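(* (a) For all integers $m,n\ge 0$ with $m+n\ge 1$, $.M.(m+25,n+38)\ge .M.(m,n)+63$. Moreover, for all integers $m,n\ge 1$: (b) $/M.(m+25,n+38)\ge /M.(m,n)+63$; (c) $\backslash M.(m+25,n+38)\ge \backslash M.(m,n)+63$; (d) $/M\backslash(m+25,n+38)\ge /M\backslash(m,n)+63$; (e) $\backslash M\backslash(m+25,n+38)\ge \backslash M\backslash(m,n)+63$, except for $(m,n)=(1,1)$; (f) $\backslash M/(m+25,n+38)\ge \backslash M/(m,n)+63$, except for $(m,n)=(2,1)$ (each inequality being asserted whenever the quantities involved are defined).
   Context: Knuth's restricted-adversary functions $\lambda M\rho(m,n)$, for $\lambda,\rho\in\{.,/,\backslash\}$ and integers $m,n\ge0$: consider sorted lists $a_1<\cdots<a_m$ and $b_1<\cdots<b_n$ (all elements distinct, interleaving unknown). Left constraint $\lambda$: "." none, "$\backslash$" known $a_1<b_1$, "/" known $a_1>b_1$; right constraint $\rho$: "." none, "$\backslash$" known $a_m<b_n$, "/" known $a_m>b_n$; a constraint on a problem with an empty list is vacuous; $\lambda M\rho(m,n)$ is defined when some interleaving satisfies the constraints. Its value is $0$ if the constraints determine the interleaving (in particular if $m=0$ or $n=0$); otherwise $\lambda M\rho(m,n)=\min_{i,j}\lambda M_{i,j}\rho(m,n)$ with $\lambda M_{i,j}\rho(m,n)=1+\max$ over admissible splittings for the comparison $a_i$ vs $b_j$ of the sum of the two subproblem values. Splittings: (S) $0\le p\le m$, $0\le q\le n$, subproblems $(a_1..a_p;b_1..b_q)$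 below $(a_{p+1}..a_m;b_{q+1}..b_n)$, values $\lambda M.(p,q)+.M\rho(m-p,n-q)$; (A) $1\le k\le m$, $1\le q\le n-1$, $b_q<a_k<b_{q+1}$, subproblems $(a_1..a_k;b_1..b_q)$ and $(a_k..a_m;b_{q+1}..b_n)$, values $\lambda M/(k,q)+\backslash M\rho(m-k+1,n-q)$; (B) $1\le p\le m-1$, $1\le l\le n$, $a_p<b_l<a_{p+1}$, subproblems $(a_1..a_p;b_1..b_l)$ and $(a_{p+1}..a_m;b_l..b_n)$, values $\lambda M\backslash(p,l)+/M\rho(m-p,n-l+1)$. A splitting is admissible if $a_i$ and $b_j$ lie in different subproblems (neither is the shared element) and some interleaving satisfies the splitting's relations together with $\lambda,\rho$.
   Formalization: The value of λMρ(m,n) is taken to be 0 only if m=0 or n=0, not whenever the constraints determine the interleaving; with the latter convention .M.(25,39) ≤ 62, so (a) would fail at (m,n)=(0,1). *)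

theory Defs
  imports Main
begin

text \<open>
  Merging \<open>a 1 < \<dots> < a m\<close> with \<open>b 1 < \<dots> < b n\<close>. An interleaving is represented by any pair of
  strictly increasing, disjoint sequences of natural numbers; only the relative order of the
  values matters, and values at indices outside \<open>{1..m}\<close> and \<open>{1..n}\<close> are irrelevant.
\<close>

definition interleaving :: "nat \<Rightarrow> nat \<Rightarrow> (nat \<Rightarrow> nat) \<Rightarrow> (nat \<Rightarrow> nat) \<Rightarrow> bool" where
  "interleaving m n a b \<longleftrightarrow>
     strict_mono_on {1..m} a \<and> strict_mono_on {1..n} b \<and> a ` {1..m} \<inter> b ` {1..n} = {}"

text \<open>\<open>Dot\<close>: no constraint; \<open>Backslash\<close>: the \<open>a\<close>-element is smaller; \<open>Slash\<close>: it is larger.\<close>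

datatype constr = Dot | Slash | Backslash

fun constr_holds :: "constr \<Rightarrow> nat \<Rightarrow> nat \<Rightarrow> bool" where
  "constr_holds Dot x y \<longleftrightarrow> True"
| "constr_holds Slash x y \<longleftrightarrow> y < x"
| "constr_holds Backslash x y \<longleftrightarrow> x < y"

definition consistent ::
    "constr \<Rightarrow> constr \<Rightarrow> nat \<Rightarrow> nat \<Rightarrow> (nat \<Rightarrow> nat) \<Rightarrow> (nat \<Rightarrow> nat) \<Rightarrow> bool" where
  "consistent l r m n a b \<longleftrightarrow> interleaving m n a b \<and>
     (1 \<le> m \<and> 1 \<le> n \<longrightarrow> constr_holds l (a 1) (b 1) \<and> constr_holds r (a m) (b n))"

definition M_defined :: "constr \<Rightarrow> constr \<Rightarrow> nat \<Rightarrow> nat \<Rightarrow> bool" where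
  "M_defined l r m n \<longleftrightarrow> (\<exists>a b. consistent l r m n a b)"

text \<open>
  \<open>Simple p q\<close> cuts after \<open>a p\<close> and \<open>b q\<close>; \<open>Share_a k q\<close> puts \<open>a k\<close> into both subproblems and cuts
  the \<open>b\<close>-list after \<open>b q\<close>; \<open>Share_b p l\<close> puts \<open>b l\<close> into both and cuts the \<open>a\<close>-list after \<open>a p\<close>.
\<close>

datatype splitting = Simple nat nat | Share_a nat nat | Share_b nat nat

fun in_range :: "nat \<Rightarrow> nat \<Rightarrow> splitting \<Rightarrow> bool" where
  "in_range m n (Simple p q) \<longleftrightarrow> p \<le> m \<and> q \<le> n"
| "in_range m n (Share_a k q) \<longleftrightarrow> 1 \<le> k \<and> k \<le> m \<and> 1 \<le> q \<and> q + 1 \<le> n"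
| "in_range m n (Share_b p l) \<longleftrightarrow> 1 \<le> p \<and> p + 1 \<le> m \<and> 1 \<le> l \<and> l \<le> n"

fun splitting_holds ::
    "nat \<Rightarrow> nat \<Rightarrow> (nat \<Rightarrow> nat) \<Rightarrow> (nat \<Rightarrow> nat) \<Rightarrow> splitting \<Rightarrow> bool" where
  "splitting_holds m n a b (Simple p q) \<longleftrightarrow>
     (\<forall>i\<in>{1..p}. \<forall>j\<in>{q+1..n}. a i < b j) \<and> (\<forall>i\<in>{p+1..m}. \<forall>j\<in>{1..q}. b j < a i)"
| "splitting_holds m n a b (Share_a k q) \<longleftrightarrow> b q < a k \<and> a k < b (q + 1)"
| "splitting_holds m n a b (Share_b p l) \<longleftrightarrow> a p < b l \<and> b l < a (p + 1)"

fun separates :: "nat \<Rightarrow> nat \<Rightarrow> splitting \<Rightarrow> bool" where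
  "separates i j (Simple p q) \<longleftrightarrow> i \<le> p \<and> q < j \<or> p < i \<and> j \<le> q"
| "separates i j (Share_a k q) \<longleftrightarrow> i < k \<and> q < j \<or> k < i \<and> j \<le> q"
| "separates i j (Share_b p l) \<longleftrightarrow> i \<le> p \<and> l < j \<or> p < i \<and> j < l"

definition admissible ::
    "constr \<Rightarrow> constr \<Rightarrow> nat \<Rightarrow> nat \<Rightarrow> nat \<Rightarrow> nat \<Rightarrow> splitting \<Rightarrow> bool" where
  "admissible l r m n i j s \<longleftrightarrow> in_range m n s \<and> separates i j s \<and>
     (\<exists>a b. consistent l r m n a b \<and> splitting_holds m n a b s)"

text \<open>
  The constraints restrict the answers the adversary may give; the merging algorithm still has to
  ask. A problem is therefore free only if one of its lists is empty, even where \<open>l\<close> and \<open>r\<close> leave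
  a single consistent interleaving: for instance \<open>M Backslash Dot 1 1\<close> is \<open>1\<close>, not \<open>0\<close>.

  If \<open>M_defined l r m n\<close> fails, no splitting is admissible and \<open>M l r m n\<close> is meaningless. Such
  arguments never arise from an admissible splitting.
\<close>

function M :: "constr \<Rightarrow> constr \<Rightarrow> nat \<Rightarrow> nat \<Rightarrow> nat" where
  "M l r m n =
     (if m = 0 \<or> n = 0 then 0
      else Min ((\<lambda>(i, j). 1 + Max ((\<lambda>s. case s of
                  Simple p q \<Rightarrow> M l Dot p q + M Dot r (m - p) (n - q)
                | Share_a k q \<Rightarrow> M l Slash k q + M Backslash r (m - k + 1) (n - q)
                | Share_b p h \<Rightarrow> M l Backslash p h + M Slash r (m - p) (n - h + 1))
              ` {s. admissible l r m n i j s}))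
            ` ({1..m} \<times> {1..n})))"
  by pat_completeness auto
termination
  by (relation "measure (\<lambda>(l, r, m, n). m + n)") (auto simp: admissible_def)

declare M.simps [simp del]

end

theory Submission
  imports Defs
begin

text \<open>
  Let the big problem extend the small one at its right end by 25 and 38 elements. A comparison inside the
  small problem is answered as there, the second part growing by induction. A comparison involving a new
  element is answered by a splitting near the end of the small problem: its first part exceeds the small
  problem by an increment \<open>M l r m n + c \<le> M l t (m + x) (n + y)\<close> valid for all \<open>l\<close>, \<open>m\<close>, \<open>n\<close> with a smaller
  shift \<open>(x, y)\<close>, and its second part has constant size. The increments needed, and lower bounds for the
  problems of constant size, form finite tables that are closed under this very argument.

  With a right constraint a few comparisons have no such answer. By reversal one may instead extend at the
  left end, and if this fails too then \<open>(m, n)\<close> is one of finitely many pairs, for which an upper bound on the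
  small problem suffices. Reversing both lists and exchanging them leave the right constraints \<open>Dot\<close> and
  \<open>Backslash\<close>, the latter for the shifts (25, 38) and (38, 25).
\<close>

section \<open>Admissible splittings\<close>

text \<open>The bound leaves no slack. Since 63 = 25 + 38 and \<open>M_tape\<close> gives at most
  \<open>m + n - 1\<close>, a problem that attains this linear bound must pay one full comparison
  for every new element.

  Finite tables suffice because every regular problem gains at least 2 per diagonal step
  (\<open>inc_diag\<close>), so that one entry serves all later points of its diagonal. The argument
  is not circular: a certificate quotes only smaller problems or smaller shifts, and the increments
  from \<open>Dot\<close> are complete before those from \<open>Backslash\<close> begin.

  What shapes the proof are small determined problems that gain too little. Type
  \<open>Backslash\<close>, \<open>Backslash\<close> of size (1, 1) is the exception in (e), and
  type \<open>Slash\<close>, \<open>Backslash\<close> of size (1, 2) under the shift (38, 25) is the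
  exception in (f) after exchanging the lists. Both may turn up as second parts of an answer that
  one would like to reuse. The first is bypassed by a cut before \<open>b n\<close>; the second
  forces the case analysis of \<open>reaches_corner\<close>.\<close>

fun fits :: "constr \<Rightarrow> constr \<Rightarrow> nat \<Rightarrow> nat \<Rightarrow> splitting \<Rightarrow> bool" where
  "fits l r m n (Simple p q) \<longleftrightarrow>
     (p = 0 \<longrightarrow> l \<noteq> Backslash) \<and> (q = 0 \<longrightarrow> l \<noteq> Slash) \<and>
     (p = m \<longrightarrow> r \<noteq> Slash) \<and> (q = n \<longrightarrow> r \<noteq> Backslash)"
| "fits l r m n (Share_a k q) \<longleftrightarrow> (l = Backslash \<longrightarrow> 2 \<le> k) \<and> (r = Slash \<longrightarrow> k < m)"
| "fits l r m n (Share_b p h) \<longleftrightarrow> (l = Slash \<longrightarrow> 2 \<le> h) \<and> (r = Backslash \<longrightarrow> h < n)"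

definition ok :: "constr \<Rightarrow> constr \<Rightarrow> nat \<Rightarrow> nat \<Rightarrow> nat \<Rightarrow> nat \<Rightarrow> splitting \<Rightarrow> bool" where
  "ok l r m n i j s \<longleftrightarrow> in_range m n s \<and> separates i j s \<and> fits l r m n s"

lemma smono: "strict_mono_on A (f :: nat \<Rightarrow> nat) \<Longrightarrow> x \<in> A \<Longrightarrow> y \<in> A \<Longrightarrow> x \<le> y \<Longrightarrow> f x \<le> f y"
  by (metis le_less strict_mono_onD)

text \<open>A cut at the end of a list already orders two end elements: \<open>p = 0\<close>
  together with \<open>separates\<close> puts \<open>b 1\<close> below \<open>a 1\<close>, and a
  shared \<open>a 1\<close> lies above \<open>b q\<close>, hence above \<open>b 1\<close>. Each
  clause of \<open>fits\<close> excludes a clash of this kind with \<open>l\<close> or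
  \<open>r\<close>; the converse shows that there is no other obstruction.\<close>

lemma admissible_imp_fits:
  assumes "admissible l r m n i j s" "1 \<le> i" "i \<le> m" "1 \<le> j" "j \<le> n"
  shows "fits l r m n s"
proof -
  obtain a b where c: "consistent l r m n a b" and h: "splitting_holds m n a b s"
    using assms by (auto simp: admissible_def)
  have sa: "strict_mono_on {1..m} a" and sb: "strict_mono_on {1..n} b"
    using c by (auto simp: consistent_def interleaving_def)
  have cl: "constr_holds l (a 1) (b 1)" "constr_holds r (a m) (b n)"
    using c assms by (auto simp: consistent_def)
  have rng: "in_range m n s" "separates i j s" using assms by (auto simp: admissible_def)
  show ?thesis
  proof (cases s)
    case (Simple p q)
    have "p = 0 \<Longrightarrow> b 1 < a 1" "q = 0 \<Longrightarrow> a 1 < b 1" "p = m \<Longrightarrow> a m < b n" "q = n \<Longrightarrow> b n < a m"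
      using Simple h rng assms by auto
    then show ?thesis using cl Simple by (cases l; cases r) auto
  next
    case (Share_a k q)
    have "b 1 \<le> b q" "b (q+1) \<le> b n" "a 1 \<le> a k" "a k \<le> a m"
      using smono[OF sb, of 1 q] smono[OF sb, of "q+1" n] smono[OF sa, of 1 k] smono[OF sa, of k m] Share_a rng by auto
    then show ?thesis using cl Share_a h rng by (cases l; cases r; cases "k = 1"; cases "k = m") auto
  next
    case (Share_b p k)
    have "a 1 \<le> a p" "a (p+1) \<le> a m" "b 1 \<le> b k" "b k \<le> b n"
      using smono[OF sa, of 1 p] smono[OF sa, of "p+1" m] smono[OF sb, of 1 k] smono[OF sb, of k n] Share_b rng by auto
    then show ?thesis using cl Share_b h rng by (cases l; cases r; cases "k = 1"; cases "k = n") auto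
  qed
qed

lemma fits_imp_admissible:
  assumes "fits l r m n s" "in_range m n s" "separates i j s" "1 \<le> i" "i \<le> m" "1 \<le> j" "j \<le> n"
  shows "admissible l r m n i j s"
proof -
  let ?N = "m + n + 1"
  have "\<exists>a b. consistent l r m n a b \<and> splitting_holds m n a b s"
  proof (cases s)
    case (Simple p q)
    \<comment> \<open>The witness places the elements in blocks starting at multiples of
      \<open>?N\<close>, which exceeds every index, so blocks do not overlap. Below the cut
      \<open>l\<close> decides which list comes first, above it \<open>r\<close> does. In the other
      two cases the block at \<open>2 * ?N\<close> is reserved for the shared element.\<close>
    define a where "a = (\<lambda>i. (if i \<le> p then (if l = Slash then ?N else 0) else (if r = Slash then 3 * ?N else 2 * ?N)) + i)"
    define b where "b = (\<lambda>j. (if j \<le> q then (if l = Slash then 0 else ?N) else (if r = Slash then 2 * ?N else 3 * ?N)) + j)"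
    have "strict_mono_on {1..m} a" "strict_mono_on {1..n} b"
      by (auto simp: strict_mono_on_def a_def b_def)
    moreover have "a ` {1..m} \<inter> b ` {1..n} = {}" by (auto simp: a_def b_def split: if_splits)
    moreover have "constr_holds l (a 1) (b 1)" "constr_holds r (a m) (b n)"
      using assms Simple by (cases l; auto simp: a_def b_def; fail) (cases r; use assms Simple in \<open>auto simp: a_def b_def\<close>; fail)
    moreover have "splitting_holds m n a b s" using assms Simple by (auto simp: a_def b_def)
    ultimately show ?thesis by (auto simp: consistent_def interleaving_def)
  next
    case (Share_a k q)
    define a where "a = (\<lambda>i. (if i < k then (if l = Slash then ?N else 0) else if i = k then 2 * ?N else (if r = Slash then 4 * ?N else 3 * ?N)) + i)"
    define b where "b = (\<lambda>j. (if j \<le> q then (if l = Slash then 0 else ?N) else (if r = Slash then 3 * ?N else 4 * ?N)) + j)"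
    have "strict_mono_on {1..m} a" "strict_mono_on {1..n} b"
      by (auto simp: strict_mono_on_def a_def b_def)
    moreover have "a ` {1..m} \<inter> b ` {1..n} = {}" by (auto simp: a_def b_def split: if_splits)
    moreover have "constr_holds l (a 1) (b 1)" "constr_holds r (a m) (b n)"
      using assms Share_a by (cases l; auto simp: a_def b_def; fail) (cases r; use assms Share_a in \<open>auto simp: a_def b_def\<close>; fail)
    moreover have "splitting_holds m n a b s" using assms Share_a by (auto simp: a_def b_def)
    ultimately show ?thesis by (auto simp: consistent_def interleaving_def)
  next
    case (Share_b p h)
    define b where "b = (\<lambda>i. (if i < h then (if l = Backslash then ?N else 0) else if i = h then 2 * ?N else (if r = Backslash then 4 * ?N else 3 * ?N)) + i)"
    define a where "a = (\<lambda>j. (if j \<le> p then (if l = Backslash then 0 else ?N) else (if r = Backslash then 3 * ?N else 4 * ?N)) + j)"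
    have "strict_mono_on {1..m} a" "strict_mono_on {1..n} b"
      by (auto simp: strict_mono_on_def a_def b_def)
    moreover have "a ` {1..m} \<inter> b ` {1..n} = {}" by (auto simp: a_def b_def split: if_splits)
    moreover have "constr_holds l (a 1) (b 1)" "constr_holds r (a m) (b n)"
      using assms Share_b by (cases l; auto simp: a_def b_def; fail) (cases r; use assms Share_b in \<open>auto simp: a_def b_def\<close>; fail)
    moreover have "splitting_holds m n a b s" using assms Share_b by (auto simp: a_def b_def)
    ultimately show ?thesis by (auto simp: consistent_def interleaving_def)
  qed
  then show ?thesis using assms by (auto simp: admissible_def)
qed

lemma admissible_iff_ok:
  assumes "1 \<le> i" "i \<le> m" "1 \<le> j" "j \<le> n"
  shows "admissible l r m n i j s \<longleftrightarrow> ok l r m n i j s"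
  using admissible_imp_fits[of l r m n i j s] fits_imp_admissible[of l r m n s i j] assms
  by (auto simp: ok_def admissible_def)

fun val :: "constr \<Rightarrow> constr \<Rightarrow> nat \<Rightarrow> nat \<Rightarrow> splitting \<Rightarrow> nat" where
  "val l r m n (Simple p q) = M l Dot p q + M Dot r (m - p) (n - q)"
| "val l r m n (Share_a k q) = M l Slash k q + M Backslash r (m - k + 1) (n - q)"
| "val l r m n (Share_b p h) = M l Backslash p h + M Slash r (m - p) (n - h + 1)"

lemma finite_in_range: "finite {s. in_range m n s}"
proof -
  have "{s. in_range m n s} \<subseteq> (\<lambda>(p, q). Simple p q) ` ({..m} \<times> {..n}) \<union>
     (\<lambda>(p, q). Share_a p q) ` ({..m} \<times> {..n}) \<union> (\<lambda>(p, q). Share_b p q) ` ({..m} \<times> {..n})"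
  proof
    fix s assume "s \<in> {s. in_range m n s}"
    then show "s \<in> (\<lambda>(p, q). Simple p q) ` ({..m} \<times> {..n}) \<union>
     (\<lambda>(p, q). Share_a p q) ` ({..m} \<times> {..n}) \<union> (\<lambda>(p, q). Share_b p q) ` ({..m} \<times> {..n})"
      by (cases s) (auto simp: image_iff)
  qed
  then show ?thesis by (rule finite_subset) auto
qed

lemma finite_ok: "finite {s. ok l r m n i j s}"
  by (rule finite_subset[OF _ finite_in_range]) (auto simp: ok_def)

lemma M_zero [simp]: "M l r 0 n = 0" "M l r m 0 = 0"
  by (simp_all add: M.simps)

text \<open>From here on \<open>M\<close> is governed by the arithmetic condition \<open>ok\<close>;
  interleavings occur again only in \<open>M_defined_imp_dfd\<close>.\<close>

lemma M_eq:
  assumes "1 \<le> m" "1 \<le> n"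
  shows "M l r m n = Min ((\<lambda>(i, j). 1 + Max (val l r m n ` {s. ok l r m n i j s})) ` ({1..m} \<times> {1..n}))"
proof -
  have v: "(\<lambda>s. case s of Simple p q \<Rightarrow> M l Dot p q + M Dot r (m - p) (n - q)
                | Share_a k q \<Rightarrow> M l Slash k q + M Backslash r (m - k + 1) (n - q)
                | Share_b p h \<Rightarrow> M l Backslash p h + M Slash r (m - p) (n - h + 1)) = val l r m n"
    by (rule ext) (simp split: splitting.split)
  have "{s. admissible l r m n i j s} = {s. ok l r m n i j s}" if "(i, j) \<in> {1..m} \<times> {1..n}" for i j
    using that admissible_iff_ok[of i m j n l r] by auto
  then show ?thesis using assms
    by (subst M.simps) (auto simp: v intro!: arg_cong[where f = Min] image_cong)
qed

lemma M_geI: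
  assumes "1 \<le> m" "1 \<le> n"
    and "\<And>i j. 1 \<le> i \<Longrightarrow> i \<le> m \<Longrightarrow> 1 \<le> j \<Longrightarrow> j \<le> n \<Longrightarrow> \<exists>s. ok l r m n i j s \<and> c \<le> 1 + val l r m n s"
  shows "c \<le> M l r m n"
proof -
  have "c \<le> 1 + Max (val l r m n ` {s. ok l r m n i j s})" if ij: "1 \<le> i" "i \<le> m" "1 \<le> j" "j \<le> n" for i j
  proof -
    obtain s where s: "ok l r m n i j s" "c \<le> 1 + val l r m n s" using assms(3)[OF ij] by blast
    then have "val l r m n s \<le> Max (val l r m n ` {s. ok l r m n i j s})"
      by (intro Max_ge finite_imageI finite_ok) auto
    then show ?thesis using s by linarith
  qed
  then show ?thesis unfolding M_eq[OF assms(1,2)] using assms(1,2)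
    by (subst Min_ge_iff) auto
qed

text \<open>
  Agrees with \<open>M_defined\<close> only when both lists are nonempty.
\<close>

definition dfd :: "constr \<Rightarrow> constr \<Rightarrow> nat \<Rightarrow> nat \<Rightarrow> bool" where
  "dfd l r m n \<longleftrightarrow> (l = Slash \<and> r = Backslash \<longrightarrow> 2 \<le> n) \<and> (l = Backslash \<and> r = Slash \<longrightarrow> 2 \<le> m)"

lemma M_defined_imp_dfd:
  assumes "M_defined l r m n" "1 \<le> m" "1 \<le> n"
  shows "dfd l r m n"
proof -
  obtain a b where "consistent l r m n a b" using assms by (auto simp: M_defined_def)
  then have "constr_holds l (a 1) (b 1)" "constr_holds r (a m) (b n)" "a 1 \<le> a m" "b 1 \<le> b n"
    using assms smono[of "{1..m}" a 1 m] smono[of "{1..n}" b 1 n]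
    by (auto simp: consistent_def interleaving_def)
  then show ?thesis using assms(2,3) unfolding dfd_def
    by (cases "m = 1"; cases "n = 1"; cases l; cases r) auto
qed

lemma ex_ok:
  assumes "dfd l r m n" "1 \<le> i" "i \<le> m" "1 \<le> j" "j \<le> n"
  shows "\<exists>s. ok l r m n i j s"
proof (cases "ok l r m n i j (Simple i (j - 1))")
  case False
  then have "ok l r m n i j (Simple (i - 1) j)"
    using assms by (cases l; cases r) (auto simp: ok_def dfd_def)
  then show ?thesis by blast
qed blast

text \<open>The counterpart of \<open>M_geI\<close>: fixing a first comparison bounds
  \<open>M\<close> by the best answer to it, which exists by \<open>ex_ok\<close>. Lower-bound
  proofs use this to borrow the adversary's best answer from a smaller or a transformed
  problem.\<close>

lemma M_le_split:
  assumes "dfd l r m n" "1 \<le> i" "i \<le> m" "1 \<le> j" "j \<le> n"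
  obtains s where "ok l r m n i j s" "M l r m n \<le> 1 + val l r m n s"
proof -
  let ?S = "{s. ok l r m n i j s}"
  have "M l r m n \<le> 1 + Max (val l r m n ` ?S)"
    using assms by (subst M_eq) (auto intro!: Min_le)
  moreover have "Max (val l r m n ` ?S) \<in> val l r m n ` ?S"
    using ex_ok[OF assms] by (intro Max_in finite_imageI finite_ok) auto
  ultimately show ?thesis using that by force
qed

lemma M_leI:
  assumes "dfd l r m n" "1 \<le> i" "i \<le> m" "1 \<le> j" "j \<le> n"
    and "\<And>s. ok l r m n i j s \<Longrightarrow> 1 + val l r m n s \<le> c"
  shows "M l r m n \<le> c"
  using M_le_split[OF assms(1-5)] assms(6) by (metis le_trans)

section \<open>Reversing both lists and exchanging them\<close>

fun flip :: "constr \<Rightarrow> constr" where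
  "flip Dot = Dot" | "flip Slash = Backslash" | "flip Backslash = Slash"

lemma flip_flip [simp]: "flip (flip c) = c" by (cases c) auto
lemma flip_eq [simp]: "flip c = Dot \<longleftrightarrow> c = Dot" "flip c = Slash \<longleftrightarrow> c = Backslash" "flip c = Backslash \<longleftrightarrow> c = Slash"
  by (cases c; simp)+

text \<open>Keeps inductions inside the defined problems. Only splittings with a shared element are
  listed, since both parts of a \<open>Simple\<close> splitting carry a \<open>Dot\<close>.\<close>

lemma ok_dfd:
  assumes "ok l r m n i j s"
  shows "s = Share_a p q \<Longrightarrow> dfd l Slash p q \<and> dfd Backslash r (m - p + 1) (n - q)"
    "s = Share_b p q \<Longrightarrow> dfd l Backslash p q \<and> dfd Slash r (m - p) (n - q + 1)"
  using assms by (auto simp: ok_def dfd_def)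

lemma ok_SimpleD:
  assumes "ok l r m n i j (Simple p q)" "1 \<le> i" "i \<le> m" "1 \<le> j" "j \<le> n"
  shows "p \<le> m \<and> q \<le> n \<and> p + q < m + n \<and> 0 < p + q"
proof -
  have "p \<le> m \<and> q \<le> n \<and> (i \<le> p \<and> q < j \<or> p < i \<and> j \<le> q)" using assms by (simp add: ok_def)
  then show ?thesis using assms by linarith
qed

lemma dfd_Dot [simp]: "dfd l Dot m n" "dfd Dot r m n" by (auto simp: dfd_def)

fun rvs :: "nat \<Rightarrow> nat \<Rightarrow> splitting \<Rightarrow> splitting" where
  "rvs m n (Simple p q) = Simple (m - p) (n - q)"
| "rvs m n (Share_a k q) = Share_a (m - k + 1) (n - q)"
| "rvs m n (Share_b p h) = Share_b (m - p) (n - h + 1)"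

lemma ok_rvs:
  assumes "ok l r m n (m + 1 - i) (n + 1 - j) s" "1 \<le> i" "i \<le> m" "1 \<le> j" "j \<le> n"
  shows "ok (flip r) (flip l) m n i j (rvs m n s)"
  using assms by (cases s) (auto simp: ok_def)

text \<open>Reversal turns last elements into first ones and every \<open><\<close> into
  \<open>>\<close>, so the two constraints are exchanged and flipped. Mirroring the best answer by
  \<open>rvs\<close> gives one inequality; as reversal is an involution, \<open>M_rev\<close>
  follows.\<close>

lemma M_rev_le:
  "dfd l r m n \<Longrightarrow> M l r m n \<le> M (flip r) (flip l) m n"
proof (induction "m + n" arbitrary: l r m n rule: less_induct)
  case less
  show ?case
  proof (cases "m = 0 \<or> n = 0")
    case False
    show ?thesis
    proof (rule M_geI)
      fix i j assume ij: "1 \<le> i" "i \<le> m" "1 \<le> j" "j \<le> n"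
      have ij': "1 \<le> m + 1 - i" "m + 1 - i \<le> m" "1 \<le> n + 1 - j" "n + 1 - j \<le> n" using ij by auto
      obtain s where s: "ok l r m n (m + 1 - i) (n + 1 - j) s" "M l r m n \<le> 1 + val l r m n s"
        using M_le_split[OF less.prems ij'] by blast
      note d = ok_dfd[OF s(1)]
      have "val l r m n s \<le> val (flip r) (flip l) m n (rvs m n s)"
      proof (cases s)
        case (Simple p q)
        then have "p \<le> m" "q \<le> n" "p + q < m + n" "0 < p + q" using ok_SimpleD[OF _ ij'] s(1) by blast+
        then show ?thesis using Simple less.hyps[of p q l Dot] less.hyps[of "m - p" "n - q" Dot r]
          by (auto simp: add.commute[of "M (flip r) _ _ _"] intro!: add_mono)
      next
        case (Share_a k q)
        then have *: "k \<le> m" "1 \<le> k" "1 \<le> q" "q < n" using s(1) by (auto simp: ok_def)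
        then show ?thesis using Share_a less.hyps[of k q l Slash] less.hyps[of "m - k + 1" "n - q" Backslash r] d(1)
          by (auto simp: add.commute[of "M (flip r) _ _ _"] intro!: add_mono)
      next
        case (Share_b p h)
        then have *: "p < m" "1 \<le> p" "1 \<le> h" "h \<le> n" using s(1) by (auto simp: ok_def)
        then show ?thesis using Share_b less.hyps[of p h l Backslash] less.hyps[of "m - p" "n - h + 1" Slash r] d(2)
          by (auto simp: add.commute[of "M (flip r) _ _ _"] intro!: add_mono)
      qed
      then show "\<exists>s. ok (flip r) (flip l) m n i j s \<and> M l r m n \<le> 1 + val (flip r) (flip l) m n s"
        using ok_rvs[OF s(1) ij] s(2) by (intro exI[of _ "rvs m n s"]) auto
    qed (use False in auto)
  qed auto
qed

lemma dfd_rev: "dfd (flip r) (flip l) m n = dfd l r m n" by (auto simp: dfd_def)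

lemma M_rev: "dfd l r m n \<Longrightarrow> M (flip r) (flip l) m n = M l r m n"
  using M_rev_le[of l r m n] M_rev_le[of "flip r" "flip l" m n] by (auto simp: dfd_rev intro: le_antisym)

fun sws :: "splitting \<Rightarrow> splitting" where
  "sws (Simple p q) = Simple q p"
| "sws (Share_a k q) = Share_b q k"
| "sws (Share_b p h) = Share_a h p"

lemma ok_sws: "ok l r m n j i s \<Longrightarrow> ok (flip l) (flip r) n m i j (sws s)"
  by (cases s) (auto simp: ok_def)

text \<open>Exchanging the lists keeps left and right apart but turns every relation between an
  \<open>a\<close> and a \<open>b\<close> round, and a shared \<open>a\<close> becomes a shared
  \<open>b\<close>.\<close>

lemma M_swap_le: "dfd l r m n \<Longrightarrow> M l r m n \<le> M (flip l) (flip r) n m"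
proof (induction "m + n" arbitrary: l r m n rule: less_induct)
  case less
  show ?case
  proof (cases "m = 0 \<or> n = 0")
    case False
    show ?thesis
    proof (rule M_geI)
      fix i j assume ij: "1 \<le> i" "i \<le> n" "1 \<le> j" "j \<le> m"
      obtain s where s: "ok l r m n j i s" "M l r m n \<le> 1 + val l r m n s"
        using M_le_split[OF less.prems ij(3,4,1,2)] by blast
      note d = ok_dfd[OF s(1)]
      have "val l r m n s \<le> val (flip l) (flip r) n m (sws s)"
      proof (cases s)
        case (Simple p q)
        then have "p \<le> m" "q \<le> n" "p + q < m + n" "0 < p + q" using ok_SimpleD[OF _ ij(3,4,1,2)] s(1) by blast+
        then show ?thesis using Simple less.hyps[of p q l Dot] less.hyps[of "m - p" "n - q" Dot r]
          by (auto intro!: add_mono)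
      next
        case (Share_a k q)
        then have *: "k \<le> m" "1 \<le> k" "1 \<le> q" "q < n" using s(1) by (auto simp: ok_def)
        then show ?thesis using Share_a less.hyps[of k q l Slash] less.hyps[of "m - k + 1" "n - q" Backslash r] d(1)
          by (auto intro!: add_mono)
      next
        case (Share_b p h)
        then have *: "p < m" "1 \<le> p" "1 \<le> h" "h \<le> n" using s(1) by (auto simp: ok_def)
        then show ?thesis using Share_b less.hyps[of p h l Backslash] less.hyps[of "m - p" "n - h + 1" Slash r] d(2)
          by (auto intro!: add_mono)
      qed
      then show "\<exists>s. ok (flip l) (flip r) n m i j s \<and> M l r m n \<le> 1 + val (flip l) (flip r) n m s"
        using ok_sws[OF s(1)] s(2) by (intro exI[of _ "sws s"]) auto
    qed (use False in auto)
  qed auto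
qed

lemma dfd_swap: "dfd (flip l) (flip r) n m = dfd l r m n" by (auto simp: dfd_def)

lemma M_swap: "dfd l r m n \<Longrightarrow> M (flip l) (flip r) n m = M l r m n"
  using M_swap_le[of l r m n] M_swap_le[of "flip l" "flip r" n m] by (auto simp: dfd_swap intro: le_antisym)

section \<open>Monotonicity and elementary bounds\<close>

lemma M_mono_Suc: "dfd l r m n \<Longrightarrow> M l r m n \<le> M l r m (n + 1)"
proof (induction "m + n" arbitrary: l r m n rule: less_induct)
  case less
  show ?case
  proof (cases "m = 0 \<or> n = 0")
    case False
    show ?thesis
    proof (rule M_geI)
      fix i j assume ij: "1 \<le> i" "i \<le> m" "1 \<le> j" "j \<le> n + 1"
      \<comment> \<open>A comparison with the new \<open>b (n + 1)\<close> is answered like one with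
        \<open>b n\<close>. Only a \<open>Simple p n\<close> that puts \<open>b n\<close> below
        \<open>a i\<close> has to be changed: its cut moves on to \<open>n + 1\<close>.\<close>
      define j' where "j' = min j n"
      have j': "1 \<le> j'" "j' \<le> n" "j' \<le> j" "j' < n \<Longrightarrow> j' = j" "j \<noteq> j' \<Longrightarrow> j' = n \<and> j = n + 1"
        using ij False by (auto simp: j'_def)
      obtain s where s: "ok l r m n i j' s" "M l r m n \<le> 1 + val l r m n s"
        using M_le_split[OF less.prems ij(1,2) j'(1,2)] by blast
      note d = ok_dfd[OF s(1)]
      have "\<exists>t. ok l r m (n + 1) i j t \<and> val l r m n s \<le> val l r m (n + 1) t"
      proof (cases s)
        case (Simple p q)
        note b = ok_SimpleD[OF s(1)[unfolded Simple] ij(1,2) j'(1,2)]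
        show ?thesis
        proof (cases "p < i \<and> j = n + 1 \<and> q = n")
          case True
          then show ?thesis using Simple s(1) less.hyps[of p n l Dot] ij
            by (intro exI[of _ "Simple p (n + 1)"]) (auto simp: ok_def)
        next
          case False
          then have "ok l r m (n + 1) i j (Simple p q)" using Simple s(1) j' ij by (auto simp: ok_def)
          moreover have "M Dot r (m - p) (n - q) \<le> M Dot r (m - p) (n + 1 - q)"
            using less.hyps[of "m - p" "n - q" Dot r] b by (auto simp: Suc_diff_le)
          ultimately show ?thesis using Simple by (intro exI[of _ "Simple p q"]) auto
        qed
      next
        case (Share_a k q)
        then have b: "1 \<le> k" "k \<le> m" "1 \<le> q" "q < n" using s(1) by (auto simp: ok_def)
        have "ok l r m (n + 1) i j (Share_a k q)" using Share_a s(1) j' ij by (auto simp: ok_def)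
        moreover have "M Backslash r (m - k + 1) (n - q) \<le> M Backslash r (m - k + 1) (n + 1 - q)"
          using less.hyps[of "m - k + 1" "n - q" Backslash r] b d(1)[OF Share_a] by (auto simp: Suc_diff_le)
        ultimately show ?thesis using Share_a by (intro exI[of _ "Share_a k q"]) auto
      next
        case (Share_b p h)
        then have b: "1 \<le> p" "p < m" "1 \<le> h" "h \<le> n" using s(1) by (auto simp: ok_def)
        have "ok l r m (n + 1) i j (Share_b p h)" using Share_b s(1) j' ij by (auto simp: ok_def)
        moreover have "M Slash r (m - p) (n - h + 1) \<le> M Slash r (m - p) (n + 1 - h + 1)"
          using less.hyps[of "m - p" "n - h + 1" Slash r] b d(2)[OF Share_b] by (auto simp: Suc_diff_le)
        ultimately show ?thesis using Share_b by (intro exI[of _ "Share_b p h"]) auto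
      qed
      then show "\<exists>s. ok l r m (n + 1) i j s \<and> M l r m n \<le> 1 + val l r m (n + 1) s"
        using s(2) by (meson add_le_cancel_left le_trans)
    qed (use False in auto)
  qed auto
qed

lemma dfd_mono: "dfd l r m n \<Longrightarrow> m \<le> m' \<Longrightarrow> n \<le> n' \<Longrightarrow> dfd l r m' n'"
  by (auto simp: dfd_def)

lemma M_mono_right: "dfd l r m n \<Longrightarrow> M l r m n \<le> M l r m (n + k)"
proof (induction k)
  case (Suc k)
  have "M l r m (n + k) \<le> M l r m (n + k + 1)"
    by (rule M_mono_Suc) (use Suc.prems dfd_mono in force)
  then show ?case using Suc by simp
qed simp

lemma M_mono:
  assumes "dfd l r m n" "m \<le> m'" "n \<le> n'"
  shows "M l r m n \<le> M l r m' n'"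
proof -
  have "M l r m n \<le> M l r m n'" using M_mono_right[OF assms(1), of "n' - n"] assms(3) by simp
  also have "\<dots> \<le> M l r m' n'"
    using M_mono_right[of "flip l" "flip r" n' m "m' - m"] assms(2) dfd_mono[OF assms(1) le_refl assms(3)]
      dfd_mono[OF assms] M_swap[of l r m n'] M_swap[of l r m' n'] by (simp add: dfd_swap)
  finally show ?thesis .
qed

text \<open>Dropping a constraint only enlarges the adversary's choice: the best splitting stays
  available, and its second part grows by induction.\<close>

lemma M_le_Dot: "dfd l r m n \<Longrightarrow> M l r m n \<le> M l Dot m n"
proof (induction "m + n" arbitrary: l m n rule: less_induct)
  case less
  show ?case
  proof (cases "m = 0 \<or> n = 0")
    case False
    show ?thesis
    proof (rule M_geI)
      fix i j assume ij: "1 \<le> i" "i \<le> m" "1 \<le> j" "j \<le> n"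
      obtain s where s: "ok l r m n i j s" "M l r m n \<le> 1 + val l r m n s"
        using M_le_split[OF less.prems ij] by blast
      note d = ok_dfd[OF s(1)]
      have "ok l Dot m n i j s" using s(1) by (cases s) (auto simp: ok_def)
      moreover have "val l r m n s \<le> val l Dot m n s"
      proof (cases s)
        case (Simple p q)
        then show ?thesis using ok_SimpleD[OF s(1)[unfolded Simple] ij] less.hyps[of "m - p" "n - q" Dot] by auto
      next
        case (Share_a k q)
        then have b: "1 \<le> k" "k \<le> m" "1 \<le> q" "q < n" using s(1) by (auto simp: ok_def)
        then show ?thesis using Share_a less.hyps[of "m - k + 1" "n - q" Backslash] d(1)[OF Share_a] by auto
      next
        case (Share_b p h)
        then have b: "1 \<le> p" "p < m" "1 \<le> h" "h \<le> n" using s(1) by (auto simp: ok_def)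
        then show ?thesis using Share_b less.hyps[of "m - p" "n - h + 1" Slash] d(2)[OF Share_b] by auto
      qed
      ultimately show "\<exists>s. ok l Dot m n i j s \<and> M l r m n \<le> 1 + val l Dot m n s"
        using s(2) by (intro exI[of _ s]) auto
    qed (use False in auto)
  qed auto
qed

text \<open>Ask for \<open>a m\<close> against \<open>b n\<close>, although the answer is known. No
  splitting with a shared element separates the two last elements, so only \<open>Simple p n\<close>
  with \<open>p < m\<close> remains, and its second part contains no \<open>b\<close>.\<close>

lemma M_Slash_le:
  assumes "dfd l Slash m n" "1 \<le> m" "1 \<le> n"
  shows "M l Slash m n \<le> 1 + M l Dot (m - 1) n"
proof (rule M_leI[OF assms(1), of m n])
  fix s assume s: "ok l Slash m n m n s"
  then obtain p where p: "s = Simple p n" "p < m" by (cases s) (auto simp: ok_def)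
  then show "1 + val l Slash m n s \<le> 1 + M l Dot (m - 1) n"
    using M_mono[of l Dot p n "m - 1" n] by auto
qed (use assms in auto)

lemma M_Backslash_le:
  assumes "dfd l Backslash m n" "1 \<le> m" "1 \<le> n"
  shows "M l Backslash m n \<le> 1 + M l Dot m (n - 1)"
  using M_Slash_le[of "flip l" n m] M_swap[OF assms(1)] M_swap[of l Dot m "n - 1"] assms
    dfd_swap[of l Backslash n m] by simp

lemma M_Dot_le:
  assumes "1 \<le> m" "1 \<le> n"
  shows "M l Dot m n \<le> 1 + max (M l Dot m (n - 1)) (M l Dot (m - 1) n)"
proof (rule M_leI[of _ _ _ _ m n])
  fix s assume s: "ok l Dot m n m n s"
  then obtain p where p: "s = Simple p n \<and> p \<le> m - 1 \<or> s = Simple m p \<and> p \<le> n - 1" by (cases s) (auto simp: ok_def)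
  then show "1 + val l Dot m n s \<le> 1 + max (M l Dot m (n - 1)) (M l Dot (m - 1) n)"
    using M_mono[of l Dot p n "m - 1" n] M_mono[of l Dot m p m "n - 1"] by (auto simp: le_max_iff_disj)
qed (use assms in auto)

section \<open>Values of the smallest problems\<close>

lemma M_ge_1:
  assumes "dfd l r m n" "1 \<le> m" "1 \<le> n"
  shows "1 \<le> M l r m n"
  using assms(2,3) by (rule M_geI) (use ex_ok[OF assms(1)] in auto)

lemma M_Slash_Dot_1: "M Slash Dot m 1 \<le> 1"
proof (cases "m = 0")
  case False
  show ?thesis
  proof (rule M_leI[of _ _ _ _ 1 1])
    fix s assume "ok Slash Dot m 1 1 1 s"
    then have "s = Simple 0 1" by (cases s) (auto simp: ok_def)
    then show "1 + val Slash Dot m 1 s \<le> 1" by simp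
  qed (use False in auto)
qed simp

lemma M_Backslash_Dot_1: "M Backslash Dot 1 n \<le> 1"
  using M_Slash_Dot_1[of n] M_swap[of Slash Dot n 1] by simp

lemma M_Dot_2_1: "2 \<le> M Dot Dot 2 1"
proof (rule M_geI)
  fix i j :: nat assume ij: "1 \<le> i" "i \<le> 2" "1 \<le> j" "j \<le> 1"
  have "ok Dot Dot 2 1 i j (Simple 1 (i - 1))" using ij by (auto simp: ok_def)
  moreover have "2 \<le> 1 + val Dot Dot 2 1 (Simple 1 (i - 1))"
  proof (cases "i = 1")
    case False
    then have "i = 2" using ij by simp
    then show ?thesis using M_ge_1[of Dot Dot 1 1] by simp
  qed (use M_ge_1[of Dot Dot 1 1] in simp)
  ultimately show "\<exists>s. ok Dot Dot 2 1 i j s \<and> 2 \<le> 1 + val Dot Dot 2 1 s" by blast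
qed auto

lemma M_Slash_Dot_1_2: "2 \<le> M Slash Dot 1 2"
proof (rule M_geI)
  fix i j :: nat assume ij: "1 \<le> i" "i \<le> 1" "1 \<le> j" "j \<le> 2"
  have "ok Slash Dot 1 2 i j (Simple (j - 1) 1)" using ij by (auto simp: ok_def)
  moreover have "2 \<le> 1 + val Slash Dot 1 2 (Simple (j - 1) 1)"
  proof (cases "j = 1")
    case False
    then have "j = 2" using ij by simp
    then show ?thesis using M_ge_1[of Slash Dot 1 1] by simp
  qed (use M_ge_1[of Dot Dot 1 1] in simp)
  ultimately show "\<exists>s. ok Slash Dot 1 2 i j s \<and> 2 \<le> 1 + val Slash Dot 1 2 s" by blast
qed auto

lemma M_Slash_Dot_2_2: "3 \<le> M Slash Dot 2 2"
proof (rule M_geI)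
  fix i j :: nat assume ij: "1 \<le> i" "i \<le> 2" "1 \<le> j" "j \<le> 2"
  consider "j = 1" | "i = 1" "j = 2" | "i = 2" "j = 2" using ij by linarith
  then show "\<exists>s. ok Slash Dot 2 2 i j s \<and> 3 \<le> 1 + val Slash Dot 2 2 s"
  proof cases
    case 1
    then show ?thesis using M_Dot_2_1 ij by (intro exI[of _ "Simple 0 1"]) (auto simp: ok_def)
  next
    case 2
    then show ?thesis using M_ge_1[of Dot Dot 1 1] M_ge_1[of Slash Dot 1 1]
      by (intro exI[of _ "Simple 1 1"]) (auto simp: ok_def)
  next
    case 3
    then show ?thesis using M_Slash_Dot_1_2
      by (intro exI[of _ "Simple 1 2"]) (auto simp: ok_def)
  qed
qed auto

text \<open>
  The nonempty problems excluded by \<open>reg\<close> have \<open>M l Dot m n\<close> at most 1, however long the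
  other list is, and the increments below fail for them.
\<close>

definition reg :: "constr \<Rightarrow> nat \<Rightarrow> nat \<Rightarrow> bool" where
  "reg l m n \<longleftrightarrow> 1 \<le> m \<and> 1 \<le> n \<and> (l = Backslash \<longrightarrow> 2 \<le> m) \<and> (l = Slash \<longrightarrow> 2 \<le> n)"

lemma reg_swap: "reg (flip l) n m = reg l m n" by (auto simp: reg_def)

lemma reg_mono: "reg l m n \<Longrightarrow> m \<le> m' \<Longrightarrow> n \<le> n' \<Longrightarrow> reg l m' n'" by (auto simp: reg_def)

lemma reg_dfd: "reg l m n \<Longrightarrow> dfd l r m n" by (auto simp: reg_def dfd_def)

section \<open>Growth by 2 along the diagonal\<close>

text \<open>Going back to \<open>(m, n - 1)\<close> loses at most 1, and the diagonal step from
  there to \<open>(m + 1, n)\<close> wins 2. Where \<open>(m, n - 1)\<close> is not regular, the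
  second assumption bounds \<open>M l Dot m n\<close> by 1 or 2, and the small values above exceed
  this by 1.\<close>

lemma M_Dot_diag_aux:
  assumes "reg l m n" "M l Dot m n \<le> 1 + M l Dot m (n - 1)"
    and "\<And>n'. n' < n \<Longrightarrow> reg l m n' \<Longrightarrow> M l Dot m n' + 2 \<le> M l Dot (m + 1) (n' + 1)"
  shows "M l Dot m n + 1 \<le> M l Dot (m + 1) n"
proof -
  have "reg l m (n - 1) \<and> 2 \<le> n \<or> n = 1 \<and> l \<noteq> Slash \<or> l = Slash \<and> n = 2"
    using assms(1) by (cases "n = 1"; cases "n = 2") (auto simp: reg_def)
  then consider "reg l m (n - 1)" "2 \<le> n" | "n = 1" "l \<noteq> Slash" | "l = Slash" "n = 2" by blast
  then show ?thesis
  proof cases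
    case 1
    then show ?thesis using assms(2) assms(3)[of "n - 1"] by simp
  next
    case 2
    have m: "1 \<le> m" "l = Backslash \<longrightarrow> 2 \<le> m" using assms(1) by (auto simp: reg_def)
    have "2 \<le> M l Dot (m + 1) 1"
    proof (cases l)
      case Dot
      then show ?thesis using M_Dot_2_1 M_mono[of Dot Dot 2 1 "m + 1" 1] m by simp
    next
      case Backslash
      then show ?thesis using M_Slash_Dot_1_2 M_swap[of Slash Dot 1 2] M_mono[of Backslash Dot 2 1 "m + 1" 1] m by simp
    qed (use 2 in simp)
    then show ?thesis using 2 assms(2) by simp
  next
    case 3
    have "3 \<le> M l Dot (m + 1) n"
      using M_Slash_Dot_2_2 M_mono[of Slash Dot 2 2 "m + 1" 2] 3 assms(1) by (simp add: reg_def)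
    then show ?thesis using 3 assms(2) M_Slash_Dot_1[of m] by simp
  qed
qed

text \<open>Old cells keep their answer, and cells with one new element are cut at
  \<open>(m, n)\<close>, which leaves a \<open>(1, 1)\<close> problem behind. For the two new
  elements, \<open>M_Dot_le\<close> tells whether \<open>(m, n - 1)\<close> or
  \<open>(m - 1, n)\<close> comes within 1 of the value at \<open>(m, n)\<close>; the adversary then
  makes the new element of the list shortened there the largest of all.\<close>

lemma M_Dot_diag: "reg l m n \<Longrightarrow> M l Dot m n + 2 \<le> M l Dot (m + 1) (n + 1)"
proof (induction "m + n" arbitrary: l m n rule: less_induct)
  case less
  have r: "1 \<le> m" "1 \<le> n" "l = Backslash \<Longrightarrow> 2 \<le> m" "l = Slash \<Longrightarrow> 2 \<le> n"
    using less.prems by (auto simp: reg_def)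
  show ?case
  proof (rule M_geI)
    fix i j assume ij: "1 \<le> i" "i \<le> m + 1" "1 \<le> j" "j \<le> n + 1"
    have one: "1 \<le> M Dot Dot 1 1" by (rule M_ge_1) auto
    consider "i \<le> m" "j \<le> n" | "i \<le> m" "j = n + 1" | "i = m + 1" "j \<le> n" | "i = m + 1" "j = n + 1"
      using ij by linarith
    then show "\<exists>s. ok l Dot (m + 1) (n + 1) i j s \<and> M l Dot m n + 2 \<le> 1 + val l Dot (m + 1) (n + 1) s"
    proof cases
      case 1
      obtain s where s: "ok l Dot m n i j s" "M l Dot m n \<le> 1 + val l Dot m n s"
        using M_le_split[of l Dot m n i j] 1 ij by auto
      have "ok l Dot (m + 1) (n + 1) i j s" using s(1) by (cases s) (auto simp: ok_def)
      moreover have "val l Dot m n s + 2 \<le> val l Dot (m + 1) (n + 1) s"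
      proof (cases s)
        case (Simple p q)
        note b = ok_SimpleD[OF s(1)[unfolded Simple] ij(1) 1(1) ij(3) 1(2)]
        have "M Dot Dot (m - p) (n - q) + 2 \<le> M Dot Dot (m - p + 1) (n - q + 1)"
        proof (cases "reg Dot (m - p) (n - q)")
          case True
          then show ?thesis using less.hyps[of "m - p" "n - q" Dot] b by auto
        next
          case False
          then have "(m - p = 0 \<and> 1 \<le> n - q) \<or> (n - q = 0 \<and> 1 \<le> m - p)" using b by (auto simp: reg_def)
          then show ?thesis
            using M_Dot_2_1 M_swap[of Dot Dot 2 1] M_mono[of Dot Dot 1 2 1 "n - q + 1"] M_mono[of Dot Dot 2 1 "m - p + 1" 1]
            by auto
        qed
        then show ?thesis using Simple b by (simp add: Suc_diff_le)
      next
        case (Share_a k q)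
        then have b: "1 \<le> k" "k \<le> m" "1 \<le> q" "q < n" using s(1) by (auto simp: ok_def)
        have "M Backslash Dot (m - k + 1) (n - q) + 2 \<le> M Backslash Dot (m - k + 1 + 1) (n - q + 1)"
        proof (cases "k = m")
          case True
          have "2 \<le> n - q + 1" using b by linarith
          from M_mono[OF _ order.refl this, of Backslash Dot 2] have "3 \<le> M Backslash Dot 2 (n - q + 1)"
            using M_Slash_Dot_2_2 M_swap[of Slash Dot 2 2] by simp
          then show ?thesis using True M_Backslash_Dot_1[of "n - q"] by (simp add: numeral_2_eq_2)
        next
          case False
          have "m - k + 1 + (n - q) < m + n" using b by linarith
          moreover have "reg Backslash (m - k + 1) (n - q)" using b False by (auto simp: reg_def)
          ultimately show ?thesis by (rule less.hyps[OF _])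
        qed
        then show ?thesis using Share_a b by (simp add: Suc_diff_le)
      next
        case (Share_b p h)
        then have b: "1 \<le> p" "p < m" "1 \<le> h" "h \<le> n" using s(1) by (auto simp: ok_def)
        have "M Slash Dot (m - p) (n - h + 1) + 2 \<le> M Slash Dot (m - p + 1) (n - h + 1 + 1)"
        proof (cases "h = n")
          case True
          have "2 \<le> m - p + 1" using b by linarith
          from M_mono[OF _ this order.refl, of Slash Dot 2] have "3 \<le> M Slash Dot (m - p + 1) 2"
            using M_Slash_Dot_2_2 by simp
          then show ?thesis using True M_Slash_Dot_1[of "m - p"] by (simp add: numeral_2_eq_2)
        next
          case False
          have "m - p + (n - h + 1) < m + n" using b by linarith
          moreover have "reg Slash (m - p) (n - h + 1)" using b False by (auto simp: reg_def)
          ultimately show ?thesis by (rule less.hyps[OF _])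
        qed
        then show ?thesis using Share_b b by (simp add: Suc_diff_le)
      qed
      ultimately show ?thesis using s(2) by (intro exI[of _ s]) auto
    next
      case 2
      then show ?thesis using one ij r by (intro exI[of _ "Simple m n"]) (auto simp: ok_def)
    next
      case 3
      then show ?thesis using one ij r by (intro exI[of _ "Simple m n"]) (auto simp: ok_def)
    next
      case 4
      have "M l Dot m n \<le> 1 + M l Dot m (n - 1) \<or> M l Dot m n \<le> 1 + M l Dot (m - 1) n"
        using M_Dot_le[OF r(1,2), of l] by linarith
      then show ?thesis
      proof
        assume "M l Dot m n \<le> 1 + M l Dot m (n - 1)"
        then have "M l Dot m n + 1 \<le> M l Dot (m + 1) n"
          by (rule M_Dot_diag_aux[OF less.prems]) (use less.hyps in auto)
        then show ?thesis using 4 r by (intro exI[of _ "Simple (m + 1) n"]) (auto simp: ok_def)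
      next
        assume a: "M l Dot m n \<le> 1 + M l Dot (m - 1) n"
        have "M (flip l) Dot n m + 1 \<le> M (flip l) Dot (n + 1) m"
        proof (rule M_Dot_diag_aux)
          show "reg (flip l) n m" using less.prems by (simp add: reg_swap)
          show "M (flip l) Dot n m \<le> 1 + M (flip l) Dot n (m - 1)"
            using a M_swap[of l Dot m n] M_swap[of l Dot "m - 1" n] by simp
          show "M (flip l) Dot n m' + 2 \<le> M (flip l) Dot (n + 1) (m' + 1)"
            if "m' < m" "reg (flip l) n m'" for m'
            using less.hyps[of m' n l] that M_swap[of l Dot m' n] M_swap[of l Dot "m' + 1" "n + 1"]
            by (simp add: reg_swap)
        qed
        then have "M l Dot m n + 1 \<le> M l Dot m (n + 1)"
          using M_swap[of l Dot m n] M_swap[of l Dot m "n + 1"] by simp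
        then show ?thesis using 4 r by (intro exI[of _ "Simple m (n + 1)"]) (auto simp: ok_def)
      qed
    qed
  qed auto
qed

text \<open>The diagonal step gains 2, while \<open>M_Dot_le\<close> at
  \<open>(m + 1, n + 1)\<close> allows only 1 above the larger of the two neighbours. Which
  neighbour that is remains unknown.\<close>

lemma M_Dot_step:
  assumes "reg l m n"
  shows "M l Dot m n + 1 \<le> M l Dot (m + 1) n \<or> M l Dot m n + 1 \<le> M l Dot m (n + 1)"
  using M_Dot_diag[OF assms] M_Dot_le[of "m + 1" "n + 1" l] by simp linarith

section \<open>Extending a problem at its right end\<close>

text \<open>\<open>r\<close> and \<open>t\<close> may differ because the first part of a splitting
  ends with the constraint created by the cut, not with that of the whole problem. For the same
  reason second parts begin with varying constraints, so the claim has to be uniform in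
  \<open>l\<close>.\<close>

definition inc :: "constr \<Rightarrow> constr \<Rightarrow> nat \<Rightarrow> nat \<Rightarrow> nat \<Rightarrow> bool" where
  "inc r t x y c \<longleftrightarrow> (\<forall>l m n. reg l m n \<longrightarrow> M l r m n + c \<le> M l t (m + x) (n + y))"

lemma incD: "inc r t x y c \<Longrightarrow> reg l m n \<Longrightarrow> M l r m n + c \<le> M l t (m + x) (n + y)"
  by (simp add: inc_def)

lemma inc_swap: "inc (flip r) (flip t) y x c \<longleftrightarrow> inc r t x y c"
proof -
  have *: "inc (flip r) (flip t) y x c" if "inc r t x y c" for r t x y c
    unfolding inc_def
  proof (intro allI impI)
    fix l m n assume r: "reg l m n"
    then have r': "reg (flip l) n m" by (simp add: reg_swap)
    have "reg (flip l) (n + x) (m + y)" by (rule reg_mono[OF r']) auto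
    then show "M l (flip r) m n + c \<le> M l (flip t) (m + y) (n + x)"
      using incD[OF that r'] M_swap[OF reg_dfd[OF r'], of r] M_swap[of "flip l" t "n + x" "m + y"]
        reg_dfd by simp
  qed
  show ?thesis using *[of r t x y c] *[of "flip r" "flip t" y x c] by auto
qed

lemma inc_trans:
  assumes "inc r s x y c" "inc s t x' y' c'"
  shows "inc r t (x + x') (y + y') (c + c')"
  unfolding inc_def
proof (intro allI impI)
  fix l m n assume r: "reg l m n"
  have r': "reg l (m + x) (n + y)" by (rule reg_mono[OF r]) auto
  show "M l r m n + (c + c') \<le> M l t (m + (x + x')) (n + (y + y'))"
    using incD[OF assms(1) r] incD[OF assms(2) r'] by (simp add: add.assoc)
qed

text \<open>Isolates one comparison from \<open>M_geI\<close>, so that different cells can be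
  settled by different arguments.\<close>

definition reaches :: "constr \<Rightarrow> constr \<Rightarrow> nat \<Rightarrow> nat \<Rightarrow> nat \<Rightarrow> nat \<Rightarrow> nat \<Rightarrow> bool" where
  "reaches l r m n i j c \<longleftrightarrow> (\<exists>s. ok l r m n i j s \<and> c \<le> 1 + val l r m n s)"

lemma reachesI: "ok l r m n i j s \<Longrightarrow> c \<le> 1 + val l r m n s \<Longrightarrow> reaches l r m n i j c"
  by (auto simp: reaches_def)

lemma M_ge_reaches:
  assumes "1 \<le> m" "1 \<le> n"
    and "\<And>i j. 1 \<le> i \<Longrightarrow> i \<le> m \<Longrightarrow> 1 \<le> j \<Longrightarrow> j \<le> n \<Longrightarrow> reaches l r m n i j c"
  shows "c \<le> M l r m n"
  using assms by (intro M_geI) (auto simp: reaches_def)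

text \<open>The best answer of the small problem is reused: its first part is unchanged and its
  second part takes up the whole shift. The bounds \<open>caps\<close> replace \<open>IH\<close>
  where the second part is not regular, being empty in one list or of value at most 1 because it
  begins with a shared element.\<close>

lemma transplant_Dot:
  assumes IH: "\<And>l' m' n'. m' + n' < m + n \<Longrightarrow> reg l' m' n' \<Longrightarrow> M l' Dot m' n' + c \<le> M l' t (m' + x) (n' + y)"
    and t: "t = Slash \<longrightarrow> 1 \<le> x" "t = Backslash \<longrightarrow> 1 \<le> y"
    and caps: "c \<le> M Dot t x (y + 1)" "c \<le> M Dot t (x + 1) y"
      "c + 1 \<le> M Backslash t (x + 1) (y + 1)" "c + 1 \<le> M Slash t (x + 1) (y + 1)"
    and ij: "1 \<le> i" "i \<le> m" "1 \<le> j" "j \<le> n"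
  shows "reaches l t (m + x) (n + y) i j (M l Dot m n + c)"
proof -
  obtain s where s: "ok l Dot m n i j s" "M l Dot m n \<le> 1 + val l Dot m n s"
    using M_le_split[of l Dot m n i j] ij by auto
  have "ok l t (m + x) (n + y) i j s" using s(1) t ij by (cases s) (auto simp: ok_def)
  moreover have "val l Dot m n s + c \<le> val l t (m + x) (n + y) s"
  proof (cases s)
    case (Simple p q)
    note b = ok_SimpleD[OF s(1)[unfolded Simple] ij]
    have "M Dot Dot (m - p) (n - q) + c \<le> M Dot t (m - p + x) (n - q + y)"
    proof (cases "reg Dot (m - p) (n - q)")
      case True
      then show ?thesis using b by (intro IH) auto
    next
      case False
      then have "(m - p = 0 \<and> 1 \<le> n - q) \<or> (n - q = 0 \<and> 1 \<le> m - p)" using b by (auto simp: reg_def)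
      then show ?thesis
      proof
        assume a: "m - p = 0 \<and> 1 \<le> n - q"
        then have "y + 1 \<le> n - q + y" by linarith
        then have "c \<le> M Dot t x (n - q + y)"
          using M_mono[OF dfd_Dot(2) order.refl, of "y + 1" "n - q + y" t x] caps(1) by linarith
        moreover have "m - p = 0" using a by simp
        ultimately show ?thesis by (simp only: M_zero add_0)
      next
        assume a: "n - q = 0 \<and> 1 \<le> m - p"
        then have "x + 1 \<le> m - p + x" by linarith
        then have "c \<le> M Dot t (m - p + x) y"
          using M_mono[OF dfd_Dot(2) _ order.refl, of "x + 1" "m - p + x" t y] caps(2) by linarith
        moreover have "n - q = 0" using a by simp
        ultimately show ?thesis by (simp only: M_zero add_0)
      qed
    qed
    moreover have "m + x - p = m - p + x" "n + y - q = n - q + y" using b by linarith+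
    ultimately show ?thesis using Simple by simp
  next
    case (Share_a k q)
    then have b: "1 \<le> k" "k \<le> m" "1 \<le> q" "q < n" using s(1) by (auto simp: ok_def)
    have "M Backslash Dot (m - k + 1) (n - q) + c \<le> M Backslash t (m - k + 1 + x) (n - q + y)"
    proof (cases "k = m")
      case True
      have "y + 1 \<le> n - q + y" using b by linarith
      moreover have "dfd Backslash t (x + 1) (y + 1)" using t by (auto simp: dfd_def)
      ultimately have "M Backslash t (x + 1) (y + 1) \<le> M Backslash t (x + 1) (n - q + y)"
        by (intro M_mono) auto
      then show ?thesis using True caps(3) M_Backslash_Dot_1[of "n - q"] by simp
    next
      case False
      then show ?thesis using b by (intro IH) (auto simp: reg_def)
    qed
    moreover have "m + x - k + 1 = m - k + 1 + x" "n + y - q = n - q + y" using b by linarith+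
    ultimately show ?thesis using Share_a by simp
  next
    case (Share_b p h)
    then have b: "1 \<le> p" "p < m" "1 \<le> h" "h \<le> n" using s(1) by (auto simp: ok_def)
    have "M Slash Dot (m - p) (n - h + 1) + c \<le> M Slash t (m - p + x) (n - h + 1 + y)"
    proof (cases "h = n")
      case True
      have "x + 1 \<le> m - p + x" using b by linarith
      moreover have "dfd Slash t (x + 1) (y + 1)" using t by (auto simp: dfd_def)
      ultimately have "M Slash t (x + 1) (y + 1) \<le> M Slash t (m - p + x) (y + 1)"
        by (intro M_mono) auto
      then show ?thesis using True caps(4) M_Slash_Dot_1[of "m - p"] by simp
    next
      case False
      then show ?thesis using b by (intro IH) (auto simp: reg_def)
    qed
    moreover have "m + x - p = m - p + x" "n + y - h + 1 = n - h + 1 + y" using b by linarith+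
    ultimately show ?thesis using Share_b by simp
  qed
  ultimately show ?thesis using s(2) by (intro reachesI[of _ _ _ _ _ _ s]) auto
qed

lemma ok_extend:
  assumes "ok l Backslash m n i j s" "i \<le> m" "j \<le> n" "t = Slash \<longrightarrow> 1 \<le> x"
  shows "ok l t (m + x) (n + y) i j s"
  using assms by (cases s) (auto simp: ok_def)

text \<open>
  Only \<open>Share_a m (n - 1)\<close> cannot be reused: its second part grows from a determined problem of size
  (1, 1) by less than \<open>c\<close>. The predicate \<open>E\<close> lists further parts for which the induction hypothesis fails.
\<close>

lemma transplant_Backslash_val:
  assumes IH: "\<And>l' m' n'. m' + n' < m + n \<Longrightarrow> reg l' m' n' \<Longrightarrow> \<not> E l' m' n' \<Longrightarrow>
      M l' Backslash m' n' + c \<le> M l' t (m' + x) (n' + y)"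
    and t: "t = Slash \<longrightarrow> 1 \<le> x"
    and caps: "c \<le> M Dot t x (y + 1)" "c + 1 \<le> M Backslash t (x + 1) (y + 2)"
    and E: "\<And>l' m' n'. E l' m' n' \<Longrightarrow> l' = Slash \<and> m' = 1 \<and> n' = 2"
    and s: "ok l Backslash m n i j s" "s \<noteq> Share_a m (n - 1)"
      "\<And>p h. s = Share_b p h \<Longrightarrow> \<not> E Slash (m - p) (n - h + 1)"
    and ij: "1 \<le> i" "i \<le> m" "1 \<le> j" "j \<le> n"
  shows "val l Backslash m n s + c \<le> val l t (m + x) (n + y) s"
proof (cases s)
  case (Simple p q)
  note b = ok_SimpleD[OF s(1)[unfolded Simple] ij]
  have q: "q < n" using s(1) Simple by (auto simp: ok_def)
  have "M Dot Backslash (m - p) (n - q) + c \<le> M Dot t (m - p + x) (n - q + y)"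
  proof (cases "p = m")
    case False
    then show ?thesis using b q E[of Dot "m - p" "n - q"] by (intro IH) (auto simp: reg_def)
  next
    case True
    have "y + 1 \<le> n - q + y" using q by linarith
    with M_mono[OF _ order.refl this, of Dot t x] show ?thesis using True caps(1) by simp
  qed
  moreover have "m + x - p = m - p + x" "n + y - q = n - q + y" using b by linarith+
  ultimately show ?thesis using Simple by simp
next
  case (Share_b p h)
  then have b: "1 \<le> p" "p < m" "1 \<le> h" "h < n" using s(1) by (auto simp: ok_def)
  have "M Slash Backslash (m - p) (n - h + 1) + c \<le> M Slash t (m - p + x) (n - h + 1 + y)"
    using b s(3)[OF Share_b] by (intro IH) (auto simp: reg_def)
  moreover have "m + x - p = m - p + x" "n + y - h + 1 = n - h + 1 + y" using b by linarith+
  ultimately show ?thesis using Share_b by simp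
next
  case (Share_a k q)
  then have b: "1 \<le> k" "k \<le> m" "1 \<le> q" "q < n" using s(1) by (auto simp: ok_def)
  have e: "m + x - k + 1 = m - k + 1 + x" "n + y - q = n - q + y" using b by linarith+
  consider "k < m" | "k = m" "q + 2 \<le> n" using b s(2) Share_a by fastforce
  then show ?thesis
  proof cases
    case 1
    then have "M Backslash Backslash (m - k + 1) (n - q) + c \<le> M Backslash t (m - k + 1 + x) (n - q + y)"
      using b E[of Backslash "m - k + 1" "n - q"] by (intro IH) (auto simp: reg_def)
    then show ?thesis using Share_a e by simp
  next
    case 2
    have "M Backslash Backslash 1 (n - q) \<le> 1"
      using M_le_Dot[of Backslash Backslash 1 "n - q"] M_Backslash_Dot_1[of "n - q"]
      by (simp add: dfd_def)
    moreover have "y + 2 \<le> n - q + y" using 2 by linarith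
    moreover have "dfd Backslash t (x + 1) (y + 2)" using t by (auto simp: dfd_def)
    ultimately have le: "M Backslash Backslash 1 (n - q) + c \<le> M Backslash t (x + 1) (n - q + y)"
      using M_mono[of Backslash t "x + 1" "y + 2" "x + 1" "n - q + y"] caps(2) by linarith
    have f: "m - k + 1 = 1" "m + x - k + 1 = x + 1" using 2 by simp_all
    show ?thesis
      by (unfold Share_a val.simps f e(2)) (use le in linarith)
  qed
qed

text \<open>\<open>Share_a m (n - 1)\<close> answers only cells with \<open>i < m\<close> and
  \<open>j = n\<close>, and so does a \<open>Share_b\<close> leading into \<open>E\<close>, apart
  from the cells that \<open>noE\<close> excludes. There \<open>Simple m (n - 1)\<close> serves
  instead: \<open>M_Backslash_le\<close> loses 1, which the comparison pays for, and the second part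
  contributes \<open>c\<close>.\<close>

lemma transplant_Backslash:
  assumes IH: "\<And>l' m' n'. m' + n' < m + n \<Longrightarrow> reg l' m' n' \<Longrightarrow> \<not> E l' m' n' \<Longrightarrow>
      M l' Backslash m' n' + c \<le> M l' t (m' + x) (n' + y)"
    and t: "t = Slash \<longrightarrow> 1 \<le> x"
    and caps: "c \<le> M Dot t x (y + 1)" "c + 1 \<le> M Backslash t (x + 1) (y + 2)"
    and E: "\<And>l' m' n'. E l' m' n' \<Longrightarrow> l' = Slash \<and> m' = 1 \<and> n' = 2"
    and noE: "E Slash 1 2 \<Longrightarrow> j < n - 1 \<Longrightarrow> i = m \<Longrightarrow> False"
    and ij: "1 \<le> i" "i \<le> m" "1 \<le> j" "j \<le> n" and d: "dfd l Backslash m n"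
  shows "reaches l t (m + x) (n + y) i j (M l Backslash m n + c)"
proof -
  obtain s where s: "ok l Backslash m n i j s" "M l Backslash m n \<le> 1 + val l Backslash m n s"
    using M_le_split[OF d ij] by auto
  have last: ?thesis if "i < m" "j = n" "2 \<le> n"
  proof (rule reachesI)
    show "ok l t (m + x) (n + y) i j (Simple m (n - 1))" using that t ij by (auto simp: ok_def)
    show "M l Backslash m n + c \<le> 1 + val l t (m + x) (n + y) (Simple m (n - 1))"
      using M_Backslash_le[OF d] caps(1) that by simp
  qed
  show ?thesis
  proof (cases "s = Share_a m (n - 1) \<or> (\<exists>p h. s = Share_b p h \<and> E Slash (m - p) (n - h + 1))")
    case False
    then have "val l Backslash m n s + c \<le> val l t (m + x) (n + y) s"
      by (intro transplant_Backslash_val[OF IH t caps E s(1) _ _ ij]) auto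
    then show ?thesis using s(2) ok_extend[OF s(1) ij(2,4) t] by (intro reachesI[of _ _ _ _ _ _ s]) auto
  next
    case True
    then show ?thesis
    proof
      assume "s = Share_a m (n - 1)"
      then show ?thesis using s(1) ij by (intro last) (auto simp: ok_def)
    next
      assume "\<exists>p h. s = Share_b p h \<and> E Slash (m - p) (n - h + 1)"
      then obtain p h where sb: "s = Share_b p h" "E Slash (m - p) (n - h + 1)" by blast
      have b: "1 \<le> p" "p < m" "1 \<le> h" "h < n" and *: "i \<le> p \<and> h < j \<or> p < i \<and> j < h"
        using s(1) sb(1) by (auto simp: ok_def)
      have e1: "m - p = 1" and e2: "n - h + 1 = 2" using E[OF sb(2)] by blast+
      have e3: "E Slash 1 2" using sb(2) unfolding e1 e2 .
      have "j = n \<and> i < m"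
      proof (cases "i \<le> p")
        case True
        then show ?thesis using * e1 e2 ij b by linarith
      next
        case False
        then have "i = m" "j < n - 1" using * e1 e2 ij b by linarith+
        then show ?thesis using noE[OF e3] by blast
      qed
      then show ?thesis using b by (intro last) auto
    qed
  qed
qed

lemma M_Backslash_1:
  assumes "dfd l Backslash m 1" "1 \<le> m"
  shows "M l Backslash m 1 \<le> 1"
  using M_Backslash_le[OF assms] by simp

lemma M_Slash_Backslash_2:
  assumes "1 \<le> m"
  shows "M Slash Backslash m 2 \<le> 2"
  using M_Backslash_le[of Slash m 2] M_Slash_Dot_1[of m] assms by (simp add: dfd_def numeral_2_eq_2)

lemma inc_DotI:
  assumes t: "t = Slash \<longrightarrow> 1 \<le> x" "t = Backslash \<longrightarrow> 1 \<le> y"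
    and caps: "c \<le> M Dot t x (y + 1)" "c \<le> M Dot t (x + 1) y"
      "c + 1 \<le> M Backslash t (x + 1) (y + 1)" "c + 1 \<le> M Slash t (x + 1) (y + 1)"
    and cells: "\<And>l m n i j. reg l m n \<Longrightarrow> 1 \<le> i \<Longrightarrow> i \<le> m + x \<Longrightarrow> 1 \<le> j \<Longrightarrow> j \<le> n + y \<Longrightarrow>
      m < i \<or> n < j \<Longrightarrow> reaches l t (m + x) (n + y) i j (M l Dot m n + c)"
  shows "inc Dot t x y c"
proof -
  have "M l Dot m n + c \<le> M l t (m + x) (n + y)" if "reg l m n" for l m n
    using that
  proof (induction "m + n" arbitrary: l m n rule: less_induct)
    case less
    show ?case
    proof (rule M_ge_reaches)
      fix i j assume ij: "1 \<le> i" "i \<le> m + x" "1 \<le> j" "j \<le> n + y"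
      show "reaches l t (m + x) (n + y) i j (M l Dot m n + c)"
      proof (cases "m < i \<or> n < j")
        case True
        then show ?thesis using cells[OF less.prems ij] by blast
      next
        case False
        then show ?thesis
          by (intro transplant_Dot[OF less.hyps t caps]) (use ij in auto)
      qed
    qed (use less.prems in \<open>auto simp: reg_def\<close>)
  qed
  then show ?thesis by (simp add: inc_def)
qed

text \<open>Answers in new cells start from \<open>(m, n - 1)\<close>, so \<open>cells\<close>
  speaks only of regular \<open>(m, n - 1)\<close>. Otherwise \<open>n = 1\<close>, or
  \<open>l = Slash\<close> and \<open>n = 2\<close>; then \<open>M l Backslash m n\<close> is at
  most 1 or 2, and the last three caps exceed this by \<open>c\<close>.\<close>

lemma inc_BackslashI:
  assumes t: "t = Slash \<longrightarrow> 1 \<le> x"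
    and caps: "c \<le> M Dot t x (y + 1)" "c + 1 \<le> M Backslash t (x + 1) (y + 2)"
      "c + 1 \<le> M Dot t (x + 1) (y + 1)" "c + 1 \<le> M Backslash t (x + 2) (y + 1)"
      "c + 2 \<le> M Slash t (x + 1) (y + 2)"
    and cells: "\<And>l m n i j. reg l m (n - 1) \<Longrightarrow> 1 \<le> i \<Longrightarrow> i \<le> m + x \<Longrightarrow> 1 \<le> j \<Longrightarrow> j \<le> n + y \<Longrightarrow>
      m < i \<or> n < j \<Longrightarrow> reaches l t (m + x) (n + y) i j (M l Backslash m n + c)"
  shows "inc Backslash t x y c"
proof -
  have "M l Backslash m n + c \<le> M l t (m + x) (n + y)" if "reg l m n" for l m n
    using that
  proof (induction "m + n" arbitrary: l m n rule: less_induct)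
    case less
    then have r: "1 \<le> m" "1 \<le> n" "l = Backslash \<Longrightarrow> 2 \<le> m" "l = Slash \<Longrightarrow> 2 \<le> n" by (auto simp: reg_def)
    note d = reg_dfd[OF less.prems]
    show ?case
    proof (cases "reg l m (n - 1)")
      case True
      show ?thesis
      proof (rule M_ge_reaches)
        fix i j assume ij: "1 \<le> i" "i \<le> m + x" "1 \<le> j" "j \<le> n + y"
        show "reaches l t (m + x) (n + y) i j (M l Backslash m n + c)"
        proof (cases "m < i \<or> n < j")
          case True
          then show ?thesis using cells[OF \<open>reg l m (n - 1)\<close> ij] by blast
        next
          case False
          then show ?thesis
            by (intro transplant_Backslash[where E = "\<lambda>_ _ _. False", OF less.hyps t caps(1,2)]) (use ij d in auto)
        qed
      qed (use r in auto)
    next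
      case False
      then have "n = 1 \<and> l \<noteq> Slash \<or> n = 2 \<and> l = Slash" using r by (cases "n = 1"; cases "n = 2") (auto simp: reg_def)
      then show ?thesis
      proof
        assume n: "n = 1 \<and> l \<noteq> Slash"
        have "c + 1 \<le> M l t (m + x) (1 + y)"
        proof (cases l)
          case Dot
          have "M Dot t (x + 1) (y + 1) \<le> M Dot t (m + x) (1 + y)" by (rule M_mono) (use r in auto)
          then show ?thesis using Dot caps(3) by simp
        next
          case Backslash
          have "M Backslash t (x + 2) (y + 1) \<le> M Backslash t (m + x) (1 + y)"
            by (rule M_mono) (use r Backslash t in \<open>auto simp: dfd_def\<close>)
          then show ?thesis using Backslash caps(4) by simp
        qed (use n in simp)
        then show ?thesis using n M_Backslash_1[of l m] d r by simp
      next
        assume n: "n = 2 \<and> l = Slash"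
        have "M Slash t (x + 1) (y + 2) \<le> M Slash t (m + x) (2 + y)"
          by (rule M_mono) (use r in \<open>auto simp: dfd_def\<close>)
        then show ?thesis using n M_Slash_Backslash_2[of m] caps(5) r by simp
      qed
    qed
  qed
  then show ?thesis by (simp add: inc_def)
qed

section \<open>Certificates\<close>

datatype opt = S int int | A int int | B int int | D int int | X int int

text \<open>
  An option is a splitting in coordinates relative to a base point, and \<open>cov a u v\<close> says that it answers
  the comparison in cell \<open>(u, v)\<close>. \<open>D p q\<close> stands for the better of \<open>S (p + 1) q\<close> and \<open>S p (q + 1)\<close>,
  which by \<open>M_Dot_step\<close> gains 1 over \<open>S p q\<close>. \<open>X p q\<close> claims its cell without a splitting.
\<close>

fun cov :: "opt \<Rightarrow> int \<Rightarrow> int \<Rightarrow> bool" where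
  "cov (S p q) u v \<longleftrightarrow> u \<le> p \<and> q < v \<or> p < u \<and> v \<le> q"
| "cov (A p q) u v \<longleftrightarrow> u < p \<and> q < v \<or> p < u \<and> v \<le> q"
| "cov (B p q) u v \<longleftrightarrow> u \<le> p \<and> q < v \<or> p < u \<and> v < q"
| "cov (D p q) u v \<longleftrightarrow> u = p + 1 \<and> v = q + 1"
| "cov (X p q) u v \<longleftrightarrow> u = p + 1 \<and> v = q + 1"

definition mx :: "int \<Rightarrow> int \<Rightarrow> int" where "mx a b = (if a < b then b else a)"

text \<open>
  State of the scan: rows before \<open>u\<close> are covered, row \<open>u\<close> is covered in the columns below \<open>bu\<close>, and all
  later rows in the columns below \<open>bn\<close>.
\<close>

fun chain :: "int \<Rightarrow> int \<Rightarrow> int \<Rightarrow> int \<Rightarrow> int \<Rightarrow> opt list \<Rightarrow> bool"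
  and adv :: "int \<Rightarrow> int \<Rightarrow> int \<Rightarrow> int \<Rightarrow> int \<Rightarrow> int \<Rightarrow> int \<Rightarrow> int \<Rightarrow> bool \<Rightarrow> opt list \<Rightarrow> bool" where
  "chain x y u bu bn [] = (if x < u then True else if y < bu then if u = x then True else y < bn else False)"
| "chain x y u bu bn (S p q # os) =
     adv x y u (if p < u then mx bu (q + 1) else bu) (if p \<le> u then mx bn (q + 1) else bn) q (p + 1) (q + 1) True os"
| "chain x y u bu bn (A p q # os) =
     adv x y u (if p < u then mx bu (q + 1) else bu) (if p \<le> u then mx bn (q + 1) else bn) q p (q + 1) False os"
| "chain x y u bu bn (B p q # os) =
     adv x y u (if p < u then mx bu q else bu) (if p \<le> u then mx bn q else bn) q (p + 1) q True os"
| "chain x y u bu bn (D p q # os) =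
     chain x y u (if u = p + 1 then if q + 1 \<le> bu then mx bu (q + 2) else bu else bu) bn os"
| "chain x y u bu bn (X p q # os) =
     chain x y u (if u = p + 1 then if q + 1 \<le> bu then mx bu (q + 2) else bu else bu) bn os"
| "adv x y u bu bn q ra cb own os =
     (if (if u < ra then if q < bu then if ra = u + 1 then True else q < bn else False else False)
      then chain x y ra (if own then mx bn cb else bn) (mx bn cb) os
      else chain x y u bu bn os)"

text \<open>\<open>S p q\<close> answers the columns beyond \<open>q\<close> in rows up to
  \<open>p\<close> and the columns up to \<open>q\<close> in later rows. So rows up to
  \<open>p\<close> are finished once the frontier has passed \<open>q\<close>, and the scan resumes
  at row \<open>p + 1\<close> with a new frontier. \<open>A\<close> leaves row \<open>p\<close> open
  and \<open>B\<close> leaves column \<open>q\<close> open, which explains the different arguments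
  of \<open>adv\<close>.\<close>

lemma chain_sound:
  assumes "chain x y u bu bn os" "u \<le> u'" "u' \<le> x" "v \<le> y" "u' = u \<longrightarrow> bu \<le> v" "u < u' \<longrightarrow> bn \<le> v"
  shows "\<exists>o'\<in>set os. cov o' u' v"
  using assms
proof (induction os arbitrary: u bu bn)
  case Nil
  then show ?case by (cases "u' = u") (auto split: if_splits)
next
  case (Cons a os)
  show ?case
  proof (rule ccontr)
    assume "\<not> ?thesis"
    then have nc: "\<not> cov a u' v" and no: "\<not> (\<exists>o'\<in>set os. cov o' u' v)" by auto
    have C: "chain x y w b c os \<Longrightarrow> w \<le> u' \<Longrightarrow> u' = w \<longrightarrow> b \<le> v \<Longrightarrow> w < u' \<longrightarrow> c \<le> v \<Longrightarrow> False" for w b c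
      using Cons.IH[of w b c] Cons.prems(3,4) no by blast
    note pr = Cons.prems(1,2,5,6) nc
    show False
    proof (cases a)
      case (S p q)
      then show ?thesis using pr
        by (auto simp: mx_def split: if_splits dest!: C)
    next
      case (A p q)
      then show ?thesis using pr
        by (auto simp: mx_def split: if_splits dest!: C)
    next
      case (B p q)
      then show ?thesis using pr
        by (auto simp: mx_def split: if_splits dest!: C)
    next
      case (D p q)
      then show ?thesis using pr
        by (auto simp: mx_def split: if_splits dest!: C)
    next
      case (X p q)
      then show ?thesis using pr
        by (auto simp: mx_def split: if_splits dest!: C)
    qed
  qed
qed

section \<open>Tables of lower bounds and of increments\<close>

text \<open>
  Suffixes name the pair of constraints, with D, S, B for \<open>Dot\<close>, \<open>Slash\<close>, \<open>Backslash\<close>. Tables are indexed by the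
  diagonal \<open>d = n - m\<close>; an entry \<open>(a, c)\<close> is the bound \<open>c\<close> at \<open>(a, a + d)\<close>, and every step along the
  diagonal adds 2.
\<close>

definition lb_tab_DD :: "int \<Rightarrow> (int \<times> int) list" where
  "lb_tab_DD d = (if d < 8 then (if d < 4 then (if d < 2 then (if d < 1 then (if d = 0 then [(2,3)] else [])
    else [(1,2)]) else (if d < 3 then [(2,5),(1,2)] else [(4,10),(1,3)])) else (if d < 6 then
    (if d < 5 then [(6,15),(2,6),(1,3)] else [(8,20),(4,11),(2,6)]) else (if d < 7 then [(10,
    25),(6,16),(3,9),(1,3)] else [(11,28),(7,19),(4,12),(2,7),(1,4)]))) else (if d < 12 then
    (if d < 10 then (if d < 9 then [(13,33),(8,22),(6,17),(4,12),(2,7),(1,4)] else [(15,38),(10,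
    27),(7,20),(4,13),(3,10),(1,4)]) else (if d < 11 then [(16,41),(12,32),(8,23),(6,18),(4,
    13)] else [(18,46),(14,37),(10,28),(7,21),(5,16),(3,11)])) else (if d < 14 then (if d < 13
    then [(20,51),(15,40),(12,33),(8,24),(6,19),(4,14)] else [(22,56),(17,45),(13,36),(10,29),
    (8,24),(5,17)]) else (if d < 15 then [(24,61),(19,50),(15,41),(12,34),(9,27),(6,20)] else
    (if d = 15 then [(25,63),(16,44),(13,37),(8,25)] else [])))))"

definition lb_tab_DB :: "int \<Rightarrow> (int \<times> int) list" where
  "lb_tab_DB d = (if d < 1 then (if d < (-7) then (if d < (-11) then (if d < (-13) then (if d = (-14) then [(40,64),(32,
    47),(29,40)] else []) else (if d < (-12) then [(39,64),(34,53),(30,44),(26,35),(23,28)]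
    else [(36,59),(32,50),(27,39),(23,30),(21,25),(18,18)])) else (if d < (-9) then (if d <
    (-10) then [(33,54),(29,45),(24,34),(21,27),(19,22)] else [(31,51),(26,40),(22,31),(19,24),
    (16,17),(14,12)]) else (if d < (-8) then [(28,46),(23,35),(19,26),(16,19),(14,14)] else
    [(25,41),(20,30),(16,21),(14,16),(12,11),(10,5)]))) else (if d < (-3) then (if d < (-5)
    then (if d < (-6) then [(23,38),(18,27),(14,18),(12,13),(10,8),(9,5)] else [(20,33),(15,22),
    (12,15),(9,8),(8,5)]) else (if d < (-4) then [(17,28),(12,17),(9,10)] else [(14,23),(10,14),
    (7,7)])) else (if d < (-1) then (if d < (-2) then [(11,18),(7,9),(5,4)] else [(8,13),(4,
    4)]) else (if d < 0 then [(5,8),(3,3)] else [(2,3)])))) else (if d < 9 then (if d < 5 then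
    (if d < 3 then (if d < 2 then [(1,2)] else [(3,7),(1,2)]) else (if d < 4 then [(5,12),(1,
    3)] else [(7,17),(3,8),(1,3)])) else (if d < 7 then (if d < 6 then [(9,22),(5,13),(2,6)]
    else [(11,27),(6,16),(3,9),(1,3)]) else (if d < 8 then [(13,32),(8,21),(5,14),(2,7),(1,4)]
    else [(15,37),(10,26),(6,17),(4,12),(2,7),(1,4)]))) else (if d < 13 then (if d < 11 then
    (if d < 10 then [(16,40),(11,29),(7,20),(5,15),(3,10)] else [(18,45),(13,34),(9,25),(6,18),
    (4,13),(2,7)]) else (if d < 12 then [(20,50),(15,39),(11,30),(8,23),(5,16),(3,11),(2,8)]
    else [(21,53),(17,44),(12,33),(9,26),(7,21),(5,16),(3,11),(2,8)])) else (if d < 15 then (if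
    d < 14 then [(23,58),(19,49),(14,38),(10,29),(8,24),(5,17),(4,14)] else [(25,63),(20,52),(16,43),
    (12,34),(9,27),(7,22)]) else (if d < 16 then [(22,57),(17,46),(14,39),(11,32),(8,25)] else
    (if d = 16 then [(19,51),(15,42),(12,35),(9,28)] else []))))))"

definition lb_tab_BB :: "int \<Rightarrow> (int \<times> int) list" where
  "lb_tab_BB d = (if d < 8 then (if d < 4 then (if d < 2 then (if d < 1 then (if d = 0 then [(2,3)] else [])
    else [(7,14),(2,3)]) else (if d < 3 then [(7,15),(2,4)] else [(9,20),(4,9),(2,4)])) else
    (if d < 6 then (if d < 5 then [(11,25),(6,14),(3,7)] else [(13,30),(8,19),(5,12)]) else (if
    d < 7 then [(15,35),(10,24),(6,15),(3,8),(2,5)] else [(17,40),(12,29),(7,18),(5,13)])))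
    else (if d < 12 then (if d < 10 then (if d < 9 then [(18,43),(13,32),(9,23),(4,11)] else
    [(20,48),(15,37),(11,28),(7,19),(5,14)]) else (if d < 11 then [(22,53),(17,42),(12,31),(9,
    24),(6,17),(4,12),(3,9)] else [(24,58),(19,47),(14,36),(8,22),(4,12),(3,9)])) else (if d <
    14 then (if d < 13 then [(21,52),(16,41),(12,32),(9,25),(7,20),(5,15)] else [(22,55),(18,
    46),(14,37),(10,28),(8,23)]) else (if d < 15 then [(24,60),(19,49),(12,33)] else (if d = 15
    then [(21,54),(17,45)] else [])))))"

definition lb_tab_SB :: "int \<Rightarrow> (int \<times> int) list" where
  "lb_tab_SB d = (if d < 2 then (if d < (-6) then (if d < (-10) then (if d < (-12) then (if d = (-13) then [(40,65),(33,
    50),(29,41)] else []) else (if d < (-11) then [(35,56),(31,47)] else [(33,53),(28,42)]))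
    else (if d < (-8) then (if d < (-9) then [(30,48),(25,37)] else [(38,66),(27,43),(22,32)]) else (if
    d < (-7) then [(24,38),(20,29)] else [(26,44),(21,33),(17,24)]))) else (if d < (-2) then
    (if d < (-4) then (if d < (-5) then [(14,19)] else [(16,25),(12,16)]) else (if d < (-3)
    then [(13,20),(10,13)] else [(15,26),(10,15),(7,8)])) else (if d < 0 then (if d < (-1) then
    [(7,10),(5,5)] else [(9,16),(4,5),(3,2)]) else (if d < 1 then [(2,2)] else [(1,2)])))) else
    (if d < 10 then (if d < 6 then (if d < 4 then (if d < 3 then [(6,13),(1,2)] else [(6,14),(1,
    3)]) else (if d < 5 then [(8,19),(3,8),(1,3)] else [(10,24),(5,13),(2,6)])) else (if d < 8
    then (if d < 7 then [(12,29),(7,18),(4,11)] else [(14,34),(9,23),(5,14),(2,7),(1,4)]) else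
    (if d < 9 then [(16,39),(11,28),(4,12)] else [(17,42),(12,31),(8,22),(5,15),(3,10)]))) else
    (if d < 14 then (if d < 12 then (if d < 11 then [(19,47),(14,36),(10,27),(6,18),(4,13)]
    else [(21,52),(16,41),(11,30),(8,23),(5,16),(3,11),(2,8)]) else (if d < 13 then [(23,57),
    (18,46),(13,35),(9,26),(7,21),(5,16)] else [(25,62),(20,51),(15,40),(11,31),(4,14)])) else
    (if d < 16 then (if d < 15 then [(26,65),(21,54),(17,45),(13,36),(9,27),(7,22)] else [(18,48),(14,
    39)]) else (if d < 17 then [(16,44)] else (if d = 17 then [(18,49),(14,40),(11,33)] else
    []))))))"

definition inc_tab_DD :: "int \<Rightarrow> (int \<times> int) list" where
  "inc_tab_DD d = (if d < 8 then (if d < 4 then (if d < 2 then (if d = 1 then [(3,7)] else []) else (if d < 3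
    then [(5,12),(1,3)] else [(7,17),(3,8),(1,3)])) else (if d < 6 then (if d < 5 then [(9,22),
    (5,13),(2,6)] else [(11,27),(6,16),(3,9)]) else (if d < 7 then [(13,32),(8,21),(5,14),(3,9),
    (1,4)] else [(15,37),(10,26),(6,17),(4,12),(2,7)]))) else (if d < 11 then (if d < 9 then
    [(17,42),(11,29),(8,22),(5,15),(3,10),(1,4)] else (if d < 10 then [(18,45),(13,34),(9,25),
    (6,18),(4,13)] else [(20,50),(15,39),(11,30),(8,23),(5,16)])) else (if d < 13 then (if d <
    12 then [(22,55),(17,44),(12,33),(9,26),(7,21)] else [(23,58),(19,49),(14,38),(11,31),(8,
    24)]) else (if d < 14 then [(25,63),(20,52),(16,43),(12,34),(9,27)] else (if d = 14 then
    [(17,46),(14,39)] else [])))))"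

definition inc_tab_DB :: "int \<Rightarrow> (int \<times> int) list" where
  "inc_tab_DB d = (if d < 2 then (if d < (-7) then (if d < (-10) then (if d < (-12) then (if d = (-13) then [(32,
    49),(28,40)] else []) else (if d < (-11) then [(30,46)] else [(32,52)])) else (if d < (-9)
    then [(29,47)] else (if d < (-8) then [(26,42)] else [(23,37)]))) else (if d < (-3) then
    (if d < (-5) then (if d = (-7) then [(20,32),(16,23)] else []) else (if d < (-4) then [(15,
    24)] else [(12,19)])) else (if d < (-1) then (if d < (-2) then [(9,14)] else [(6,9)]) else
    (if d < 1 then (if d = (-1) then [(3,4)] else []) else [(6,13)])))) else (if d < 9 then (if
    d < 5 then (if d < 3 then [(8,18),(1,3)] else (if d < 4 then [(8,19),(3,8)] else [(10,24),
    (5,13),(2,6)])) else (if d < 7 then (if d < 6 then [(12,29),(7,18),(4,11)] else [(14,34),(9,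
    23),(5,14)]) else (if d < 8 then [(16,39),(11,28),(7,19),(4,12)] else [(18,44),(12,31),(3,
    10)]))) else (if d < 12 then (if d < 10 then [(20,49),(14,36),(10,27),(7,20)] else (if d <
    11 then [(21,52),(16,41),(12,32),(8,23)] else [(23,57),(18,46),(13,35),(7,21),(3,11),(2,
    8)])) else (if d < 14 then (if d < 13 then [(20,51),(15,40),(11,31),(8,24),(6,19),(4,14)]
    else [(22,56),(13,36)]) else (if d < 15 then [(23,59),(18,48),(11,32)] else (if d = 15 then
    [(16,44)] else []))))))"

definition inc_tab_BD :: "int \<Rightarrow> (int \<times> int) list" where
  "inc_tab_BD d = (if d < (-9) then (if d = (-12) then [(32,52)] else []) else (if d < 8 then (if d = (-9) then
    [(24,39)] else []) else (if d = 8 then [(16,40)] else [])))"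

definition inc_tab_BS :: "int \<Rightarrow> (int \<times> int) list" where
  "inc_tab_BS d = (if d < 3 then (if d < (-3) then (if d < (-10) then (if d = (-14) then [(34,53)] else []) else
    (if d < (-9) then [(28,46)] else (if d = (-9) then [(25,41)] else []))) else (if d < 1 then
    (if d < (-1) then (if d = (-3) then [(8,13)] else []) else (if d = (-1) then [(1,1)] else
    [])) else (if d < 2 then [(2,4)] else [(4,9)]))) else (if d < 8 then (if d < 4 then [(6,
    14)] else (if d < 7 then (if d = 4 then [(8,19)] else []) else [(13,32)])) else (if d < 10
    then (if d < 9 then [(15,37)] else [(17,42)]) else (if d < 12 then (if d = 10 then [(19,
    47)] else []) else (if d = 12 then [(22,55)] else [])))))"

definition inc_tab_BB :: "int \<Rightarrow> (int \<times> int) list" where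
  "inc_tab_BB d = (if d < 7 then (if d < 4 then (if d < 2 then (if d = 1 then [(6,13)] else []) else (if d < 3
    then [(6,14),(1,3)] else [(8,19)])) else (if d < 5 then [(10,24),(5,13)] else (if d < 6
    then [(12,29),(7,18),(4,11)] else [(14,34),(9,23)]))) else (if d < 10 then (if d < 8 then
    [(16,39),(11,28)] else (if d < 9 then [(17,42),(12,31)] else [(19,47),(14,36)])) else (if d
    < 11 then [(21,52),(16,41)] else (if d < 13 then (if d = 11 then [(23,57),(18,46)] else [])
    else (if d = 13 then [(21,54)] else [])))))"

fun look :: "int \<Rightarrow> int \<Rightarrow> (int \<times> int) list \<Rightarrow> int" where
  "look z m [] = z"
| "look z m ((a, c) # es) = (if a \<le> m then c + 2 * (m - a) else look z m es)"

lemma look_cases: "look z m es = z \<or> (\<exists>a c. (a, c) \<in> set es \<and> a \<le> m \<and> look z m es = c + 2 * (m - a))"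
proof (induction es)
  case (Cons e es)
  obtain a c where e: "e = (a, c)" by (cases e)
  then show ?case using Cons by (cases "a \<le> m") (force, auto)
qed simp

text \<open>\<open>M_swap\<close> and \<open>M_rev\<close> reduce the nine pairs of constraints to
  four tables. The default 1 is justified by \<open>M_ge_1\<close>.\<close>

fun lbv :: "constr \<Rightarrow> constr \<Rightarrow> int \<Rightarrow> int \<Rightarrow> int" where
  "lbv Dot Dot m n = (if m < 1 then 0 else if n < 1 then 0 else
     if n < m then look 1 n (lb_tab_DD (m - n)) else look 1 m (lb_tab_DD (n - m)))"
| "lbv Dot Backslash m n = (if m < 1 then 0 else if n < 1 then 0 else look 1 m (lb_tab_DB (n - m)))"
| "lbv Slash Dot m n = (if m < 1 then 0 else if n < 1 then 0 else look 1 m (lb_tab_DB (n - m)))"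
| "lbv Dot Slash m n = (if m < 1 then 0 else if n < 1 then 0 else look 1 n (lb_tab_DB (m - n)))"
| "lbv Backslash Dot m n = (if m < 1 then 0 else if n < 1 then 0 else look 1 n (lb_tab_DB (m - n)))"
| "lbv Backslash Backslash m n = (if m < 1 then 0 else if n < 1 then 0 else
     if n < m then look 1 n (lb_tab_BB (m - n)) else look 1 m (lb_tab_BB (n - m)))"
| "lbv Slash Slash m n = (if m < 1 then 0 else if n < 1 then 0 else
     if n < m then look 1 n (lb_tab_BB (m - n)) else look 1 m (lb_tab_BB (n - m)))"
| "lbv Slash Backslash m n = (if m < 1 then 0 else if n < 1 then 0 else look 1 m (lb_tab_SB (n - m)))"
| "lbv Backslash Slash m n = (if m < 1 then 0 else if n < 1 then 0 else look 1 n (lb_tab_SB (m - n)))"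

definition lb_tab :: "constr \<Rightarrow> constr \<Rightarrow> int \<Rightarrow> (int \<times> int) list" where
  "lb_tab l r d = (if r = Dot then if l = Dot then lb_tab_DD d else []
     else if r = Backslash then if l = Dot then lb_tab_DB d else if l = Backslash then lb_tab_BB d else lb_tab_SB d
     else [])"

text \<open>Limiting the size of the entries by \<open>N\<close> permits an induction on size, since
  the certificate of an entry quotes only smaller problems.\<close>

definition lb_ok :: "int \<Rightarrow> bool" where
  "lb_ok N \<longleftrightarrow> (\<forall>l r d a c. (a, c) \<in> set (lb_tab l r d) \<longrightarrow> 2 * a + d \<le> N \<longrightarrow>
     1 \<le> a \<and> 1 \<le> a + d \<and> reg l (nat a) (nat (a + d)) \<and> c \<le> int (M l r (nat a) (nat (a + d))))"

lemma lb_ok_mono: "lb_ok N \<Longrightarrow> N' \<le> N \<Longrightarrow> lb_ok N'"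
  unfolding lb_ok_def by (meson order_trans)

text \<open>A new cell with one old element is cut at \<open>(m, n)\<close>, where
  \<open>M_le_Dot\<close> removes the constraint. For the two new elements,
  \<open>M_Backslash_le\<close> passes to the unconstrained \<open>(m, n - 1)\<close> at a loss of
  1, and \<open>M_Dot_diag\<close> from there to \<open>(m + 1, n)\<close> gains 2.\<close>

lemma inc_Backslash_diag: "inc Backslash Backslash 1 1 2"
proof -
  have D1: "1 \<le> M Dot Backslash 1 1" "1 \<le> M Backslash Dot 1 1" "1 \<le> M Slash Dot 1 1"
    by (rule M_ge_1; simp)+
  have D12: "2 \<le> M Dot Backslash 1 2" and D21: "2 \<le> M Backslash Dot 2 1" and D22: "3 \<le> M Dot Backslash 2 2"
    using M_Slash_Dot_1_2 M_Slash_Dot_2_2 M_rev[of Slash Dot 1 2] M_rev[of Slash Dot 2 2] M_swap[of Slash Dot 1 2]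
    by auto
  have BB: "3 \<le> M Backslash Backslash 2 2"
  proof (rule M_ge_reaches)
    fix i j :: nat assume ij: "1 \<le> i" "i \<le> 2" "1 \<le> j" "j \<le> 2"
    consider "i = 1" | "i = 2" "j = 1" | "i = 2" "j = 2" using ij by linarith
    then show "reaches Backslash Backslash 2 2 i j 3"
    proof cases
      case 1
      then show ?thesis using D12 ij by (intro reachesI[of _ _ _ _ _ _ "Simple 1 0"]) (auto simp: ok_def)
    next
      case 2
      then show ?thesis using D1 by (intro reachesI[of _ _ _ _ _ _ "Simple 1 1"]) (auto simp: ok_def)
    next
      case 3
      then show ?thesis using D21 by (intro reachesI[of _ _ _ _ _ _ "Simple 2 1"]) (auto simp: ok_def)
    qed
  qed auto
  have SB: "4 \<le> M Slash Backslash 2 3"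
  proof (rule M_ge_reaches)
    fix i j :: nat assume ij: "1 \<le> i" "i \<le> 2" "1 \<le> j" "j \<le> 3"
    consider "j = 1" | "j = 3" | "i = 1" "j = 2" | "i = 2" "j = 2" using ij by linarith
    then show "reaches Slash Backslash 2 3 i j 4"
    proof cases
      case 1
      then show ?thesis using D22 ij by (intro reachesI[of _ _ _ _ _ _ "Simple 0 1"]) (auto simp: ok_def)
    next
      case 2
      then show ?thesis using M_Slash_Dot_2_2 ij by (intro reachesI[of _ _ _ _ _ _ "Simple 2 2"]) (auto simp: ok_def)
    next
      case 3
      then show ?thesis using D1 D12 by (intro reachesI[of _ _ _ _ _ _ "Simple 1 1"]) (auto simp: ok_def)
    next
      case 4
      then show ?thesis using D1 M_Slash_Dot_1_2 by (intro reachesI[of _ _ _ _ _ _ "Simple 1 2"]) (auto simp: ok_def)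
    qed
  qed auto
  have BB32: "3 \<le> M Backslash Backslash 3 2" and BB23: "3 \<le> M Backslash Backslash 2 3"
    using BB M_mono[of Backslash Backslash 2 2 3 2] M_mono[of Backslash Backslash 2 2 2 3] by (auto simp: dfd_def)
  show ?thesis
  proof (rule inc_BackslashI)
    fix l m n i j assume r: "reg l m (n - 1)" and ij: "1 \<le> i" "i \<le> m + 1" "1 \<le> j" "j \<le> n + 1" "m < i \<or> n < j"
    have r': "1 \<le> m" "2 \<le> n" "l = Backslash \<longrightarrow> 2 \<le> m" "l = Slash \<longrightarrow> 3 \<le> n" using r by (auto simp: reg_def)
    have le: "M l Backslash m n \<le> M l Dot m n" using r' by (intro M_le_Dot) (auto simp: dfd_def)
    show "reaches l Backslash (m + 1) (n + 1) i j (M l Backslash m n + 2)"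
    proof (cases "i = m + 1 \<and> j = n + 1")
      case False
      then show ?thesis using le D1 ij r' by (intro reachesI[of _ _ _ _ _ _ "Simple m n"]) (auto simp: ok_def)
    next
      case True
      have "M l Backslash m n \<le> 1 + M l Dot m (n - 1)" using r' by (intro M_Backslash_le) (auto simp: dfd_def)
      moreover have "M l Dot m (n - 1) + 2 \<le> M l Dot (m + 1) n" using M_Dot_diag[OF r] r' by simp
      ultimately show ?thesis using True r' by (intro reachesI[of _ _ _ _ _ _ "Simple (m + 1) n"]) (auto simp: ok_def)
    qed
  qed (use D12 BB23 D22 BB32 SB in \<open>auto simp: numeral_eq_Suc\<close>)
qed

lemma inc_refl: "inc r r 0 0 0" by (simp add: inc_def)

lemma inc_Dot_diag: "inc Dot Dot 1 1 2" using M_Dot_diag by (simp add: inc_def)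

text \<open>Turns a table entry into a bound for all later points of its diagonal, both for problems
  and for shifts.\<close>

lemma inc_diag: "inc r r k k (2 * k)"
proof -
  have *: "inc r r 1 1 2"
  proof (cases r)
    case Slash
    then show ?thesis using inc_Backslash_diag inc_swap[of Backslash Backslash 1 1 2] by simp
  qed (use inc_Dot_diag inc_Backslash_diag in auto)
  show ?thesis
  proof (induction k)
    case (Suc k)
    then show ?case using inc_trans[OF Suc *] by simp
  qed (simp add: inc_refl)
qed

lemma lb_tab_le:
  assumes "lb_ok (int m + int n)" "dfd l r m n" "1 \<le> m" "1 \<le> n"
  shows "look 1 (int m) (lb_tab l r (int n - int m)) \<le> int (M l r m n)"
  using look_cases[of 1 "int m" "lb_tab l r (int n - int m)"]
proof
  assume "look 1 (int m) (lb_tab l r (int n - int m)) = 1"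
  then show ?thesis using M_ge_1[OF assms(2-4)] by simp
next
  assume "\<exists>a c. (a, c) \<in> set (lb_tab l r (int n - int m)) \<and> a \<le> int m \<and>
    look 1 (int m) (lb_tab l r (int n - int m)) = c + 2 * (int m - a)"
  then obtain a c where ac: "(a, c) \<in> set (lb_tab l r (int n - int m))" "a \<le> int m"
    "look 1 (int m) (lb_tab l r (int n - int m)) = c + 2 * (int m - a)" by blast
  define b where "b = a + (int n - int m)"
  have "2 * a + (int n - int m) \<le> int m + int n" using ac(2) by linarith
  then have e: "1 \<le> a" "1 \<le> b" "reg l (nat a) (nat b)" "c \<le> int (M l r (nat a) (nat b))"
    using assms(1) ac(1) unfolding lb_ok_def b_def by blast+
  define k where "k = nat (int m - a)"
  have k: "nat a + k = m" "nat b + k = n" "int k = int m - a" using e ac(2) by (auto simp: k_def b_def)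
  have "M l r (nat a) (nat b) + 2 * k \<le> M l r m n"
    using incD[OF inc_diag e(3), of r k] k by simp
  then have le: "int (M l r (nat a) (nat b)) + 2 * int k \<le> int (M l r m n)" by linarith
  have "look 1 (int m) (lb_tab l r (int n - int m)) = c + 2 * int k" using ac(3) k(3) by simp
  also have "\<dots> \<le> int (M l r (nat a) (nat b)) + 2 * int k" using e(4) by simp
  also note le
  finally show ?thesis .
qed

lemma lbv_le:
  assumes "lb_ok (int m + int n)" "dfd l r m n"
  shows "lbv l r (int m) (int n) \<le> int (M l r m n)"
proof (cases "1 \<le> m \<and> 1 \<le> n")
  case True
  have o': "lb_ok (int n + int m)" using assms(1) by (simp add: add.commute)
  note L = lb_tab_le[OF assms(1)] lb_tab_le[OF o']
  show ?thesis
    using True assms(2) L(1)[of Dot Dot] L(2)[of Dot Dot] L(1)[of Dot Backslash] L(2)[of Dot Backslash]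
      L(1)[of Backslash Backslash] L(2)[of Backslash Backslash] L(1)[of Slash Backslash] L(2)[of Slash Backslash]
      M_swap[of l r m n] M_rev[of l r m n] M_rev[of Slash Slash n m] M_rev[of Dot Backslash n m]
    by (cases l; cases r) (simp_all add: lb_tab_def dfd_def)
next
  case False
  then show ?thesis by (cases l; cases r) auto
qed

section \<open>Soundness of the lower-bound certificates\<close>

fun lb_good :: "constr \<Rightarrow> constr \<Rightarrow> int \<Rightarrow> int \<Rightarrow> int \<Rightarrow> opt \<Rightarrow> bool" where
  "lb_good l r m n c (S p q) \<longleftrightarrow> 0 \<le> p \<and> p \<le> m \<and> 0 \<le> q \<and> q \<le> n \<and> 0 < p + q \<and> p + q < m + n \<and>
     (if p = 0 then l \<noteq> Backslash else True) \<and> (if q = 0 then l \<noteq> Slash else True) \<and>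
     (if p = m then r \<noteq> Slash else True) \<and> (if q = n then r \<noteq> Backslash else True) \<and>
     c \<le> 1 + (lbv l Dot p q + lbv Dot r (m - p) (n - q))"
| "lb_good l r m n c (A p q) \<longleftrightarrow> 1 \<le> p \<and> p \<le> m \<and> 1 \<le> q \<and> q < n \<and>
     (if p = 1 then l \<noteq> Backslash else True) \<and> (if p = m then r \<noteq> Slash else True) \<and>
     c \<le> 1 + (lbv l Slash p q + lbv Backslash r (m - p + 1) (n - q))"
| "lb_good l r m n c (B p q) \<longleftrightarrow> 1 \<le> p \<and> p < m \<and> 1 \<le> q \<and> q \<le> n \<and>
     (if q = 1 then l \<noteq> Slash else True) \<and> (if q = n then r \<noteq> Backslash else True) \<and>
     c \<le> 1 + (lbv l Backslash p q + lbv Slash r (m - p) (n - q + 1))"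
| "lb_good l r m n c (D p q) \<longleftrightarrow> False"
| "lb_good l r m n c (X p q) \<longleftrightarrow> False"

lemma lb_good_reaches:
  assumes ok: "lb_ok (int m + int n - 1)" and g: "lb_good l r (int m) (int n) c a"
    and cv: "cov a (int i) (int j)" and ij: "1 \<le> i" "i \<le> m" "1 \<le> j" "j \<le> n"
  shows "reaches l r m n i j (nat c)"
proof (cases a)
  case (S p q)
  define p' q' where "p' = nat p" and "q' = nat q"
  have pq: "p = int p'" "q = int q'" using g S by (auto simp: p'_def q'_def)
  have b: "p' \<le> m" "q' \<le> n" "0 < p' + q'" "p' + q' < m + n" using g S pq by auto
  have "lb_ok (int p' + int q')" "lb_ok (int (m - p') + int (n - q'))"
    by (rule lb_ok_mono[OF ok]; use b in linarith)+
  from lbv_le[OF this(1), of l Dot] lbv_le[OF this(2), of Dot r]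
  have "c \<le> int (1 + val l r m n (Simple p' q'))" using g S pq b by (simp add: of_nat_diff)
  moreover have "ok l r m n i j (Simple p' q')" using g S pq cv ij by (auto simp: ok_def split: if_splits)
  ultimately show ?thesis by (intro reachesI) auto
next
  case (A p q)
  define p' q' where "p' = nat p" and "q' = nat q"
  have pq: "p = int p'" "q = int q'" using g A by (auto simp: p'_def q'_def)
  have b: "1 \<le> p'" "p' \<le> m" "1 \<le> q'" "q' < n" using g A pq by auto
  have o': "ok l r m n i j (Share_a p' q')" using g A pq cv ij by (auto simp: ok_def split: if_splits)
  have "lb_ok (int p' + int q')" "lb_ok (int (m - p' + 1) + int (n - q'))"
    by (rule lb_ok_mono[OF ok]; use b in linarith)+
  from lbv_le[OF this(1), of l Slash] lbv_le[OF this(2), of Backslash r]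
  have "c \<le> int (1 + val l r m n (Share_a p' q'))" using g A pq b ok_dfd(1)[OF o'] by (simp add: of_nat_diff add.commute)
  with o' show ?thesis by (intro reachesI) auto
next
  case (B p q)
  define p' q' where "p' = nat p" and "q' = nat q"
  have pq: "p = int p'" "q = int q'" using g B by (auto simp: p'_def q'_def)
  have b: "1 \<le> p'" "p' < m" "1 \<le> q'" "q' \<le> n" using g B pq by auto
  have o': "ok l r m n i j (Share_b p' q')" using g B pq cv ij by (auto simp: ok_def split: if_splits)
  have "lb_ok (int p' + int q')" "lb_ok (int (m - p') + int (n - q' + 1))"
    by (rule lb_ok_mono[OF ok]; use b in linarith)+
  from lbv_le[OF this(1), of l Backslash] lbv_le[OF this(2), of Slash r]
  have "c \<le> int (1 + val l r m n (Share_b p' q'))" using g B pq b ok_dfd(2)[OF o'] by (simp add: of_nat_diff add.commute)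
  with o' show ?thesis by (intro reachesI) auto
qed (use g in auto)

text \<open>All cells of the problem have to be answered, so the scan starts at cell (1, 1) with
  nothing covered.\<close>

definition lb_check :: "constr \<Rightarrow> constr \<Rightarrow> int \<Rightarrow> (int \<times> int) \<Rightarrow> opt list \<Rightarrow> bool" where
  "lb_check l r d e os = (case e of (m, c) \<Rightarrow>
     1 \<le> m \<and> 1 \<le> m + d \<and> (if l = Backslash then 2 \<le> m else True) \<and> (if l = Slash then 2 \<le> m + d else True) \<and>
     list_all (lb_good l r m (m + d) c) os \<and> chain m (m + d) 1 1 1 os)"

definition lb_checked :: "constr \<Rightarrow> constr \<Rightarrow> bool" where
  "lb_checked l r \<longleftrightarrow> (\<forall>d. \<exists>oss. list_all2 (lb_check l r d) (lb_tab l r d) oss)"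

lemma lb_okI:
  assumes "\<And>l r. (l, r) \<in> {(Dot, Dot), (Dot, Backslash), (Backslash, Backslash), (Slash, Backslash)} \<Longrightarrow> lb_checked l r"
  shows "lb_ok N"
proof -
  have "lb_ok (int k)" for k
  proof (induction k rule: less_induct)
    case (less k)
    show ?case unfolding lb_ok_def
    proof (intro allI impI)
      fix l r d a c assume e: "(a, c) \<in> set (lb_tab l r d)" "2 * a + d \<le> int k"
      then have "(l, r) \<in> {(Dot, Dot), (Dot, Backslash), (Backslash, Backslash), (Slash, Backslash)}"
        by (cases l; cases r) (auto simp: lb_tab_def)
      from assms[OF this] obtain oss where "list_all2 (lb_check l r d) (lb_tab l r d) oss" by (auto simp: lb_checked_def)
      with e(1) obtain os where chk: "lb_check l r d (a, c) os"
        by (metis (no_types, lifting) in_set_conv_nth list_all2_conv_all_nth)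
      then have a: "1 \<le> a" "1 \<le> a + d" by (auto simp: lb_check_def)
      define m n where "m = nat a" and "n = nat (a + d)"
      have mn: "a = int m" "a + d = int n" using a by (auto simp: m_def n_def)
      have d: "d = int n - int m" using mn by linarith
      have r: "reg l m n" using chk a mn by (auto simp: lb_check_def reg_def split: if_splits)
      have "lb_ok (int (k - 1))" using less.IH[of "k - 1"] e(2) a by auto
      then have ok: "lb_ok (int m + int n - 1)" by (rule lb_ok_mono) (use e(2) mn a in linarith)
      have "nat c \<le> M l r m n"
      proof (rule M_ge_reaches)
        fix i j assume ij: "1 \<le> i" "i \<le> m" "1 \<le> j" "j \<le> n"
        have "chain (int m) (int n) 1 1 1 os" "list_all (lb_good l r (int m) (int n) c) os"
          using chk by (auto simp: lb_check_def mn(1) d)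
        with chain_sound[of "int m" "int n" 1 1 1 os "int i" "int j"] ij
        obtain a' where "a' \<in> set os" "cov a' (int i) (int j)" "lb_good l r (int m) (int n) c a'"
          by (auto simp: list_all_iff)
        then show "reaches l r m n i j (nat c)" using lb_good_reaches[OF ok] ij by blast
      qed (use r in \<open>auto simp: reg_def\<close>)
      then show "1 \<le> a \<and> 1 \<le> a + d \<and> reg l (nat a) (nat (a + d)) \<and> c \<le> int (M l r (nat a) (nat (a + d)))"
        using a r by (auto simp: m_def n_def)
    qed
  qed
  from this[of "nat N"] show ?thesis by (rule lb_ok_mono) auto
qed

lemma lb_checkedI:
  assumes "\<And>d. d < lo \<or> hi < d \<Longrightarrow> lb_tab l r d = []" and "map fst cs = [lo..hi]"
    and "list_all (\<lambda>(d, oss). list_all2 (lb_check l r d) (lb_tab l r d) oss) cs"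
  shows "lb_checked l r"
  unfolding lb_checked_def
proof
  fix d
  show "\<exists>oss. list_all2 (lb_check l r d) (lb_tab l r d) oss"
  proof (cases "d < lo \<or> hi < d")
    case False
    then have "d \<in> set (map fst cs)" unfolding assms(2) by auto
    then obtain oss where "(d, oss) \<in> set cs" by auto
    then show ?thesis using assms(3) by (auto simp: list_all_iff)
  qed (use assms(1) in auto)
qed

section \<open>Checking increments\<close>

text \<open>
  \<open>-1000\<close> means that no increment is known.
\<close>

fun incv :: "constr \<Rightarrow> constr \<Rightarrow> int \<Rightarrow> int \<Rightarrow> int" where
  "incv Dot Dot x y = (if y < x then look (2 * y) y (inc_tab_DD (x - y)) else look (2 * x) x (inc_tab_DD (y - x)))"
| "incv Dot Backslash x y = look (-1000) x (inc_tab_DB (y - x))"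
| "incv Dot Slash x y = look (-1000) y (inc_tab_DB (x - y))"
| "incv Backslash Dot x y = look (-1000) x (inc_tab_BD (y - x))"
| "incv Backslash Slash x y = look (-1000) x (inc_tab_BS (y - x))"
| "incv Backslash Backslash x y = (if y < x then look (2 * y) x (inc_tab_BB (y - x)) else look (2 * x) x (inc_tab_BB (y - x)))"
| "incv Slash t x y = -1000"

definition inc_tab :: "constr \<Rightarrow> constr \<Rightarrow> int \<Rightarrow> (int \<times> int) list" where
  "inc_tab r t d = (if r = Dot then if t = Dot then inc_tab_DD d else if t = Backslash then inc_tab_DB d else []
     else if r = Backslash then if t = Dot then inc_tab_BD d else if t = Slash then inc_tab_BS d else inc_tab_BB d
     else [])"

definition iinc :: "constr \<Rightarrow> constr \<Rightarrow> int \<Rightarrow> int \<Rightarrow> int \<Rightarrow> bool" where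
  "iinc r t x y c \<longleftrightarrow>
     (\<forall>l m n. reg l m n \<longrightarrow> int (M l r m n) + c \<le> int (M l t (m + nat x) (n + nat y)))"

definition inc_ok :: "constr \<Rightarrow> int \<Rightarrow> bool" where
  "inc_ok r N \<longleftrightarrow> (\<forall>t d a c. (a, c) \<in> set (inc_tab r t d) \<longrightarrow> 2 * a + d \<le> N \<longrightarrow>
     0 \<le> a \<and> 0 \<le> a + d \<and> iinc r t a (a + d) c)"

lemma inc_ok_mono: "inc_ok r N \<Longrightarrow> N' \<le> N \<Longrightarrow> inc_ok r N'"
  unfolding inc_ok_def by (meson order_trans)

lemma iinc_inc: "iinc r t (int x) (int y) (int c) \<longleftrightarrow> inc r t x y c"
proof -
  have *: "int a + int c \<le> int b \<longleftrightarrow> a + c \<le> b" for a b by linarith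
  show ?thesis by (simp only: iinc_def inc_def nat_int *)
qed

lemma iinc_swap: "iinc r t x y c \<Longrightarrow> iinc (flip r) (flip t) y x c"
  unfolding iinc_def
proof (intro allI impI)
  fix l m n
  assume i: "\<forall>l m n. reg l m n \<longrightarrow> int (M l r m n) + c \<le> int (M l t (m + nat x) (n + nat y))" and r: "reg l m n"
  then have r': "reg (flip l) n m" by (simp add: reg_swap)
  have "reg (flip l) (n + nat x) (m + nat y)" by (rule reg_mono[OF r']) auto
  then show "int (M l (flip r) m n) + c \<le> int (M l (flip t) (m + nat y) (n + nat x))"
    using i[rule_format, OF r'] M_swap[OF reg_dfd[OF r'], of r]
      M_swap[of "flip l" t "n + nat x" "m + nat y"] reg_dfd by simp
qed

lemma inc_mono_zero: "inc r r x y 0"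
  unfolding inc_def using M_mono reg_dfd by simp

lemma iinc_default: "0 \<le> x \<Longrightarrow> 0 \<le> y \<Longrightarrow> iinc r r x y (2 * min x y)"
proof -
  assume xy: "0 \<le> x" "0 \<le> y"
  define k where "k = min (nat x) (nat y)"
  have k: "k + (nat x - k) = nat x" "k + (nat y - k) = nat y" by (auto simp: k_def)
  have "inc r r (k + (nat x - k)) (k + (nat y - k)) (2 * k + 0)"
    by (rule inc_trans[OF inc_diag inc_mono_zero])
  then have "inc r r (nat x) (nat y) (2 * k)" using k by simp
  then have "iinc r r (int (nat x)) (int (nat y)) (int (2 * k))" by (subst iinc_inc)
  moreover have "int (2 * k) = 2 * min x y" using xy by (auto simp: k_def min_def)
  ultimately show ?thesis using xy by simp
qed

lemma inc_tab_le:
  assumes "inc_ok r (x + y)" "0 \<le> x" "0 \<le> y" "look z x (inc_tab r t (y - x)) = c"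
    "c = z \<Longrightarrow> iinc r t x y c"
  shows "iinc r t x y c"
  using look_cases[of z x "inc_tab r t (y - x)"]
proof
  assume "look z x (inc_tab r t (y - x)) = z"
  then show ?thesis using assms by simp
next
  assume "\<exists>a e. (a, e) \<in> set (inc_tab r t (y - x)) \<and> a \<le> x \<and> look z x (inc_tab r t (y - x)) = e + 2 * (x - a)"
  then obtain a e where ae: "(a, e) \<in> set (inc_tab r t (y - x))" "a \<le> x" "c = e + 2 * (x - a)"
    using assms(4) by auto
  have "2 * a + (y - x) \<le> x + y" using ae(2) by linarith
  then have e: "0 \<le> a" "0 \<le> a + (y - x)" "iinc r t a (a + (y - x)) e"
    using assms(1) ae(1) unfolding inc_ok_def by blast+
  define k where "k = nat (x - a)"
  have k: "nat a + k = nat x" "nat (a + (y - x)) + k = nat y" "2 * int k = 2 * (x - a)"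
    using e ae(2) by (auto simp: k_def)
  show ?thesis unfolding iinc_def
  proof (intro allI impI)
    fix l m n assume r: "reg l m n"
    have r': "reg l (m + nat a) (n + nat (a + (y - x)))" by (rule reg_mono[OF r]) auto
    have "int (M l r m n) + e \<le> int (M l t (m + nat a) (n + nat (a + (y - x))))"
      using e(3) r unfolding iinc_def by blast
    moreover have "int (M l t (m + nat a) (n + nat (a + (y - x)))) + 2 * int k
        \<le> int (M l t (m + nat a + k) (n + nat (a + (y - x)) + k))"
      using incD[OF inc_diag r', of t k] by linarith
    ultimately show "int (M l r m n) + c \<le> int (M l t (m + nat x) (n + nat y))"
      using ae(3) k by (simp add: add.assoc)
  qed
qed

lemma incv_le:
  assumes "inc_ok Dot (x + y)" "r = Backslash \<Longrightarrow> inc_ok Backslash (x + y)" "0 \<le> x" "0 \<le> y" "- 9 \<le> incv r t x y"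
  shows "iinc r t x y (incv r t x y)"
proof -
  have o': "inc_ok Dot (y + x)" using assms(1) by (simp add: add.commute)
  note L = inc_tab_le[OF assms(1,3,4)] and L' = inc_tab_le[OF o' assms(4,3)]
  have d: "iinc r r x y (2 * y)" if "y < x" for r using iinc_default[of x y r] assms(3,4) that by simp
  have d': "iinc r r x y (2 * x)" if "\<not> y < x" for r using iinc_default[of x y r] assms(3,4) that by simp
  have d'': "iinc r r y x (2 * y)" if "y < x" for r using iinc_default[of y x r] assms(3,4) that by simp
  show ?thesis
  proof (cases r)
    case Dot
    show ?thesis
    proof (cases t)
      case t: Dot
      show ?thesis
      proof (cases "y < x")
        case True
        have "iinc Dot Dot y x (incv r t x y)"
        proof (rule L'[where z = "2 * y"])
          assume "incv r t x y = 2 * y"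
          with d''[OF True] show "iinc Dot Dot y x (incv r t x y)" by simp
        qed (use Dot t True in \<open>simp add: inc_tab_def\<close>)
        from iinc_swap[OF this] show ?thesis using Dot t by simp
      next
        case False
        have "iinc Dot Dot x y (incv r t x y)"
        proof (rule L[where z = "2 * x"])
          assume "incv r t x y = 2 * x"
          with d'[OF False] show "iinc Dot Dot x y (incv r t x y)" by simp
        qed (use Dot t False in \<open>simp add: inc_tab_def\<close>)
        then show ?thesis using Dot t by simp
      qed
    next
      case t: Slash
      have "iinc Dot Backslash y x (incv r t x y)"
        by (rule L'[where z = "-1000"]) (use Dot t assms(5) in \<open>simp_all add: inc_tab_def\<close>)
      from iinc_swap[OF this] show ?thesis using Dot t by simp
    next
      case t: Backslash
      have "iinc Dot Backslash x y (incv r t x y)"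
        by (rule L[where z = "-1000"]) (use Dot t assms(5) in \<open>simp_all add: inc_tab_def\<close>)
      then show ?thesis using Dot t by simp
    qed
  next
    case Backslash
    note LB = inc_tab_le[OF assms(2)[OF Backslash] assms(3,4)]
    show ?thesis
    proof (cases "t = Backslash")
      case t: True
      show ?thesis
      proof (cases "y < x")
        case True
        have "iinc Backslash Backslash x y (incv r t x y)"
        proof (rule LB[where z = "2 * y"])
          assume "incv r t x y = 2 * y"
          with d[OF True] show "iinc Backslash Backslash x y (incv r t x y)" by simp
        qed (use Backslash t True in \<open>simp add: inc_tab_def\<close>)
        then show ?thesis using Backslash t by simp
      next
        case False
        have "iinc Backslash Backslash x y (incv r t x y)"
        proof (rule LB[where z = "2 * x"])
          assume "incv r t x y = 2 * x"
          with d'[OF False] show "iinc Backslash Backslash x y (incv r t x y)" by simp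
        qed (use Backslash t False in \<open>simp add: inc_tab_def\<close>)
        then show ?thesis using Backslash t by simp
      qed
    next
      case t: False
      have "iinc Backslash t x y (incv r t x y)"
        by (rule LB[where z = "-1000"]; insert Backslash t assms(5); cases t) (simp_all add: inc_tab_def)
      then show ?thesis using Backslash by simp
    qed
  next
    case Slash
    then show ?thesis using assms(5) by simp
  qed
qed

text \<open>
  For \<open>r = Backslash\<close> the base point is \<open>(m, n - 1)\<close>: a splitting may cut before \<open>b n\<close>, and then
  \<open>M_Backslash_le\<close> or \<open>M_le_Dot\<close> relates the small problem to one without right constraint.
\<close>

definition fb :: "constr \<Rightarrow> constr \<Rightarrow> int \<Rightarrow> int \<Rightarrow> int" where
  "fb r k p q = (if r = Dot then incv Dot k p q else
     mx (incv Dot k p q - 1) (if q < 1 then -1000 else mx (incv Backslash k p (q - 1))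
       (if k = Dot then incv Dot Dot p (q - 1) else -1000)))"

text \<open>With base point \<open>(m, n)\<close> the small problem is
  \<open>(m, n + sh r)\<close>.\<close>

definition sh :: "constr \<Rightarrow> nat" where "sh r = (if r = Dot then 0 else 1)"

lemma fb_le:
  assumes D: "inc_ok Dot (p + q)" and B: "r = Backslash \<Longrightarrow> inc_ok Backslash (p + q - 1)"
    and "r = Dot \<or> r = Backslash" "0 \<le> p" "0 \<le> q" "- 9 \<le> fb r k p q" "reg l m n"
  shows "int (M l r m (n + sh r)) + fb r k p q \<le> int (M l k (m + nat p) (n + nat q))"
proof (cases "r = Dot")
  case True
  then show ?thesis using incv_le[OF D _ assms(4,5), of Dot k] assms(6,7)
    by (simp add: fb_def sh_def iinc_def)
next
  case False
  then have r: "r = Backslash" using assms(3) by simp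
  have rg: "reg l m (n + 1)" by (rule reg_mono[OF assms(7)]) auto
  let ?f = "fb r k p q"
  consider "?f = incv Dot k p q - 1" | "1 \<le> q" "?f = incv Backslash k p (q - 1)" | "1 \<le> q" "k = Dot" "?f = incv Dot Dot p (q - 1)"
    using r assms(6) by (auto simp: fb_def mx_def split: if_splits)
  then show ?thesis
  proof cases
    case 1
    then have "iinc Dot k p q (incv Dot k p q)" using assms(6) by (intro incv_le[OF D _ assms(4,5)]) auto
    then have "int (M l Dot m n) + incv Dot k p q \<le> int (M l k (m + nat p) (n + nat q))"
      using assms(7) by (simp add: iinc_def)
    moreover have "M l Backslash m (n + 1) \<le> 1 + M l Dot m n"
      using M_Backslash_le[OF reg_dfd[OF rg]] assms(7) by (simp add: reg_def)
    ultimately show ?thesis using 1 r by (simp add: sh_def)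
  next
    case 2
    have q: "n + 1 + nat (q - 1) = n + nat q" using 2(1) by linarith
    have D': "inc_ok Dot (p + (q - 1))" by (rule inc_ok_mono[OF D]) simp
    have B': "inc_ok Backslash (p + (q - 1))" using B[OF r] by (simp add: algebra_simps)
    have "iinc Backslash k p (q - 1) (incv Backslash k p (q - 1))"
      by (rule incv_le[OF D' B']) (use 2 assms in auto)
    from this[unfolded iinc_def, rule_format, OF rg] show ?thesis using 2 r unfolding q by (simp add: sh_def)
  next
    case 3
    have q: "n + 1 + nat (q - 1) = n + nat q" using 3(1) by linarith
    have D': "inc_ok Dot (p + (q - 1))" by (rule inc_ok_mono[OF D]) simp
    have "iinc Dot Dot p (q - 1) (incv Dot Dot p (q - 1))"
      by (rule incv_le[OF D']) (use 3 assms in auto)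
    from this[unfolded iinc_def, rule_format, OF rg]
    have "int (M l Dot m (n + 1)) + ?f \<le> int (M l k (m + nat p) (n + nat q))"
      using 3 unfolding q by simp
    then show ?thesis using M_le_Dot[OF reg_dfd[OF rg], of Backslash] r by (simp add: sh_def)
  qed
qed

text \<open>Values below -9 signal a missing increment: known increments are nonnegative and
  \<open>fb\<close> lowers them by at most 1, whereas the markers lie near -1000.\<close>

definition enough :: "int \<Rightarrow> int \<Rightarrow> int \<Rightarrow> bool" where
  "enough c f b \<longleftrightarrow> (if f < -9 then False else c \<le> f + b)"

text \<open>\<open>D\<close> must pass for both neighbours, as \<open>M_Dot_step\<close> does not
  say which one gains. Its \<open>c - 2\<close> accounts for the comparison and for this gain, the
  \<open>c - 1\<close> of the other options for the comparison alone.\<close>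

fun inc_good :: "constr \<Rightarrow> constr \<Rightarrow> int \<Rightarrow> int \<Rightarrow> int \<Rightarrow> opt \<Rightarrow> bool" where
  "inc_good r t x y c (S p q) \<longleftrightarrow> 0 \<le> p \<and> p \<le> x \<and> 0 \<le> q \<and> q \<le> y \<and> p + q < x + y \<and>
     (if p = x then t \<noteq> Slash else True) \<and> (if q = y then t \<noteq> Backslash else True) \<and>
     enough (c - 1) (fb r Dot p q) (lbv Dot t (x - p) (y - q))"
| "inc_good r t x y c (A p q) \<longleftrightarrow> 0 \<le> p \<and> p \<le> x \<and> 0 \<le> q \<and> q < y \<and>
     (if p = x then t \<noteq> Slash else True) \<and>
     enough (c - 1) (fb r Slash p q) (lbv Backslash t (x - p + 1) (y - q))"
| "inc_good r t x y c (B p q) \<longleftrightarrow> 0 \<le> p \<and> p < x \<and> 0 \<le> q \<and> q \<le> y \<and>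
     (if q = y then t \<noteq> Backslash else True) \<and>
     enough (c - 1) (fb r Backslash p q) (lbv Slash t (x - p) (y - q + 1))"
| "inc_good r t x y c (D p q) \<longleftrightarrow> 0 \<le> p \<and> p < x \<and> 0 \<le> q \<and> q < y \<and>
     (if p + 1 = x then t \<noteq> Slash else True) \<and> (if q + 1 = y then t \<noteq> Backslash else True) \<and>
     enough (c - 2) (fb r Dot p q) (lbv Dot t (x - p - 1) (y - q)) \<and>
     enough (c - 2) (fb r Dot p q) (lbv Dot t (x - p) (y - q - 1))"
| "inc_good r t x y c (X p q) \<longleftrightarrow> 0 \<le> p \<and> 0 \<le> q"

fun is_X :: "opt \<Rightarrow> bool" where
  "is_X (X p q) = True" | "is_X (S p q) = False" | "is_X (A p q) = False" | "is_X (B p q) = False" | "is_X (D p q) = False"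

text \<open>With \<open>0 \<le> p\<close> from \<open>inc_good\<close>, such an option answers every
  cell in rows \<open>u \<le> 0\<close> beyond column \<open>s\<close>. There is no bound on the
  number of these rows, and the scan from row 1 does not visit them.\<close>

fun starts :: "int \<Rightarrow> opt \<Rightarrow> bool" where
  "starts s (S p q) = (q \<le> s)"
| "starts s (A p q) = (if q \<le> s then 1 \<le> p else False)"
| "starts s (B p q) = (q \<le> s)"
| "starts s (D p q) = False"
| "starts s (X p q) = False"

lemma enough_nat:
  assumes "enough (c - 1) f b" "int M0 + f \<le> int v1" "b \<le> int v2"
  shows "nat (int M0 + c) \<le> 1 + (v1 + v2)"
  using assms by (auto simp: enough_def split: if_splits)

text \<open>For \<open>r = Backslash\<close> the coordinate \<open>y\<close> is one more than the
  true shift, and \<open>fb\<close> reads increments from \<open>Backslash\<close> at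
  \<open>(p, q - 1)\<close>. Since \<open>p + q < x + y\<close>, their sizes are at most
  \<open>x + y - 2\<close>, one less than the size of the shift to be established.\<close>

lemma inc_good_reaches:
  assumes lb: "\<And>N. lb_ok N" and D: "inc_ok Dot (int x + int y - (if r = Dot then 1 else 0))"
    and B: "r = Backslash \<Longrightarrow> inc_ok Backslash (int x + int y - 2)"
    and r: "r = Dot \<or> r = Backslash"
    and g: "inc_good r t (int x) (int y) c a" "\<not> is_X a" and rg: "reg l m n"
    and cv: "cov a (int i - int m) (int j - int n)" and ij: "1 \<le> i" "i \<le> m + x" "1 \<le> j" "j \<le> n + y"
  shows "reaches l t (m + x) (n + y) i j (nat (int (M l r m (n + sh r)) + c))"
proof -
  have rg': "1 \<le> m" "1 \<le> n" "l = Backslash \<Longrightarrow> 2 \<le> m" "l = Slash \<Longrightarrow> 2 \<le> n" using rg by (auto simp: reg_def)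
  have F: "int (M l r m (n + sh r)) + fb r k (int p) (int q) \<le> int (M l k (m + p) (n + q))"
    if "p + q < x + y" "- 9 \<le> fb r k (int p) (int q)" for k p q
    using fb_le[of "int p" "int q" r k l m n] that r rg
      inc_ok_mono[OF D, of "int p + int q"] inc_ok_mono[OF B, of "int p + int q - 1"] by auto
  show ?thesis
  proof (cases a)
    case (S p q)
    define p' q' where "p' = nat p" and "q' = nat q"
    have pq: "p = int p'" "q = int q'" using g S by (auto simp: p'_def q'_def)
    have b: "p' \<le> x" "q' \<le> y" "p' + q' < x + y" using g S pq by auto
    have o': "ok l t (m + x) (n + y) i j (Simple (m + p') (n + q'))"
      using g S pq cv ij rg' by (auto simp: ok_def split: if_splits)
    have "lbv Dot t (int x - int p') (int y - int q') \<le> int (M Dot t (x - p') (y - q'))"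
      using lbv_le[OF lb, of Dot t "x - p'" "y - q'"] b by (simp add: of_nat_diff)
    then have "nat (int (M l r m (n + sh r)) + c) \<le> 1 + (M l Dot (m + p') (n + q') + M Dot t (x - p') (y - q'))"
      using g S pq b F[of p' q' Dot] by (intro enough_nat) (auto simp: enough_def split: if_splits)
    with o' show ?thesis using b by (intro reachesI[OF o']) simp
  next
    case (A p q)
    define p' q' where "p' = nat p" and "q' = nat q"
    have pq: "p = int p'" "q = int q'" using g A by (auto simp: p'_def q'_def)
    have b: "p' \<le> x" "q' < y" using g A pq by auto
    have o': "ok l t (m + x) (n + y) i j (Share_a (m + p') (n + q'))"
      using g A pq cv ij rg' by (auto simp: ok_def split: if_splits)
    have "dfd Backslash t (x - p' + 1) (y - q')" using ok_dfd(1)[OF o'] by auto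
    from lbv_le[OF lb this] have "lbv Backslash t (int x - int p' + 1) (int y - int q') \<le> int (M Backslash t (x - p' + 1) (y - q'))"
      using b by (simp add: of_nat_diff add.commute)
    then have "nat (int (M l r m (n + sh r)) + c) \<le> 1 + (M l Slash (m + p') (n + q') + M Backslash t (x - p' + 1) (y - q'))"
      using g A pq b F[of p' q' Slash] by (intro enough_nat) (auto simp: enough_def split: if_splits)
    with o' show ?thesis using b by (intro reachesI[OF o']) simp
  next
    case (B p q)
    define p' q' where "p' = nat p" and "q' = nat q"
    have pq: "p = int p'" "q = int q'" using g B by (auto simp: p'_def q'_def)
    have b: "p' < x" "q' \<le> y" using g B pq by auto
    have o': "ok l t (m + x) (n + y) i j (Share_b (m + p') (n + q'))"
      using g B pq cv ij rg' by (auto simp: ok_def split: if_splits)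
    have "dfd Slash t (x - p') (y - q' + 1)" using ok_dfd(2)[OF o'] by auto
    from lbv_le[OF lb this] have "lbv Slash t (int x - int p') (int y - int q' + 1) \<le> int (M Slash t (x - p') (y - q' + 1))"
      using b by (simp add: of_nat_diff add.commute)
    then have "nat (int (M l r m (n + sh r)) + c) \<le> 1 + (M l Backslash (m + p') (n + q') + M Slash t (x - p') (y - q' + 1))"
      using g B pq b F[of p' q' Backslash] by (intro enough_nat) (auto simp: enough_def split: if_splits)
    with o' show ?thesis using b by (intro reachesI[OF o']) simp
  next
    case (D p q)
    define p' q' where "p' = nat p" and "q' = nat q"
    have pq: "p = int p'" "q = int q'" using g D by (auto simp: p'_def q'_def)
    have b: "p' < x" "q' < y" using g D pq by auto
    have f: "int (M l r m (n + sh r)) + fb r Dot (int p') (int q') \<le> int (M l Dot (m + p') (n + q'))"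
      using F[of p' q' Dot] g D pq b by (auto simp: enough_def split: if_splits)
    have l1: "lbv Dot t (int x - int p' - 1) (int y - int q') \<le> int (M Dot t (x - (p' + 1)) (y - q'))"
      and l2: "lbv Dot t (int x - int p') (int y - int q' - 1) \<le> int (M Dot t (x - p') (y - (q' + 1)))"
      using lbv_le[OF lb, of Dot t "x - (p' + 1)" "y - q'"] lbv_le[OF lb, of Dot t "x - p'" "y - (q' + 1)"] b
      by (auto simp: of_nat_diff algebra_simps)
    have "reg l (m + p') (n + q')" by (rule reg_mono[OF rg]) auto
    from M_Dot_step[OF this] show ?thesis
    proof
      assume st: "M l Dot (m + p') (n + q') + 1 \<le> M l Dot (m + p' + 1) (n + q')"
      have "ok l t (m + x) (n + y) i j (Simple (m + p' + 1) (n + q'))"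
        using g D pq cv ij rg' by (auto simp: ok_def split: if_splits)
      moreover have "nat (int (M l r m (n + sh r)) + c) \<le> 1 + val l t (m + x) (n + y) (Simple (m + p' + 1) (n + q'))"
        using g D pq f l1 st by (auto simp: enough_def split: if_splits)
      ultimately show ?thesis by (intro reachesI)
    next
      assume st: "M l Dot (m + p') (n + q') + 1 \<le> M l Dot (m + p') (n + q' + 1)"
      have "ok l t (m + x) (n + y) i j (Simple (m + p') (n + q' + 1))"
        using g D pq cv ij rg' by (auto simp: ok_def split: if_splits)
      moreover have "nat (int (M l r m (n + sh r)) + c) \<le> 1 + val l t (m + x) (n + y) (Simple (m + p') (n + q' + 1))"
        using g D pq f l2 st by (auto simp: enough_def split: if_splits)
      ultimately show ?thesis by (intro reachesI)
    qed
  qed (use g in auto)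
qed

text \<open>Old columns are collapsed into column 0, where the scan begins; rows up to 0 are left to
  \<open>starts\<close>. Its frontier is 1 for \<open>Backslash\<close> because column 1 is then the
  old \<open>b n\<close>, whose cells in old rows are answered by transplanting.\<close>

definition inc_cells :: "constr \<Rightarrow> constr \<Rightarrow> int \<Rightarrow> int \<Rightarrow> int \<Rightarrow> opt list \<Rightarrow> bool" where
  "inc_cells r t x y c os \<longleftrightarrow> list_all (inc_good r t x y c) os \<and>
     list_ex (starts (if r = Dot then 0 else 1)) os \<and> chain x y 1 0 0 os"

lemma inc_cells_reaches:
  assumes lb: "\<And>N. lb_ok N" and D: "inc_ok Dot (int x + int y - (if r = Dot then 1 else 0))"
    and B: "r = Backslash \<Longrightarrow> inc_ok Backslash (int x + int y - 2)"
    and r: "r = Dot \<or> r = Backslash"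
    and c: "inc_cells r t (int x) (int y) c os" and rg: "reg l m n"
    and ij: "1 \<le> i" "i \<le> m + x" "1 \<le> j" "j \<le> n + y" "m < i \<or> n + sh r < j"
    and X: "\<And>p q. X p q \<in> set os \<Longrightarrow> int i = int m + p + 1 \<Longrightarrow> int j = int n + q + 1 \<Longrightarrow> False"
  shows "reaches l t (m + x) (n + y) i j (nat (int (M l r m (n + sh r)) + c))"
proof -
  have good: "inc_good r t (int x) (int y) c a" if "a \<in> set os" for a
    using c that by (auto simp: inc_cells_def list_all_iff)
  have R: "reaches l t (m + x) (n + y) i j (nat (int (M l r m (n + sh r)) + c))"
    if "a \<in> set os" "\<not> is_X a" "cov a (int i - int m) (int j - int n)" for a
    by (rule inc_good_reaches[OF lb D _ r good[OF that(1)] that(2) rg that(3) ij(1-4)]) (fact B)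
  show ?thesis
  proof (cases "i \<le> m")
    case True
    obtain a where a: "a \<in> set os" "starts (int (sh r)) a"
      using c by (auto simp: inc_cells_def list_ex_iff sh_def split: if_splits)
    have u: "int i - int m \<le> 0" and v: "int (sh r) < int j - int n" using True ij(5) by auto
    have "\<not> is_X a \<and> cov a (int i - int m) (int j - int n)"
      using a(2) good[OF a(1)] u v by (cases a) (auto simp del: of_nat_less_iff split: if_splits)
    then show ?thesis using R[OF a(1)] by blast
  next
    case False
    \<comment> \<open>Column 0 stands for all old columns: as \<open>0 \<le> q\<close>, an option
      that answers column 0 of a row also answers everything to the left of it.\<close>
    define v where "v = max 0 (int j - int n)"
    have "chain (int x) (int y) 1 0 0 os" using c by (simp add: inc_cells_def)
    from chain_sound[OF this, of "int i - int m" v] obtain a where a: "a \<in> set os" "cov a (int i - int m) v"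
      using False ij by (auto simp: v_def)
    have n: "0 \<le> q" if "a = S p q \<or> a = A p q \<or> a = B p q \<or> a = D p q \<or> a = X p q" for p q
      using good[OF a(1)] that by auto
    have cv: "cov a (int i - int m) (int j - int n)"
    proof (cases "int j - int n \<le> 0")
      case True
      then have "v = 0" by (simp add: v_def)
      then show ?thesis using a(2) n True by (cases a) auto
    next
      case False
      then have "v = int j - int n" by (simp add: v_def)
      then show ?thesis using a(2) by simp
    qed
    show ?thesis
    proof (cases "is_X a")
      case True
      then obtain p q where "a = X p q" by (cases a) auto
      then have "int i = int m + p + 1 \<and> int j = int n + q + 1" using cv by auto
      then show ?thesis using X \<open>a = X p q\<close> a(1) by blast
    next
      case False
      then show ?thesis using R[OF a(1) _ cv] by blast
    qed
  qed
qed

text \<open>The inequalities are the caps of \<open>inc_DotI\<close> and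
  \<open>inc_BackslashI\<close>, read from the tables. For \<open>Backslash\<close> the scan extends
  to \<open>x + d + 1\<close>, since the base point lies one column to the left of the end of the
  small problem.\<close>

definition inc_check :: "constr \<Rightarrow> constr \<Rightarrow> int \<Rightarrow> (int \<times> int) \<Rightarrow> opt list \<Rightarrow> bool" where
  "inc_check r t d e os = (case e of (x, c) \<Rightarrow> 0 \<le> x \<and> 0 \<le> x + d \<and> 0 \<le> c \<and>
     (if t = Slash then 1 \<le> x else True) \<and>
     (if r = Dot then (if t = Backslash then 1 \<le> x + d else True) \<and>
        c \<le> lbv Dot t x (x + d + 1) \<and> c \<le> lbv Dot t (x + 1) (x + d) \<and>
        c + 1 \<le> lbv Backslash t (x + 1) (x + d + 1) \<and> c + 1 \<le> lbv Slash t (x + 1) (x + d + 1) \<and>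
        inc_cells r t x (x + d) c os
      else c \<le> lbv Dot t x (x + d + 1) \<and> c + 1 \<le> lbv Backslash t (x + 1) (x + d + 2) \<and>
        c + 1 \<le> lbv Dot t (x + 1) (x + d + 1) \<and> c + 1 \<le> lbv Backslash t (x + 2) (x + d + 1) \<and>
        c + 2 \<le> lbv Slash t (x + 1) (x + d + 2) \<and> inc_cells r t x (x + d + 1) c os) \<and>
     list_all (\<lambda>a. \<not> is_X a) os)"

definition inc_checked :: "constr \<Rightarrow> constr \<Rightarrow> bool" where
  "inc_checked r t \<longleftrightarrow> (\<forall>d. \<exists>oss. list_all2 (inc_check r t d) (inc_tab r t d) oss)"

lemma inc_checkedD:
  assumes "inc_checked r t" "(a, c) \<in> set (inc_tab r t d)"
  obtains os where "inc_check r t d (a, c) os"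
  using assms unfolding inc_checked_def
  by (metis (no_types, lifting) in_set_conv_nth list_all2_conv_all_nth)

lemma lbv_nat_le:
  assumes "\<And>N. lb_ok N" "dfd l r m n" "c \<le> lbv l r (int m) (int n)"
  shows "c \<le> int (M l r m n)"
  using lbv_le[OF assms(1,2)] assms(3) by linarith

lemma inc_ok_DotI:
  assumes lb: "\<And>N. lb_ok N" and ch: "inc_checked Dot Dot" "inc_checked Dot Backslash"
  shows "inc_ok Dot N"
proof -
  have "inc_ok Dot (int k)" for k
  proof (induction k rule: less_induct)
    case (less k)
    show ?case unfolding inc_ok_def
    proof (intro allI impI)
      fix t d a c assume e: "(a, c) \<in> set (inc_tab Dot t d)" "2 * a + d \<le> int k"
      then have t: "t = Dot \<or> t = Backslash" by (cases t) (auto simp: inc_tab_def)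
      with e(1) ch obtain os where chk: "inc_check Dot t d (a, c) os" by (auto elim: inc_checkedD)
      then have a: "0 \<le> a" "0 \<le> a + d" "0 \<le> c" by (auto simp: inc_check_def)
      define x y z where "x = nat a" and "y = nat (a + d)" and "z = nat c"
      have xy: "a = int x" "d = int y - int x" "c = int z" using a by (auto simp: x_def y_def z_def)
      have tt: "t = Slash \<longrightarrow> 1 \<le> x" "t = Backslash \<longrightarrow> 1 \<le> y" using chk xy by (auto simp: inc_check_def)
      have caps: "int z \<le> lbv Dot t (int x) (int (y + 1))" "int z \<le> lbv Dot t (int (x + 1)) (int y)"
        "int (z + 1) \<le> lbv Backslash t (int (x + 1)) (int (y + 1))" "int (z + 1) \<le> lbv Slash t (int (x + 1)) (int (y + 1))"
        and ic: "inc_cells Dot t (int x) (int y) (int z) os" and nX: "list_all (\<lambda>a. \<not> is_X a) os"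
        using chk by (auto simp: inc_check_def xy algebra_simps)
      have ok: "inc_ok Dot (int x + int y - (if Dot = Dot then 1 else 0))"
      proof (cases "x + y = 0")
        case True
        \<comment> \<open>For the empty shift, sizes up to -1 are asked for. No entry is that small,
          since checked entries have nonnegative coordinates.\<close>
        have "\<not> inc_ok Dot (-1) \<Longrightarrow> False"
        proof -
          assume "\<not> inc_ok Dot (-1)"
          then obtain t' d' a' c' where "(a', c') \<in> set (inc_tab Dot t' d')" "2 * a' + d' \<le> -1"
            by (auto simp: inc_ok_def)
          moreover from this(1) have "t' = Dot \<or> t' = Backslash" by (cases t') (auto simp: inc_tab_def)
          ultimately obtain os' where "inc_check Dot t' d' (a', c') os'" using ch by (auto elim: inc_checkedD)
          then show False using \<open>2 * a' + d' \<le> -1\<close> by (auto simp: inc_check_def)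
        qed
        then show ?thesis using True by auto
      next
        case False
        then have "nat (int x + int y - 1) < k" using e(2) xy by auto
        from less.IH[OF this] show ?thesis using False by (auto elim: inc_ok_mono)
      qed
      have "inc Dot t x y z"
      proof (rule inc_DotI)
        show "z \<le> M Dot t x (y + 1)" "z \<le> M Dot t (x + 1) y"
          using lbv_nat_le[OF lb _ caps(1)] lbv_nat_le[OF lb _ caps(2)] by auto
        show "z + 1 \<le> M Backslash t (x + 1) (y + 1)" "z + 1 \<le> M Slash t (x + 1) (y + 1)"
          using lbv_nat_le[OF lb _ caps(3)] lbv_nat_le[OF lb _ caps(4)] tt by (auto simp: dfd_def)
      next
        fix l m n i j assume h: "reg l m n" "1 \<le> i" "i \<le> m + x" "1 \<le> j" "j \<le> n + y" "m < i \<or> n < j"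
        have "reaches l t (m + x) (n + y) i j (nat (int (M l Dot m (n + sh Dot)) + int z))"
          by (rule inc_cells_reaches[OF lb ok _ _ ic h(1-5)]) (use h(6) nX in \<open>auto simp: sh_def list_all_iff\<close>)
        then show "reaches l t (m + x) (n + y) i j (M l Dot m n + z)"
          by (simp add: sh_def nat_int_add)
      qed (use tt in auto)
      then show "0 \<le> a \<and> 0 \<le> a + d \<and> iinc Dot t a (a + d) c"
        using a xy by (simp add: iinc_inc)
    qed
  qed
  from this[of "nat N"] show ?thesis by (rule inc_ok_mono) auto
qed

text \<open>The increments from \<open>Dot\<close> are already available in every size, so the
  induction concerns only those from \<open>Backslash\<close>.\<close>

lemma inc_ok_BackslashI:
  assumes lb: "\<And>N. lb_ok N" and D: "\<And>N. inc_ok Dot N" and ch: "\<And>t. inc_checked Backslash t"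
  shows "inc_ok Backslash N"
proof -
  have neg: "inc_ok Backslash N" if "N < 0" for N
    unfolding inc_ok_def
  proof (intro allI impI)
    fix t d a c assume e: "(a, c) \<in> set (inc_tab Backslash t d)" "2 * a + d \<le> N"
    with ch obtain os where "inc_check Backslash t d (a, c) os" by (auto elim: inc_checkedD)
    then show "0 \<le> a \<and> 0 \<le> a + d \<and> iinc Backslash t a (a + d) c"
      using e(2) that by (auto simp: inc_check_def)
  qed
  have "inc_ok Backslash (int k)" for k
  proof (induction k rule: less_induct)
    case (less k)
    show ?case unfolding inc_ok_def
    proof (intro allI impI)
      fix t d a c assume e: "(a, c) \<in> set (inc_tab Backslash t d)" "2 * a + d \<le> int k"
      with ch obtain os where chk: "inc_check Backslash t d (a, c) os" by (auto elim: inc_checkedD)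
      then have a: "0 \<le> a" "0 \<le> a + d" "0 \<le> c" by (auto simp: inc_check_def)
      define x y z where "x = nat a" and "y = nat (a + d)" and "z = nat c"
      have xy: "a = int x" "d = int y - int x" "c = int z" using a by (auto simp: x_def y_def z_def)
      have tt: "t = Slash \<longrightarrow> 1 \<le> x" using chk xy by (auto simp: inc_check_def)
      have caps: "int z \<le> lbv Dot t (int x) (int (y + 1))" "int (z + 1) \<le> lbv Backslash t (int (x + 1)) (int (y + 2))"
        "int (z + 1) \<le> lbv Dot t (int (x + 1)) (int (y + 1))" "int (z + 1) \<le> lbv Backslash t (int (x + 2)) (int (y + 1))"
        "int (z + 2) \<le> lbv Slash t (int (x + 1)) (int (y + 2))"
        and ic: "inc_cells Backslash t (int x) (int (y + 1)) (int z) os" and nX: "list_all (\<lambda>a. \<not> is_X a) os"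
        using chk by (auto simp: inc_check_def xy algebra_simps)
      have ok: "inc_ok Backslash (int x + int (y + 1) - 2)"
      proof (cases "x + y = 0")
        case False
        then have "nat (int x + int y - 1) < k" using e(2) xy by auto
        from less.IH[OF this] show ?thesis using False by (auto elim: inc_ok_mono)
      qed (auto intro: neg)
      have "inc Backslash t x y z"
      proof (rule inc_BackslashI)
        show "z \<le> M Dot t x (y + 1)" "z + 1 \<le> M Dot t (x + 1) (y + 1)"
          using lbv_nat_le[OF lb _ caps(1)] lbv_nat_le[OF lb _ caps(3)] by auto
        show "z + 1 \<le> M Backslash t (x + 1) (y + 2)" "z + 1 \<le> M Backslash t (x + 2) (y + 1)" "z + 2 \<le> M Slash t (x + 1) (y + 2)"
          using lbv_nat_le[OF lb _ caps(2)] lbv_nat_le[OF lb _ caps(4)] lbv_nat_le[OF lb _ caps(5)] tt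
          by (auto simp: dfd_def)
      next
        fix l m n i j assume h: "reg l m (n - 1)" "1 \<le> i" "i \<le> m + x" "1 \<le> j" "j \<le> n + y" "m < i \<or> n < j"
        have n: "n - 1 + (y + 1) = n + y" "n - 1 + 1 = n" "j \<le> n - 1 + (y + 1)" using h by (auto simp: reg_def)
        have "reaches l t (m + x) (n - 1 + (y + 1)) i j (nat (int (M l Backslash m (n - 1 + sh Backslash)) + int z))"
          by (rule inc_cells_reaches[OF lb D _ _ ic h(1-4) n(3)]) (use h(6) nX ok n in \<open>auto simp: sh_def list_all_iff\<close>)
        then show "reaches l t (m + x) (n + y) i j (M l Backslash m n + z)"
          unfolding n(1) using n(2) by (simp add: sh_def nat_int_add)
      qed (use tt in auto)
      then show "0 \<le> a \<and> 0 \<le> a + d \<and> iinc Backslash t a (a + d) c"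
        using a xy by (simp add: iinc_inc)
    qed
  qed
  from this[of "nat N"] show ?thesis by (rule inc_ok_mono) auto
qed

lemma inc_checkedI:
  assumes "\<And>d. d < lo \<or> hi < d \<Longrightarrow> inc_tab r t d = []" and "map fst cs = [lo..hi]"
    and "list_all (\<lambda>(d, oss). list_all2 (inc_check r t d) (inc_tab r t d) oss) cs"
  shows "inc_checked r t"
  unfolding inc_checked_def
proof
  fix d
  show "\<exists>oss. list_all2 (inc_check r t d) (inc_tab r t d) oss"
  proof (cases "d < lo \<or> hi < d")
    case False
    then have "d \<in> set (map fst cs)" unfolding assms(2) by auto
    then obtain oss where "(d, oss) \<in> set cs" by auto
    then show ?thesis using assms(3) by (auto simp: list_all_iff)
  qed (use assms(1) in auto)
qed

lemmas table_simps = lb_tab_def lb_tab_DD_def lb_tab_DB_def lb_tab_BB_def lb_tab_SB_def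
  inc_tab_def inc_tab_DD_def inc_tab_DB_def inc_tab_BD_def inc_tab_BS_def inc_tab_BB_def mx_def
lemmas check_simps = table_simps lb_check_def inc_check_def inc_cells_def enough_def fb_def

section \<open>The certificates\<close>

text \<open>Each option list answers all comparisons for one table entry. The order within a list
  matters, since \<open>chain\<close> reads it from left to right and closes the rows one after
  another.\<close>

definition lb_cert_DD :: "(int \<times> opt list list) list" where
  "lb_cert_DD = [(0,[[S 0 1,S 2 1]]), (1,[[S 0 1,S 1 1]]), (2,[[S 0 1,B 1 1,B 1 4,S 2 3], [S 0 2,S 1 1]]), (3,
    [[S 0 1,B 1 1,B 1 4,S 2 3,S 2 4,B 3 4,B 3 7,S 4 6], [S 0 2,S 1 2]]), (4,[[S 0 1,B 1 1,B 1 4,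
    S 2 3,S 2 4,B 3 4,B 3 7,S 4 6,S 4 7,B 5 7,B 5 10,S 6 9], [S 0 2,S 1 4,S 1 2,S 2 4], [S 0 3,
    S 1 2]]), (5,[[S 0 1,B 1 1,B 1 4,B 2 2,S 2 4,B 3 4,B 3 7,S 4 6,S 4 7,B 5 7,S 6 10,B 5 10,S
    6 9,B 7 10,A 7 12,S 8 12], [S 0 1,B 1 1,B 1 4,S 2 3,S 2 5,S 3 5,B 3 9,S 4 7], [S 0 3,S 1 2,
    S 1 4,S 2 4]]), (6,[[S 0 1,B 1 1,B 1 4,B 2 2,S 2 4,B 3 4,B 3 7,B 4 5,S 4 7,B 5 7,S 6 10,B 5
    10,S 6 9,B 7 10,A 7 12,S 8 12,A 9 15,S 8 13,B 9 13,S 10 15], [S 0 1,S 1 4,B 1 1,B 3 4,B 3 9,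
    S 5 8,B 5 12,S 6 10], [S 0 2,B 1 1,B 2 9,S 1 4,S 2 4,S 3 7], [S 0 4,S 1 2]]), (7,[[S 0 1,B
    1 1,B 1 4,B 2 3,S 2 4,B 3 4,B 3 7,B 4 6,S 4 7,B 5 7,B 5 10,B 6 9,B 6 12,S 7 11,A 7 12,B 8
    12,B 8 15,S 9 14,B 10 18,A 9 15,B 10 15,S 11 17], [S 0 1,B 1 1,S 1 4,B 2 3,S 2 6,B 4 6,S 4
    9,S 5 8,B 5 12,S 6 10,B 6 14,S 7 13], [B 1 4,S 0 2,S 1 2,B 2 3,S 2 7,S 3 7,S 3 9,S 4 9], [S
    0 2,B 1 2,B 1 8,S 2 6], [S 0 4,S 1 4]]), (8,[[S 0 1,B 1 1,B 1 4,B 2 2,S 2 4,B 3 4,B 3 7,B 4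
    6,S 4 7,B 5 7,B 5 10,B 6 9,S 6 10,B 7 10,A 7 12,B 8 12,A 9 15,B 8 15,S 9 14,B 10 15,S 11 18,
    B 10 18,S 11 17,B 12 18,A 12 20,S 13 20], [S 0 1,B 1 1,B 1 4,B 2 3,S 2 6,B 3 5,B 3 9,B 5 8,
    B 6 14,B 5 12,S 6 10,B 7 13,B 7 16,S 8 15], [S 0 1,B 1 1,B 1 4,S 2 3,S 2 7,B 4 6,S 4 10,S 5
    10,B 5 14,S 6 12], [S 0 3,S 2 3,S 2 9,S 4 9], [S 0 3,S 1 2,S 1 8,S 2 6], [S 0 4,S 1 4]]),
    (9,[[S 0 1,B 1 1,B 1 4,B 2 2,S 2 4,B 3 4,B 3 7,B 4 5,S 4 7,B 5 7,B 5 10,B 6 9,S 6 10,B 7 10,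
    S 8 13,A 7 12,B 8 12,B 9 13,A 9 15,B 10 15,B 10 18,S 11 17,S 11 18,B 12 18,S 13 21,A 12 20,
    S 13 20,B 14 21,A 14 23,S 15 23], [S 0 1,B 1 1,B 1 4,S 2 3,B 3 9,S 2 4,B 3 4,B 5 8,B 5 12,B
    6 14,S 6 10,S 8 13,B 9 19,S 8 16,B 9 16,S 10 18], [S 0 1,B 1 1,B 1 4,B 2 3,B 2 9,B 5 8,S 5
    12,S 6 14,S 6 12,S 7 14], [S 0 2,B 1 2,S 1 4,S 2 4,S 2 9,S 3 9,B 3 12,S 4 11], [S 0 2,S 1 2,
    S 2 9,S 1 5,S 2 4,S 3 9], [S 0 6,S 1 4]]), (10,[[S 0 1,B 1 1,B 1 4,B 2 3,S 2 4,B 3 4,B 3 7,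
    B 4 6,S 4 7,B 5 7,B 5 10,B 6 9,B 6 12,B 7 11,A 7 12,B 8 15,B 8 12,B 9 14,A 9 15,B 10 15,B
    11 20,B 10 18,B 11 17,S 12 19,A 12 20,B 13 20,B 13 23,S 14 22,A 14 23,B 15 26,B 15 23,S 16
    25], [S 0 1,B 1 1,S 1 4,B 3 4,B 3 9,B 5 7,B 5 12,B 7 11,S 7 14,B 9 14,B 9 19,S 11 18,B 11
    22,S 12 21], [B 1 4,S 0 2,S 1 2,B 2 3,S 2 6,B 3 5,B 3 9,S 4 7,S 4 11,B 5 10,B 5 14,S 6 12,B
    6 16,S 7 14,S 7 16,S 8 16], [S 0 1,S 1 4,B 1 1,S 2 3,B 2 9,S 4 7,S 4 12,S 5 12,B 5 16,S 6
    14], [S 0 3,B 1 1,B 1 8,B 3 7,B 3 14,S 4 11]]), (11,[[S 0 1,B 1 1,B 1 4,S 2 3,S 2 4,B 3 4,B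
    3 7,B 4 6,S 4 7,B 5 7,B 5 10,B 6 9,S 6 10,B 7 10,A 7 12,B 8 12,B 8 15,B 9 14,A 9 15,B 10 15,
    B 10 18,B 11 17,S 11 18,B 12 18,A 12 20,B 13 20,B 13 23,S 14 22,A 14 23,B 15 23,S 16 26,B
    15 26,S 16 25,B 17 26,B 17 29,S 18 28], [S 0 1,B 1 1,S 1 4,B 3 4,S 3 7,B 5 7,B 5 12,B 7 10,
    S 7 14,B 9 14,S 9 17,B 11 17,B 11 22,S 13 21,A 13 24,S 14 24], [S 0 1,B 1 1,B 1 4,S 2 3,S 2
    6,B 4 6,S 4 11,S 6 10,B 6 16,S 8 15,S 8 17,S 9 17,B 9 21,S 10 19], [B 1 4,S 0 2,S 1 2,B 2 3,
    B 2 9,S 3 5,S 3 9,S 4 9,S 4 13,S 5 14,B 5 10,S 6 14,S 6 16,S 7 16], [S 0 2,S 1 4,S 1 2,B 2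
    3,S 2 9,S 3 7,S 3 12,S 4 11,S 4 14,S 5 14], [S 0 2,B 1 2,B 1 8,S 2 6,B 2 13,S 3 12]]), (12,
    [[S 0 1,B 1 1,B 1 4,S 2 3,S 2 4,B 3 4,B 3 7,S 4 6,S 4 7,B 5 7,B 5 10,B 6 9,S 6 10,B 7 10,S
    8 13,A 7 12,B 8 12,B 9 13,A 9 15,B 10 15,B 10 18,B 11 17,S 11 18,B 12 18,A 12 20,B 13 20,A
    14 23,S 13 21,B 14 21,B 15 23,S 16 26,B 15 26,S 16 25,B 17 26,B 17 29,S 18 28,B 19 32,S 18
    29,B 19 29,S 20 31], [S 0 1,B 1 1,B 1 4,B 2 3,S 2 6,B 4 6,S 4 9,B 6 9,B 6 14,B 8 12,B 7 16,
    B 9 14,B 9 19,S 11 18,B 11 22,S 13 21,A 13 24,B 14 24,B 14 27,S 15 26], [S 0 2,B 2 2,S 2 6,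
    S 4 6,S 4 11,B 7 11,S 7 16,B 9 16,B 9 21,S 11 20,A 11 23,S 12 22], [S 0 2,S 1 4,S 1 2,S 2 4,
    B 2 9,S 4 7,S 4 13,B 6 12,S 7 18,S 6 16,S 7 16,S 8 18], [S 0 1,S 1 4,B 1 1,S 2 9,S 2 4,S 4
    9,S 4 14,B 5 18,S 5 14,S 6 16], [S 0 2,B 1 8,B 1 2,S 2 6,S 2 10,B 3 15,B 3 9,S 4 13]]), (13,
    [[S 0 1,B 1 1,B 1 4,B 2 2,S 2 4,B 3 4,B 3 7,S 4 6,S 4 7,B 5 7,S 6 10,B 5 10,S 6 9,B 7 10,S
    8 13,A 7 12,B 8 12,B 9 13,A 9 15,B 10 15,B 10 18,B 11 16,B 11 20,B 12 18,B 13 23,A 12 20,B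
    13 20,B 14 21,S 15 24,A 14 23,B 15 23,B 16 24,S 16 26,B 17 26,S 18 29,B 17 29,S 18 28,B 19
    29,S 20 32,B 19 32,S 20 31,B 21 32,A 21 34,S 22 34], [S 0 1,B 1 1,S 1 4,B 3 4,S 4 9,S 2 6,B
    4 6,B 6 9,B 6 14,S 7 11,B 7 16,B 10 15,B 11 22,S 10 19,B 11 17,S 13 21,A 13 24,S 15 24,S 15
    27,S 16 26,B 16 30,S 17 29], [S 0 1,B 1 1,S 1 4,B 3 4,B 3 9,S 5 8,B 5 12,B 7 11,S 7 16,B 8
    15,S 8 18,B 10 18,B 10 23,S 12 22,B 12 26,S 13 25], [S 0 1,B 1 1,B 1 4,S 2 3,B 2 9,B 5 8,B
    5 16,B 8 15,S 8 19,S 9 19,B 9 23,S 10 21], [S 0 3,S 2 3,B 2 9,B 5 8,S 5 16,S 7 16,B 7 21,S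
    8 18], [S 1 5,S 0 2,S 1 2,B 2 5,S 2 9,S 3 9,B 3 14,S 4 13,S 4 16,S 5 16]]), (14,[[S 0 1,B 1
    1,B 1 4,B 2 2,S 2 4,B 3 4,B 3 7,B 4 5,S 4 7,B 5 7,S 6 10,B 5 10,S 6 9,B 7 10,A 7 12,S 8 12,
    A 9 15,S 8 13,B 9 13,B 10 15,S 10 16,B 11 16,B 11 20,B 13 19,S 13 21,B 14 21,A 14 23,B 15
    23,S 15 24,B 16 24,S 16 26,B 17 26,S 18 29,S 17 27,B 18 27,B 19 29,S 20 32,B 19 32,S 20 31,
    B 21 32,A 21 34,S 22 34,S 22 35,B 23 35,B 23 38,S 24 37], [S 0 1,B 1 1,S 1 4,B 3 4,S 3 7,B
    5 7,S 4 9,B 6 9,S 6 12,B 8 12,B 9 19,S 8 16,B 10 15,B 12 18,A 13 24,S 12 22,B 13 20,S 15 24,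
    S 15 27,S 17 27,A 18 32,S 17 30,S 18 29,S 19 32], [S 0 1,S 1 4,B 1 1,B 3 4,B 3 9,B 5 7,S 4
    11,S 7 11,S 7 16,B 9 14,B 9 21,S 11 18,A 11 23,S 13 23,S 14 27,B 12 26,S 14 25,S 15 27], [S
    0 1,S 1 4,B 1 1,B 3 4,S 3 9,S 5 8,B 5 16,S 8 13,S 8 19,B 10 18,S 11 24,S 10 23,S 11 22,S 12
    24], [S 0 1,B 1 1,S 1 5,S 3 5,B 3 12,S 5 10,S 5 16,S 7 14,S 6 18,S 8 18,S 8 21,S 9 21], [S
    0 2,S 1 2,S 2 7,S 1 4,S 2 4,B 3 7,B 3 14,S 4 11,S 4 16,S 5 16,S 5 18,S 6 18]]), (15,[
    [S 0 1,B 1 1,S 1 3,B 3 3,B 3 9,B 7 8,S 7 14,B 11 14,B 11 22,S 15 21,S 15 27,B 19 27,B 19 35,S 23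
    34,B 23 39,S 25 38], [S 0 1,
    B 1 1,S 1 4,B 2 3,S 2 6,B 4 6,S 4 9,B 6 9,B 6 14,S 8 13,S 8 18,B 10 18,B 10 23,S 12 22,B 12
    26,S 14 25,S 14 27,S 15 27,B 15 31,S 16 30], [S 0 1,B 1 1,B 1 4,B 2 3,B 2 9,S 5 8,B 5 14,B
    7 13,S 7 18,S 9 17,S 9 21,B 11 20,B 11 26,S 12 24,B 12 28,S 13 26], [S 0 3,S 2 3,S 2 9,S 4
    9,S 4 14,S 6 14,S 6 20,S 8 20]])]"

definition lb_cert_DB :: "(int \<times> opt list list) list" where
  "lb_cert_DB = [((-14),[
    [S 1 0,A 1 1,S 3 1,A 3 3,A 9 3,A 8 7,A 16 7,A 15 11,A 22 11,A 21 15,S 27 15,A 27 19,S 33 19,S 33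
    22,S 36 22,S 36 24,S 38 24,S 38 25,S 40 25], [S 1 0,A 1 1,A 4 1,B 3 3,S 6 2,A 6 4,S 9 4,A 9 6,A 14 6,S 13 8,S 18 8,A 17 11,B 23 11,A
    23 13,S 26 13,A 26 15,S 29 15,S 28 16,S 30 17,S 30 16,S 32 17], [S 2 0,S 2 1,S 4 1,A 4 3,S
    9 3,A 9 6,A 14 5,S 13 8,S 20 8,S 20 11,A 26 11,S 25 13,S 27 13,S 27 14,S 29 14]]), ((-13),
    [[S 1 0,A 2 2,A 1 1,A 4 1,S 4 2,A 5 4,A 4 3,A 7 3,S 7 4,A 7 5,A 10 5,A 10 7,A 9 6,A 12 6,B
    12 7,A 13 9,A 12 8,A 15 8,A 16 9,A 16 11,A 15 10,S 16 10,A 20 11,A 19 13,A 23 13,A 21 14,A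
    23 15,B 23 14,A 24 16,S 24 15,S 26 16,A 26 17,A 29 17,A 29 19,A 27 18,S 29 18,A 30 20,A 32
    19,A 34 20,A 33 22,S 35 22,A 35 23,A 36 24,S 36 23,S 38 24,S 38 25,S 39 25], [S 1 0,A 2 2,A
    1 1,A 4 1,S 6 2,A 6 4,S 9 4,A 9 6,A 14 6,A 13 9,A 19 9,A 18 12,A 24 12,A 23 15,S 27 15,S 27
    17,S 30 17,S 30 19,S 32 19,S 32 20,S 34 20], [S 1 0,B 1 2,S 4 1,A 4 3,A 9 3,A 7 5,A 12 5,S
    11 7,S 16 7,A 15 10,S 21 10,S 21 13,S 26 13,S 26 15,S 28 15,S 28 16,S 30 16], [S 2 0,A 1 1,
    S 4 1,A 4 3,A 9 3,A 8 5,A 14 5,A 11 7,S 18 7,S 17 9,A 23 9,S 22 11,S 24 11,S 24 12,S 26 12],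
     [S 2 0,S 2 1,S 4 1,S 4 2,A 9 2,S 7 4,S 13 4,A 12 6,S 18 6,S 18 8,S 21 8,S 21 9,S 23 9]]),
    ((-12),[[S 1 0,A 2 2,A 1 1,A 4 1,S 4 2,A 4 3,A 7 3,A 7 5,A 6 4,S 7 4,A 10 5,A 9 6,A 12 6,A
    10 7,A 12 8,A 13 7,A 15 8,A 13 9,A 15 10,A 16 9,A 18 10,A 18 12,A 16 11,A 20 11,A 20 13,B
    20 12,A 23 13,A 21 14,A 23 15,A 24 14,A 24 16,S 24 15,S 26 16,A 26 17,A 27 18,S 27 17,S 29
    18,A 29 19,A 30 20,A 32 19,S 32 20,A 33 22,A 32 21,S 33 21,S 35 22,S 35 23,S 36 23], [S 1 0,
    A 1 1,S 4 1,A 4 3,A 9 3,A 8 6,A 14 6,A 13 9,A 19 9,A 18 12,A 24 12,A 23 15,S 27 15,A 26 17,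
    S 30 17,S 30 19,S 32 19], [S 1 0,A 1 1,S 4 1,A 4 3,A 9 3,S 8 5,A 12 5,S 11 7,S 16 7,A 16 9,
    S 19 9,S 18 11,B 23 11,S 23 13,S 26 13,S 25 14,S 27 14], [S 1 0,A 1 1,S 4 1,A 3 2,S 6 2,A 5
    3,A 9 3,A 8 5,A 14 5,A 12 6,A 16 6,A 15 8,S 20 8,S 19 9,S 21 10,S 21 9,S 23 10], [S 2 0,S 2
    1,S 5 1,S 5 3,A 12 3,A 10 5,A 18 5,S 16 7,S 18 8,S 19 7,S 21 8], [S 2 0,A 2 1,S 4 1,S 4 2,S
    9 2,S 9 3,A 14 3,S 13 4,S 16 4,S 16 5,S 18 5]]), ((-11),[[S 1 0,A 1 1,A 4 1,A 4 3,A 3 2,S 4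
    2,A 7 3,A 6 4,S 7 4,A 7 5,A 10 5,A 10 7,A 9 6,A 12 6,A 13 7,A 13 9,A 12 8,S 13 8,A 16 9,A
    15 10,A 18 10,A 17 11,A 18 12,S 18 11,A 21 12,A 20 13,A 21 14,S 21 13,B 23 14,A 24 16,A 23
    15,S 24 15,S 26 16,A 27 18,A 26 17,A 29 17,S 29 18,A 30 20,A 29 19,S 30 19,S 32 20,S 32 21,
    S 33 21], [S 1 0,A 1 1,S 4 1,A 4 3,A 9 3,A 8 6,A 14 6,A 13 9,A 19 9,A 18 12,A 24 12,A 23 15,
    S 27 15,S 27 17,S 29 17], [S 1 0,A 1 1,S 4 1,S 4 2,S 6 2,A 6 4,S 9 4,A 9 6,A 16 6,A 15 8,S
    18 8,A 18 10,S 21 10,S 22 12,S 20 11,S 22 11,S 24 12], [S 2 0,A 1 1,S 4 1,A 3 2,A 9 2,A 8 5,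
    S 13 4,A 13 7,S 18 7,S 16 8,S 20 8,S 19 9,S 21 9], [S 3 0,S 3 2,S 6 2,A 6 4,S 14 4,A 12 6,S
    17 6,S 16 7,S 19 7]]), ((-10),[[S 1 0,A 2 2,A 1 1,A 4 1,S 4 2,A 5 4,A 4 3,A 7 3,S 7 4,A 8 6,
    A 7 5,A 10 5,A 12 6,A 11 8,S 13 8,A 13 9,B 15 9,A 15 10,A 16 11,S 16 10,A 20 11,A 19 13,A
    23 13,A 22 15,A 26 15,A 25 17,S 27 17,A 27 18,A 28 19,S 28 18,S 30 19,S 30 20,S 31 20], [S
    1 0,A 2 2,A 1 1,A 4 1,S 6 2,A 5 4,S 9 4,A 9 6,A 14 6,A 13 9,A 19 9,A 17 11,S 20 11,A 20 13,
    S 23 13,S 22 14,S 24 15,S 24 14,S 26 15], [S 2 0,S 2 1,S 4 1,A 4 3,S 7 3,A 7 5,A 14 5,S 13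
    8,S 18 8,S 18 10,S 21 10,S 20 11,S 22 11], [S 2 0,A 1 1,S 4 1,A 4 3,S 9 3,A 8 5,A 16 5,S 14
    7,S 16 8,S 17 7,S 19 8], [S 2 0,S 2 1,S 4 1,S 4 2,S 7 2,S 7 3,A 14 3,S 11 4,S 14 4,S 14 5,S
    16 5], [S 2 0,A 2 1,A 8 1,S 6 2,A 13 2,S 12 3,S 14 3]]), ((-9),[[S 1 0,A 2 2,A 1 1,A 4 1,S
    4 2,A 5 4,A 4 3,A 7 3,S 7 4,A 8 6,A 7 5,A 10 5,A 12 6,A 10 7,B 12 7,A 13 9,A 12 8,A 15 8,A
    16 9,A 16 11,A 15 10,S 16 10,A 20 11,A 19 13,A 23 13,A 22 15,S 24 15,A 25 17,A 24 16,S 26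
    16,S 27 18,S 27 17,S 28 18], [S 1 0,A 2 2,A 1 1,A 4 1,S 6 2,A 6 4,S 9 4,A 9 6,S 12 6,A 12 8,
    S 16 8,S 16 10,S 19 10,S 19 12,S 22 12,S 21 13,S 23 13], [S 1 0,A 1 1,S 4 1,A 4 3,A 9 3,S 7
    4,S 11 4,A 11 7,S 16 7,S 17 9,S 15 8,S 18 8,S 19 9], [S 2 0,A 1 1,A 4 1,A 3 2,A 9 2,S 7 4,S
    13 4,S 12 5,S 14 6,S 14 5,S 16 6], [S 2 0,A 1 1,A 8 1,A 7 3,S 12 3,S 11 4,S 14 4]]), ((-8),
    [[S 1 0,A 2 2,A 1 1,A 4 1,S 4 2,A 5 4,A 4 3,A 7 3,S 7 4,A 7 5,A 10 5,A 10 7,A 9 6,A 12 6,A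
    13 7,A 13 9,A 12 8,S 13 8,B 15 9,A 16 11,A 15 10,S 16 10,A 20 11,A 19 13,S 21 13,A 21 14,S
    22 14,A 22 15,S 24 15,S 24 16,S 25 16], [S 1 0,A 1 1,A 4 1,A 3 2,S 6 2,A 6 4,S 9 4,A 9 6,A
    12 5,A 11 7,S 14 7,A 14 9,S 17 9,S 16 10,S 18 10,S 18 11,S 20 11], [S 1 0,A 1 1,S 4 1,S 4 2,
    S 6 2,A 5 3,A 9 3,A 8 5,A 14 5,S 12 6,S 14 6,S 14 7,S 16 7], [S 2 0,A 1 1,S 4 1,A 3 2,S 9 2,
    S 9 4,S 13 4,S 12 5,S 14 5], [S 2 0,S 2 1,S 5 1,S 4 2,S 10 2,S 9 3,S 12 3], [S 5 0,S 4 1,S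
    10 1]]), ((-7),[[S 1 0,A 1 1,A 4 1,A 3 3,S 5 3,A 5 4,S 7 4,A 8 6,A 7 5,A 10 5,A 12 6,A 11 8,
    A 15 8,A 14 10,A 18 10,A 17 12,S 19 12,A 19 13,S 21 13,S 22 15,A 20 14,S 22 14,S 23 15], [S
    1 0,A 1 1,S 4 1,A 4 3,S 7 3,A 5 4,S 9 4,A 9 6,A 14 6,A 12 8,S 16 8,S 16 10,S 18 10], [S 2 0,
    S 2 1,S 4 1,A 3 2,S 6 2,A 6 4,S 11 4,S 10 5,S 12 6,S 12 5,S 14 6], [S 2 0,A 1 1,S 5 1,A 5 3,
    S 10 3,S 9 4,S 12 4], [S 3 0,S 2 1,S 8 1,S 6 2,S 10 2], [S 5 0,S 4 1,S 9 1]]), ((-6),[[S 1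
    0,A 2 2,A 1 1,A 4 1,S 4 2,A 5 4,A 4 3,A 7 3,S 7 4,A 8 6,A 7 5,A 10 5,A 12 6,A 11 8,A 15 8,A
    14 10,S 16 10,A 17 12,A 16 11,S 17 11,S 19 12,S 19 13,S 20 13], [S 1 0,A 1 1,S 4 1,A 4 3,S
    7 3,A 6 4,S 9 4,A 9 6,S 12 6,S 11 7,S 13 8,S 13 7,S 15 8], [S 2 0,A 1 1,S 4 1,A 4 3,S 9 3,S
    10 5,S 7 4,S 10 4,S 12 5], [S 2 0,A 2 1,A 8 1,S 6 2,S 9 2], [S 4 0,S 4 1,S 8 1]]), ((-5),
    [[S 1 0,A 2 2,A 1 1,A 4 1,S 4 2,A 5 4,A 4 3,A 7 3,S 7 4,A 8 6,A 7 5,A 10 5,A 12 6,A 11 8,S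
    13 8,A 13 9,A 14 10,S 14 9,S 16 10,S 16 11,S 17 11], [S 1 0,A 1 1,S 4 1,A 3 2,S 6 2,A 6 4,S
    9 4,S 8 5,S 10 6,S 10 5,S 12 6], [S 2 0,A 1 1,S 4 1,S 4 2,S 7 2,S 7 3,S 9 3]]), ((-4),[[S 1
    0,A 2 2,A 1 1,A 4 1,S 4 2,A 5 4,A 4 3,A 7 3,S 7 4,A 8 6,A 7 5,A 10 5,S 10 6,A 11 8,A 10 7,S
    11 7,S 13 8,S 13 9,S 14 9], [S 2 0,A 1 1,S 4 1,S 3 2,S 6 2,S 6 4,S 8 4,S 8 5,S 10 5], [S 2
    0,S 2 1,S 4 1,S 4 2,S 7 2]]), ((-3),[[S 1 0,A 2 2,A 1 1,A 4 1,S 4 2,A 5 4,A 4 3,A 7 3,S 7 4,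
    A 8 6,A 7 5,S 8 5,S 10 6,S 10 7,S 11 7], [S 2 0,A 1 1,S 4 1,S 3 2,S 5 2,S 5 3,S 7 3], [S 2
    0,S 2 1,S 5 1]]), ((-2),[[S 1 0,A 2 2,A 1 1,A 4 1,S 4 2,A 5 4,A 4 3,S 5 3,S 7 4,S 7 5,S 8
    5], [S 2 0,S 2 1,S 4 1]]), ((-1),[[S 1 0,A 2 2,A 1 1,S 2 1,S 4 2,S 4 3,S 5 3], [S 2 0,S 1 1,
    S 3 1]]), (0,[[S 1 0,S 1 1,S 2 1]]), (1,[[S 0 1,S 1 1]]), (2,[[S 0 1,B 1 1,S 1 2,B 2 2,S 2
    4,S 3 4], [S 0 2,S 1 1]]), (3,[[S 0 1,B 1 1,B 1 4,B 2 2,S 3 5,S 2 4,B 3 4,B 4 5,S 4 7,S 5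
    7], [S 0 2,S 1 2]]), (4,[[S 0 1,B 1 1,B 1 4,B 2 2,S 2 4,B 3 4,B 3 7,B 4 5,S 5 8,S 4 7,B 5 7,
    B 6 8,S 6 10,S 7 10], [S 0 1,B 1 1,B 1 4,S 2 3,S 2 5,S 3 5], [S 0 3,S 1 2]]), (5,[[S 0 1,B
    1 1,B 1 4,B 2 2,S 2 4,B 3 4,B 3 7,B 4 5,S 4 7,B 5 7,B 5 10,B 6 8,S 7 11,S 6 10,B 7 10,B 8
    11,S 8 13,S 9 13], [S 0 1,S 1 4,B 1 1,B 3 4,S 4 9,S 2 6,S 4 6,S 5 8], [S 0 2,S 1 2,S 1 5,S
    2 4]]), (6,[[S 0 1,B 1 1,B 1 4,B 2 2,S 2 4,B 3 4,B 3 7,B 4 5,S 4 7,B 5 7,B 6 12,S 5 8,B 6 8,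
    B 8 11,S 8 13,B 9 13,S 9 14,B 10 14,S 10 16,S 11 16], [S 0 1,B 1 1,S 1 4,B 2 3,S 2 6,B 4 6,
    S 4 9,S 5 8,S 5 10,S 6 10], [S 0 2,B 1 1,S 2 7,S 1 4,S 2 4,S 3 7], [S 0 4,S 1 2]]), (7,[[S
    0 1,B 1 1,B 1 4,B 2 2,S 2 4,B 3 4,B 3 7,B 4 5,S 4 7,B 5 7,B 6 12,S 5 8,B 6 8,B 8 11,B 8 15,
    B 10 14,S 11 17,S 10 16,B 11 16,B 12 17,S 12 19,S 13 19], [S 0 1,A 2 1,S 1 4,B 3 4,S 3 7,B
    4 6,S 4 9,B 6 9,S 7 14,B 5 12,S 7 11,S 8 13], [S 0 2,B 1 1,B 2 9,S 1 4,B 3 4,S 4 7,S 4 11,S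
    5 10], [S 0 2,B 1 8,B 1 2,S 2 6], [S 0 4,S 1 4]]), (8,[[S 0 1,B 1 1,B 1 4,B 3 3,S 4 7,S 3 5,
    B 4 5,S 5 8,B 5 7,B 6 8,B 6 12,B 8 11,B 8 15,B 10 14,B 10 18,B 12 17,S 13 21,S 12 19,B 13
    19,B 14 20,S 14 22,S 15 22], [S 0 1,B 1 1,S 1 4,A 4 4,B 3 9,B 5 7,S 4 9,B 6 9,S 6 12,B 8 12,
    S 8 16,S 10 16], [S 0 1,B 1 1,B 1 4,B 2 3,S 2 6,B 4 6,S 4 11,S 5 10,S 5 12,S 6 12], [S 0 2,
    B 1 1,S 1 5,B 3 5,S 3 10,S 4 9], [S 0 3,S 1 2,B 1 7,S 2 6], [S 0 4,S 1 4]]), (9,[[S 0 1,B 1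
    1,B 1 4,B 2 2,B 3 7,S 2 4,B 3 4,B 4 5,S 4 7,B 5 7,B 5 10,B 6 9,S 6 10,B 7 10,S 8 13,A 7 12,
    B 8 12,B 9 13,A 9 15,B 10 15,B 10 18,B 11 16,B 11 20,B 13 19,S 14 22,S 13 21,B 14 21,B 15
    22,S 15 24,S 16 24], [S 0 1,B 1 1,B 1 4,B 2 3,S 2 6,A 5 6,S 4 9,B 6 9,S 6 12,B 7 11,S 7 14,
    B 9 14,S 10 19,S 8 16,S 10 16,S 11 18], [S 0 1,B 1 1,S 1 4,B 2 3,B 3 9,S 2 6,B 3 5,B 5 8,B
    5 14,S 6 14,S 6 12,S 7 14], [S 0 1,B 1 1,B 1 4,B 2 3,S 2 9,S 4 9,S 4 12,S 5 12], [S 0 3,S 1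
    2,S 2 9,B 1 8,S 2 4,S 3 9]]), (10,[[S 0 1,B 1 1,B 1 4,B 2 2,S 2 4,B 3 4,B 3 7,B 4 5,B 5 10,
    S 4 7,B 5 7,B 6 8,S 6 10,B 7 10,S 8 13,A 7 12,B 8 12,B 9 13,A 9 15,B 10 15,B 10 18,B 11 16,
    B 11 20,B 13 19,B 13 23,B 15 22,S 16 25,S 15 24,B 16 24,B 17 25,S 17 27,S 18 27], [S 0 1,B
    1 1,S 2 6,S 1 2,B 2 2,B 4 6,S 4 9,A 7 9,B 6 14,B 8 12,S 8 16,S 10 16,S 10 19,S 12 19,S 12
    21,S 13 21], [S 0 1,B 1 1,S 1 4,B 3 4,S 3 7,B 4 6,S 4 11,B 7 11,S 8 18,B 6 16,S 8 15,S 9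
    17], [S 0 1,B 1 1,B 1 4,B 2 3,B 2 9,S 4 7,S 4 13,S 5 12,S 5 14,S 6 14], [S 0 2,B 1 1,B 1 8,
    B 3 7,S 3 12,S 4 11], [S 0 3,S 1 3,S 1 10,S 2 6]]), (11,[[S 0 1,B 1 1,B 1 4,B 2 2,S 2 4,B 3
    4,B 3 7,B 4 5,S 4 7,B 5 7,B 5 10,B 6 8,B 6 12,B 8 11,B 8 15,B 9 13,S 10 16,A 9 15,B 10 15,B
    11 16,B 11 20,B 13 19,B 13 23,B 15 22,B 15 26,B 17 25,S 17 27,B 18 27,S 18 29,S 19 30,B 19
    28,S 20 30], [S 0 1,B 1 1,S 2 6,S 1 2,B 2 2,B 4 5,S 4 9,B 6 9,S 6 12,B 7 10,B 7 16,B 10 15,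
    S 10 19,S 12 19,S 12 22,S 14 22,S 14 24,S 15 24], [S 0 2,B 2 2,S 2 6,S 4 6,S 4 11,B 7 11,B
    7 16,B 9 14,S 10 20,S 9 19,S 10 18,S 11 20], [S 0 1,B 1 1,S 1 4,B 3 4,B 2 9,B 5 8,S 5 14,S
    7 14,S 7 18,S 8 16], [B 1 4,S 0 2,S 1 2,B 2 3,S 2 9,S 3 7,S 4 14,B 3 14,S 4 11,S 5 14], [S
    0 2,B 1 2,B 2 13,B 1 8,S 2 6,S 3 12], [S 0 4,S 1 4,S 1 9,S 2 9]]), (12,[[S 0 1,B 1 1,B 1 4,
    B 2 3,S 2 4,B 3 4,B 3 7,B 4 6,S 4 7,B 5 7,B 5 10,B 6 9,S 6 10,B 7 10,A 7 12,B 8 12,B 8 15,B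
    9 13,B 10 18,A 9 15,B 10 15,S 11 18,B 11 17,B 12 18,A 12 20,B 13 20,A 14 23,S 13 21,B 14 21,
    B 15 23,S 15 24,B 16 24,S 16 26,B 17 26,S 18 29,S 17 27,B 18 27,B 19 29,S 19 30,B 20 30,S
    20 32,S 21 32], [S 0 1,B 1 1,S 1 4,B 3 4,B 3 9,B 6 8,B 6 14,B 9 13,B 9 19,B 12 18,B 12 24,B
    15 23,S 15 27,S 17 27], [S 0 1,B 1 1,S 1 4,B 3 4,B 3 9,S 5 8,B 5 12,B 7 11,S 8 18,S 7 16,B
    8 15,B 10 18,S 10 21,S 11 20,S 11 22,S 12 22], [B 1 4,S 0 2,S 1 2,B 2 3,B 2 9,B 5 8,S 4 13,
    B 7 13,S 7 18,S 8 16,S 8 19,S 9 19], [S 0 3,S 2 3,B 2 9,B 4 6,S 4 13,B 6 12,S 6 18,S 7 16],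
    [S 0 3,S 2 3,S 2 9,S 4 9,S 4 16,S 5 14], [B 1 7,S 0 3,S 1 2,B 2 13,S 2 6,S 3 12], [S 0 5,S
    1 5,S 1 9,S 2 9]]), (13,[[S 0 1,B 1 1,B 1 4,B 2 2,S 2 4,B 3 4,B 3 7,B 4 6,S 4 7,B 5 7,B 5
    10,B 6 9,S 6 10,B 7 10,S 8 13,A 7 12,B 8 12,B 9 13,A 9 15,B 10 15,B 10 18,B 11 16,B 11 20,A
    12 20,B 12 18,B 13 20,A 14 23,S 13 21,B 14 21,B 15 23,S 15 24,B 16 24,S 16 26,B 17 26,S 18
    29,S 17 27,B 18 27,B 19 29,S 19 30,B 20 30,S 20 32,B 21 32,S 21 33,B 22 33,S 22 35,S 23 35],
     [S 0 1,B 1 1,S 1 4,B 3 4,B 3 9,B 6 8,B 6 14,B 9 13,B 9 19,A 13 18,B 12 24,B 15 23,B 14 27,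
    B 17 26,S 17 30,S 19 30], [S 0 1,S 1 4,B 1 1,B 3 4,B 3 9,B 5 7,B 5 12,S 7 11,B 6 16,B 9 14,
    S 9 19,S 11 18,A 11 23,S 13 23,S 13 26,S 14 25], [S 0 1,B 1 1,S 1 4,S 2 4,S 3 7,S 2 6,B 3 5,
    S 4 7,S 4 9,B 5 14,B 5 8,B 6 12,B 6 16,B 8 15,S 8 20,S 9 19,S 9 21,S 10 21], [S 0 1,S 1 5,B
    1 1,S 3 5,B 2 9,B 5 8,S 5 16,S 7 16,S 7 19,S 8 18], [S 0 2,S 1 4,B 1 2,S 2 9,S 2 4,S 3 9,B
    3 14,S 4 13,S 4 16,S 5 16], [S 0 3,S 1 2,S 1 8,S 2 4,B 2 13,S 3 9,S 3 14,S 4 13]]), (14,[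
    [S 0 1,B 1 4,A 2 1,S 2 3,S 2 4,B 3 4,S 3 5,B 4 5,S 4 7,B 5 7,B 5 10,B 6 9,S 6 10,B 7 10,A 7 12,B 8
    12,S 8 13,B 9 13,A 9 15,B 10 15,S 10 16,B 11 16,B 11 20,B 13 19,S 13 21,B 14 21,A 14 23,B 15 23,S 15
    24,B 16 24,S 16 26,B 17 26,S 17 27,B 18 27,S 18 29,B 19 29,S 19 30,B 20 30,B 20 34,B 22 33,S 22 35,B
    23 35,S 23 36,B 24 36,S 24 38,S 25 38], [S
    0 1,B 1 1,B 1 4,B 2 2,S 2 6,B 4 6,S 4 9,B 6 9,B 6 14,B 9 13,B 9 19,B 12 18,B 12 24,B 15 23,
    S 15 27,S 17 27,S 17 30,S 19 30,S 19 32,S 20 32], [S 0 1,B 1 1,S 1 4,B 2 2,S 2 6,S 4 6,S 4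
    9,B 6 9,B 6 16,B 10 15,B 10 23,S 13 21,S 13 26,S 15 26,S 15 29,S 16 28], [S 0 2,S 1 4,S 1 2,
    B 3 4,S 4 11,B 3 9,B 5 8,B 7 11,S 7 18,S 9 17,B 9 23,S 11 22,S 11 24,S 12 24], [B 1 4,S 0 2,
    S 1 2,S 2 7,B 2 3,S 4 7,S 4 13,B 6 12,S 6 18,S 8 18,S 8 21,S 9 21], [S 0 2,S 1 5,S 1 2,S 2
    3,S 2 7,S 4 7,S 5 18,S 4 14,S 5 12,S 7 18]]), (15,[[S 0 1,S 1 4,A 2 1,B 3 4,B 3 9,B 5 7,B 5
    12,B 7 10,B 7 16,B 9 13,B 9 19,B 12 18,B 12 24,A 16 23,B 14 27,B 17 26,B 17 32,B 20 31,S 20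
    34,S 21 35,S 21 33,S 22 35], [S 0 1,B 1 4,B 1 1,B 2 3,B 3 9,S 2 4,B 3 4,S 5 8,B 5 12,B 7 11,
    S 7 14,S 8 18,B 9 14,B 11 17,A 11 23,B 13 23,S 13 26,B 15 26,S 15 29,S 16 28,S 16 31,S 17
    30], [S 0 2,S 1 2,B 1 4,S 2 3,B 2 9,B 5 7,B 5 14,S 8 13,S 8 20,S 11 20,B 11 26,S 13 25,S 13
    27,S 14 27], [S 0 2,S 1 2,B 2 9,S 1 3,S 2 3,B 4 6,B 5 18,S 4 13,S 5 10,S 9 17,S 10 24,S 9
    23,S 10 21,S 11 24], [S 0 2,S 1 2,S 1 4,S 2 4,S 2 7,B 3 14,S 3 5,B 5 10,S 5 16,B 7 16,S 7
    21,S 8 20]]), (16,[[S 0 1,B 1 1,S 2 6,B 1 4,S 2 3,B 4 6,S 4 7,B 5 7,B 5 12,S 7 11,B 7 16,B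
    10 15,B 10 23,B 13 20,S 13 26,S 16 26,S 16 31,S 18 31,S 18 33,S 19 33], [S 0 1,S 1 4,B 1 1,
    S 2 4,B 3 9,S 2 6,S 3 5,S 4 11,S 5 8,B 6 16,B 6 9,S 8 15,S 8 18,B 10 18,B 9 23,S 12 22,B 12
    26,B 13 25,S 13 28,S 14 27,S 14 29,S 15 29], [S 0 2,B 1 1,B 2 9,S 1 4,S 2 4,S 4 7,S 4 13,S
    6 12,S 6 16,S 8 16,S 8 20,S 10 19,B 11 27,B 9 25,S 11 24,S 12 26], [S 0 2,S 1 4,S 1 2,S 2 9,
    S 2 4,S 4 7,S 4 13,B 6 12,S 6 20,S 8 20,S 8 23,S 9 23]])]"

definition lb_cert_BB :: "(int \<times> opt list list) list" where
  "lb_cert_BB = [(0,[[S 1 0,S 1 1,S 2 1]]), (1,[[S 1 0,S 2 2,S 1 1,S 2 1,S 3 2,S 3 3,S 4 3,S 4 5,S 5 5,S 5 6,S 6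
    6,S 6 7,S 7 7], [S 1 0,S 1 1,S 2 1]]), (2,[[S 1 0,S 1 1,S 2 1,B 2 4,S 3 3,A 3 4,S 4 4,S 5 6,
    S 4 5,B 5 5,B 6 6,S 6 8,S 7 8], [S 1 0,S 1 2,S 2 2]]), (3,[[S 1 0,S 1 1,S 2 1,B 2 4,S 3 3,A
    3 4,S 4 4,B 4 7,B 6 6,S 6 8,B 7 8,S 7 9,B 8 9,S 8 11,S 9 11], [S 1 0,S 1 2,S 2 2,S 3 5,S 2
    4,S 3 3,S 4 5], [S 1 0,S 1 2,S 2 2]]), (4,[[S 1 0,S 1 1,S 2 1,B 2 4,S 3 3,A 3 4,S 4 4,B 4 7,
    B 6 6,B 6 10,B 8 9,S 8 11,B 9 11,S 9 12,B 10 12,S 10 14,S 11 14], [S 1 0,S 1 2,S 2 2,B 2 4,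
    S 3 3,B 3 7,S 5 6,S 5 8,S 6 8], [S 1 0,S 1 2,S 2 2,S 2 5,S 3 5]]), (5,[[S 1 0,S 1 1,S 2 1,B
    2 4,S 3 3,A 3 4,S 4 4,B 4 7,B 6 6,B 6 10,B 8 9,B 8 13,B 10 12,S 10 14,B 11 14,S 11 15,B 12
    15,S 12 17,S 13 17], [S 1 0,S 1 1,S 2 1,S 2 4,B 4 4,S 4 7,S 5 6,B 5 10,S 7 9,S 7 12,S 8 11],
     [S 1 0,S 1 1,S 2 1,S 2 5,S 4 5,S 4 9,S 5 8]]), (6,[[S 1 0,S 1 1,S 2 1,B 2 4,S 3 3,A 3 4,S
    4 4,B 4 7,B 6 6,B 6 10,B 8 9,B 8 13,B 10 12,B 10 16,B 12 15,S 13 18,S 12 17,B 13 17,S 14 20,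
    B 14 18,S 15 20], [S 1 0,S 1 1,S 2 1,S 2 4,S 4 4,S 4 7,B 5 5,S 5 8,S 6 8,S 6 10,B 8 10,S 9
    14,S 7 12,S 9 12,S 10 14], [S 1 0,S 2 4,S 1 2,S 2 2,B 4 4,B 3 9,S 5 10,S 5 8,S 6 10], [S 1
    0,S 1 2,B 2 2,B 2 8,S 3 7], [S 1 0,S 1 4,S 2 4]]), (7,[[S 1 0,S 1 1,S 2 1,B 2 4,S 3 3,A 3 4,
    S 4 4,B 4 7,B 6 6,B 6 10,B 8 9,B 8 13,B 10 12,B 10 16,B 12 15,B 12 19,B 14 18,S 14 20,B 15
    20,S 15 21,B 16 21,S 16 23,S 17 23], [S 1 0,S 1 1,S 2 1,S 2 4,S 4 4,S 4 7,S 6 7,B 6 12,B 8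
    10,A 8 14,B 10 13,S 10 16,S 11 18,S 11 15,S 12 17], [S 1 0,S 2 4,S 1 2,S 2 2,B 3 3,B 3 7,S
    4 5,S 4 9,B 5 8,B 5 12,S 6 10,S 6 12,S 7 12], [S 1 0,S 1 2,S 2 3,S 2 2,S 3 3,S 4 10,B 3 9,S
    4 7,S 5 10]]), (8,[[S 1 0,S 1 1,S 2 1,B 2 4,S 3 3,A 3 4,B 4 4,B 4 7,B 6 6,S 6 8,B 7 8,A 7
    10,B 8 10,B 8 13,B 9 11,S 10 14,A 9 13,B 10 13,B 11 14,A 11 16,S 12 17,B 12 16,B 13 17,B 13
    21,B 15 20,S 16 23,A 15 22,B 16 22,B 17 23,S 17 25,S 18 25], [S 1 0,S 1 1,S 2 1,S 2 4,B 4 4,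
    B 5 10,S 4 7,B 5 5,S 7 9,S 7 12,B 9 12,S 9 15,B 11 15,S 12 20,A 10 17,S 12 17,S 13 20], [S
    1 0,S 1 1,S 2 1,S 2 4,B 4 4,B 3 9,S 6 8,B 6 12,B 7 11,B 7 14,S 8 13,S 8 15,S 9 15], [S 1 0,
    S 1 2,S 2 5,S 2 2,S 3 9,B 3 5,S 4 9]]), (9,[[S 1 0,S 1 1,S 2 1,B 2 4,S 3 3,A 3 4,S 4 4,B 4
    7,B 6 6,B 6 10,B 8 9,A 9 13,S 8 11,B 9 11,B 10 13,S 10 14,B 11 14,A 11 16,B 12 16,S 12 17,B
    13 21,B 13 17,B 15 20,B 15 24,B 17 23,S 18 26,S 17 25,B 18 25,B 19 26,S 19 28,S 20 28], [S
    1 0,S 1 1,S 2 1,S 2 4,S 4 4,B 5 10,S 4 7,B 5 5,B 7 8,B 7 14,B 10 13,B 9 17,B 11 15,S 12 20,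
    S 11 18,B 13 18,S 14 20,S 14 23,S 15 23], [S 1 0,S 1 2,S 2 1,S 2 4,S 4 4,S 4 9,B 7 9,S 8 16,
    S 7 14,B 9 14,S 10 19,S 10 16,S 11 18], [S 1 0,B 2 4,S 1 2,S 2 2,B 3 3,B 3 9,B 5 8,B 5 14,S
    6 12,S 6 14,S 7 14], [S 1 2,S 1 0,B 2 8,S 2 2,B 4 7,S 4 12,S 5 12]]), (10,[[S 1 0,S 1 1,S 2
    1,B 2 4,S 3 3,A 3 4,S 4 4,B 4 7,B 6 6,B 6 10,B 8 9,B 8 13,B 10 12,B 10 16,B 11 14,S 12 17,A
    11 16,B 12 16,B 13 21,B 13 17,B 15 20,B 15 24,B 17 23,B 17 27,B 19 26,S 19 28,B 20 28,S 21
    31,S 20 29,B 21 29,S 22 31], [S 1 0,S 1 1,S 2 1,S 2 4,S 4 4,S 4 7,B 6 6,B 6 12,B 9 11,B 9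
    17,B 12 16,B 12 22,B 15 21,S 15 24,S 16 23,S 16 26,S 17 25], [S 1 0,S 2 4,S 1 2,S 2 2,B 4 4,
    B 5 10,S 4 7,S 5 6,B 7 9,B 7 14,B 8 13,S 8 16,B 10 16,S 10 19,S 11 18,S 11 20,S 12 20], [S
    1 0,S 1 2,S 2 2,S 2 4,B 4 4,S 4 9,B 5 8,B 6 16,B 5 12,B 7 11,S 8 15,S 8 17,S 9 17], [S 1 0,
    S 1 2,B 2 2,S 2 4,S 3 7,B 3 3,S 4 7,S 5 14,B 4 14,S 5 12,S 6 14], [S 1 0,S 1 2,B 2 8,B 2 2,
    B 3 7,B 3 13,S 4 12], [S 1 0,S 1 4,S 2 4,S 2 9,S 3 9]]), (11,[[S 1 0,S 1 1,S 2 1,B 2 4,S 3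
    2,A 3 4,S 4 4,B 4 7,B 6 6,B 6 10,B 8 9,B 8 13,B 10 12,B 10 16,B 12 15,B 12 19,B 13 17,B 13
    21,B 15 20,B 15 24,B 17 23,B 17 27,B 19 26,B 19 30,B 21 29,S 21 31,B 22 31,S 23 34,S 22 32,
    B 23 32,S 24 34], [S 1 0,S 1 2,S 2 1,B 3 7,S 2 4,S 3 3,B 6 6,B 6 12,B 9 11,B 9 17,A 13 16,B
    12 22,B 15 21,S 16 26,S 14 23,S 16 23,S 18 26,S 18 29,S 19 28], [S 1 0,S 1 1,S 2 1,S 2 4,B
    4 4,B 5 10,S 4 7,B 5 5,S 7 9,S 7 14,B 9 12,S 10 19,S 8 16,B 10 16,B 12 19,B 12 22,S 13 21,S
    13 24,S 14 23], [S 1 0,S 1 3,S 3 3,S 3 9,B 5 8,S 5 14,S 6 16,S 7 14,S 8 16], [S 1 0,S 1 3,S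
    2 2,B 3 14,S 2 8,S 3 7,S 4 12], [S 1 0,S 2 9,S 1 5,S 2 5,S 3 9]]), (12,[[S 1 0,S 1 2,S 2 1,
    B 3 7,S 2 4,S 3 3,B 6 6,B 6 12,B 9 11,B 9 17,B 12 16,B 12 22,S 15 21,A 15 25,B 16 28,B 17
    24,B 19 27,S 20 32,S 19 30,S 20 29,S 21 31], [S 1 0,S 1 1,S 2 1,S 2 4,S 4 4,S 4 7,B 5 5,S 5
    8,B 7 8,B 7 16,B 11 15,S 11 20,B 12 19,S 12 22,B 14 22,S 15 26,S 13 24,S 15 24,S 16 26], [S
    1 0,S 1 2,S 2 1,B 3 9,S 2 4,S 3 3,S 6 8,B 6 16,S 9 15,B 9 21,S 11 20,S 11 23,S 12 22], [S 1
    0,S 1 2,S 2 2,S 2 5,S 4 5,B 4 12,B 6 10,S 6 16,S 8 16,S 8 19,S 9 19], [S 1 0,S 1 1,S 2 5,S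
    2 1,S 4 5,B 4 14,B 6 12,S 6 18,S 7 16], [S 1 0,S 1 3,S 2 2,S 2 5,B 3 5,S 3 10,S 4 9,S 4 14,
    S 5 14]]), (13,[[S 1 0,S 1 1,S 2 1,S 2 4,B 4 4,S 4 5,B 5 5,B 5 10,B 7 8,B 7 14,B 10 13,B 11
    20,A 10 17,B 12 16,B 14 19,S 14 23,S 16 23,S 16 26,B 18 26,B 18 31,B 20 29,A 19 31,S 21 31,
    S 21 34,S 22 33], [S 1 0,S 1 1,S 2 1,S 2 4,S 4 4,S 4 7,S 6 7,B 6 12,B 9 11,B 9 19,B 13 18,S
    13 24,S 15 24,S 15 27,S 17 27,S 17 30,S 18 29], [S 1 0,S 1 2,S 2 1,B 3 9,S 2 3,S 3 3,S 6 8,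
    S 6 12,S 8 11,B 8 19,S 11 18,S 11 23,S 13 23,S 13 25,S 14 25], [S 1 0,B 2 4,S 1 2,S 2 2,S 3
    7,B 3 3,S 4 7,S 4 9,B 5 12,B 5 8,B 6 16,B 6 10,S 7 14,S 7 16,S 8 16,S 9 21,B 8 21,S 9 19,S
    10 21], [S 1 0,S 1 2,B 2 4,S 2 2,S 3 3,S 3 9,B 5 8,S 5 14,B 7 14,S 7 19,S 8 19]]), (14,[[S
    1 0,S 1 2,S 2 1,B 3 7,S 2 4,S 3 3,B 6 6,B 6 12,B 9 11,B 9 17,B 12 16,B 12 22,B 15 21,A 15
    25,S 17 25,A 17 28,B 19 27,B 19 33,B 22 32,S 21 34,S 23 34,S 23 36,S 24 36], [S 1 0,S 1 1,S
    2 1,S 2 4,B 4 4,S 4 7,B 5 5,B 5 10,S 7 9,B 7 16,B 11 15,B 9 19,B 13 18,S 13 24,B 15 24,S 15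
    27,B 17 27,S 18 32,A 16 29,S 18 29,S 19 32], [S 1 0,S 2 3,S 1 2,S 2 2,S 3 3,B 3 9,B 5 8,S 5
    10,S 6 10,B 6 16,B 8 13,B 9 21,B 8 19,S 9 17,S 10 19,B 10 23,S 11 22,S 11 24,S 12 24]]),
    (15,[[S 1 2,S 1 0,B 2 4,S 2 2,S 3 3,B 3 7,B 5 5,B 5 10,B 7 8,B 7 16,B 11 15,S 10 19,B 12 22,
    B 13 18,B 15 21,S 15 27,B 17 27,S 17 30,S 18 29,S 18 32,S 20 32,S 20 34,S 21 34], [S 1 0,S
    1 2,S 2 1,S 2 4,S 3 3,B 3 7,S 5 6,B 5 12,B 8 10,S 8 16,S 10 16,S 10 21,B 13 21,S 13 26,B 15
    26,S 15 29,S 16 28,S 16 30,S 17 30]])]"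

definition lb_cert_SB :: "(int \<times> opt list list) list" where
  "lb_cert_SB = [((-13),[
    [S 0 1,S 2 1,S 2 2,S 3 2,S 3 3,A 7 3,S 6 6,S 10 6,A 10 9,S 15 9,A 15 12,A 22 12,A 21 16,A 28 16,A 27
    20,B 33 20,S 33 23,S 36 23,S 36 25,S 38 25,S 38 26,S 40 26], [S 0 1,S 1 1,S 1 2,S 4 2,B 4 5,S 7 4,S 6 5,A 10 5,S 9 7,A 16 7,A 14 9,A 19 9,A 18 13,S
    24 13,A 24 15,S 27 15,A 27 17,B 29 16,S 29 18,S 32 18,S 32 19,S 33 19], [S 0 1,S 2 1,S 2 2,
    S 4 2,A 4 4,S 9 4,A 9 7,S 14 7,A 14 9,A 21 9,S 20 12,A 26 12,S 25 14,S 27 14,S 27 15,S 29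
    15]]), ((-12),[[S 0 1,S 1 2,S 2 1,S 4 2,A 5 5,A 4 4,S 7 4,A 8 7,A 10 5,A 14 7,A 13 10,A 18
    10,A 16 12,A 22 12,A 21 15,B 25 15,A 24 17,A 26 18,S 26 16,S 29 18,A 29 20,S 32 20,S 31 21,
    S 33 21,S 33 22,S 35 22], [S 0 1,S 1 2,S 2 1,S 4 2,S 4 4,S 7 4,S 7 6,A 12 6,S 11 8,S 16 8,A
    16 12,S 22 12,A 22 14,S 25 14,A 25 16,S 28 16,S 27 17,S 29 18,S 29 17,S 31 18]]), ((-11),
    [[S 0 1,S 1 2,S 2 1,S 4 2,S 4 4,S 7 4,A 6 6,A 12 6,A 11 9,A 17 9,A 16 12,S 20 12,A 20 15,A
    26 15,A 24 17,B 28 17,S 29 20,A 27 19,S 30 19,S 31 21,S 31 20,S 33 21], [S 0 1,S 1 2,S 2 1,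
    S 4 2,S 4 4,S 7 4,A 5 5,A 10 5,S 9 7,S 14 7,A 13 10,S 19 10,A 19 12,A 24 12,S 21 13,S 24 15,
    S 24 13,S 26 15,S 26 16,S 28 16]]), ((-10),[[S 0 1,S 1 2,S 2 1,S 4 2,S 4 4,S 7 4,A 6 6,A 12
    6,A 11 9,A 17 9,A 16 12,A 22 12,A 21 15,B 25 15,A 24 17,S 27 17,S 28 19,S 26 18,S 29 18,S
    30 19], [S 0 1,S 1 2,S 2 1,A 4 2,S 3 3,A 7 3,S 6 5,A 10 5,S 9 7,S 14 7,A 14 9,S 16 8,A 16
    10,S 19 10,A 19 12,A 22 12,S 21 13,S 24 13,S 23 14,S 25 14]]), ((-9),[
    [S 0 1,S 1 1,S 1 2,S 2 2,S 2 3,B 4 3,S 4 6,A 10 6,A 9 10,S 14 10,A 14 13,A 21 13,A 20 17,A 27 17,A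
    26 21,S 31 21,A 31 24,S 35 24,A 35 27,S 37 27,S 37 28,S 38 28], [S 0 1,S 1 2,S 2 1,S
    4 2,S 4 4,S 7 4,A 6 6,A 12 6,A 11 9,A 17 9,A 16 12,A 22 12,A 21 15,S 24 15,S 23 16,S 25 16,
    S 25 17,S 27 17], [S 0 1,S 2 1,S 2 2,S 4 2,S 3 3,A 7 3,S 6 5,A 10 5,S 8 6,A 12 6,A 11 7,A
    14 7,A 13 8,S 16 8,A 16 10,S 19 10,S 18 11,S 20 11,S 20 12,S 22 12]]), ((-8),[[S 0 1,S 1 1,
    S 1 2,S 4 2,S 4 4,S 7 4,A 5 5,A 10 5,A 8 7,A 14 7,A 13 10,S 16 10,A 15 11,S 18 11,A 18 13,S
    21 13,S 20 14,S 23 14,S 23 15,S 24 15], [S 0 1,S 1 2,S 2 1,S 4 2,S 4 4,S 9 4,A 9 7,S 12 6,A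
    12 9,S 17 9,S 16 10,S 18 11,S 18 10,S 20 11]]), ((-7),[[S 0 1,S 1 1,S 1 2,A 4 2,A 4 4,S 3 3,
    A 5 3,A 7 4,A 6 6,A 10 6,A 8 7,B 10 7,A 11 9,A 10 8,A 13 8,A 14 9,A 14 11,A 13 10,A 16 10,A
    16 12,B 16 11,S 17 12,A 17 13,A 21 13,A 20 15,B 22 15,A 23 17,A 22 16,S 23 16,S 25 17,S 25
    18,S 26 18], [S 0 1,S 1 1,S 1 2,S 4 2,A 5 5,A 4 4,S 7 4,A 8 7,A 10 5,S 12 7,A 12 9,A 17 9,A
    15 11,B 17 10,S 17 12,S 20 12,S 20 13,S 21 13], [S 0 1,S 1 2,S 2 1,S 4 2,S 3 3,A 9 3,S 8 6,
    S 12 6,A 9 7,S 13 8,A 14 7,S 15 8,S 15 9,S 17 9]]), ((-6),[[S 0 1,S 2 1,S 2 2,A 4 2,A 3 3,A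
    7 3,S 5 4,S 9 4,S 10 6,A 8 5,A 12 5,S 12 6,S 12 7,S 14 7]]), ((-5),[[S 0 1,S 1 2,S 2 1,S 4
    2,S 4 4,S 7 4,A 5 5,S 8 6,S 8 5,A 12 6,S 12 9,A 10 8,S 13 8,S 14 9,S 14 10,S 16 10], [S 0 1,
    S 2 1,S 2 2,S 4 2,A 4 4,S 9 4,S 8 5,S 10 5,S 10 6,S 12 6]]), ((-4),[[S 0 1,S 1 2,S 2 1,S 4
    2,A 4 4,S 7 4,S 6 5,A 10 5,S 9 7,S 11 7,S 11 8,S 13 8], [S 0 1,S 1 2,S 2 1,S 5 2,S 5 4,S 9
    4,S 8 5,S 10 5]]), ((-3),[[S 0 1,S 1 1,S 1 2,A 4 2,S 4 4,S 3 3,B 4 3,A 7 4,A 6 6,A 10 6,A 9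
    8,S 11 8,A 11 9,S 12 9,A 12 10,S 14 10,S 14 11,S 15 11], [S 0 1,S 2 1,S 2 2,S 4 2,S 3 3,A 7
    3,S 6 5,S 8 5,S 8 6,S 10 6], [S 0 1,S 2 1,S 2 2,S 5 2,S 5 3,S 7 3]]), ((-2),[[S 0 1,S 2 1,S
    2 2,S 4 2,S 3 3,S 5 3,S 5 4,S 7 4], [S 0 1,S 2 1,S 2 2,S 5 2]]), ((-1),[[S 0 1,S 1 1,S 1 2,
    A 4 2,S 4 4,S 3 3,B 4 3,S 5 4,A 6 6,A 5 5,S 6 5,S 8 6,S 8 7,S 9 7], [S 0 1,S 2 1,S 2 2,S 4
    2], [S 0 1,S 3 1]]), (0,[[S 0 1,S 2 1]]), (1,[[S 0 1,S 1 1]]), (2,[[S 0 1,S 1 1,S 2 3,S 1 2,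
    S 2 2,S 3 3,S 3 5,S 4 5,S 4 6,S 5 6,S 5 7,S 6 7], [S 0 2,S 1 1]]), (3,[[S 0 1,S 1 1,B 1 4,S
    2 3,A 2 4,S 3 4,S 4 6,S 3 5,B 4 5,B 5 6,S 5 8,S 6 8], [S 0 2,S 1 2]]), (4,[[S 0 1,S 1 1,B 1
    4,S 2 3,A 2 4,S 3 4,B 3 7,B 5 6,S 5 8,B 6 8,S 6 9,B 7 9,S 7 11,S 8 11], [B 1 4,S 0 2,S 1 2,
    S 2 3,S 2 5,S 3 5], [S 0 3,S 1 2]]), (5,[[S 0 1,S 1 1,B 1 4,S 2 3,A 2 4,S 3 4,B 3 7,B 5 6,B
    5 10,B 7 9,S 7 11,B 8 11,S 8 12,B 9 12,S 9 14,S 10 14], [S 0 2,S 1 4,S 1 2,B 3 4,S 3 7,S 4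
    6,S 4 8,S 5 8], [S 0 2,S 1 2,S 1 5,S 2 5]]), (6,[[S 0 1,S 1 1,B 1 4,S 2 3,A 2 4,S 3 4,B 3 7,
    B 5 6,B 5 10,B 7 9,B 7 13,B 9 12,S 10 15,S 9 14,B 10 14,S 11 17,B 11 15,S 12 17], [S 0 1,S
    1 4,S 1 1,B 3 4,S 3 7,S 4 6,B 4 10,S 6 9,S 6 12,S 7 11], [S 0 1,S 1 5,S 1 1,S 3 5,S 3 9,S 4
    8]]), (7,[[S 0 1,S 1 1,B 1 4,S 2 3,A 2 4,S 3 4,B 3 7,B 5 6,B 5 10,B 7 9,B 7 13,B 9 12,B 9
    16,B 11 15,S 11 17,B 12 17,S 12 18,B 13 18,S 13 20,S 14 20], [S 0 2,S 1 1,B 2 7,B 1 4,S 2 3,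
    B 4 5,S 5 10,S 4 8,S 5 8,B 7 10,S 7 13,S 8 12,S 8 15,S 9 14], [S 0 2,S 1 4,S 1 2,B 3 4,S 3
    9,S 4 8,S 4 10,S 5 10], [S 0 2,B 1 8,B 1 2,S 2 7], [S 0 4,S 1 4]]), (8,[[S 0 1,S 1 1,B 1 4,
    S 2 3,A 2 4,S 3 4,B 3 7,B 5 6,B 5 10,B 7 9,B 7 13,B 9 12,B 9 16,B 11 15,B 11 19,B 13 18,S
    14 21,S 13 20,B 14 20,B 15 21,S 15 23,S 16 23], [S 0 1,S 1 4,S 1 1,S 3 4,S 3 7,S 5 7,B 5 12,
    B 7 10,S 7 13,B 9 13,S 10 17,S 8 15,S 10 15,S 11 17], [S 0 2,S 1 2,S 1 3,S 2 3,S 2 9,S 3 7,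
    S 3 10,S 4 10]]), (9,[[S 0 1,S 1 1,B 1 4,S 2 3,A 2 4,B 3 4,B 3 7,B 5 6,S 5 8,B 6 8,A 6 10,B
    7 10,A 8 13,S 7 11,B 8 11,B 9 13,S 9 14,B 10 14,A 10 16,B 11 16,B 12 21,S 11 17,B 12 17,B
    14 20,S 15 23,A 14 22,B 15 22,B 16 23,S 16 25,S 17 25], [S 0 1,S 1 1,S 1 4,B 3 4,B 4 10,S 3
    7,B 4 5,S 6 9,S 6 12,B 8 12,S 8 15,A 9 17,B 10 15,S 11 20,S 11 17,S 12 20], [S 0 1,S 1 4,S
    1 1,B 3 4,S 3 9,B 6 9,S 6 14,S 7 13,S 7 15,S 8 15], [B 1 4,S 0 2,S 1 2,B 2 3,B 2 9,S 3 5,S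
    4 12,B 3 12,S 4 10,S 5 12], [S 0 3,S 1 2,B 1 8,B 2 5,S 2 10,S 3 9]]), (10,[[S 0 1,S 1 1,B 1
    4,S 2 3,A 2 4,S 3 4,B 3 7,B 5 6,B 5 10,B 7 9,A 8 13,S 7 11,B 8 11,B 9 13,A 10 16,S 9 14,B
    10 14,B 11 16,S 11 17,B 12 17,B 12 21,B 14 20,B 14 24,B 16 23,S 17 26,S 16 25,B 17 25,B 18
    26,S 18 28,S 19 28], [S 0 1,S 1 1,S 1 4,S 3 4,B 4 10,S 3 7,B 4 5,B 6 8,S 6 12,S 8 12,S 8 15,
    B 10 15,S 10 18,B 12 18,S 13 23,S 12 21,S 13 20,S 14 23], [S 0 1,S 1 4,S 1 1,S 3 4,S 3 9,B
    6 9,S 5 12,S 7 16,B 8 12,S 9 18,S 9 16,S 10 18], [B 1 4,S 0 2,S 1 2,B 2 3,B 2 9,B 4 8,B 4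
    14,S 5 12,S 5 14,S 6 14], [B 1 8,S 0 2,S 1 2,B 3 7,S 3 12,S 4 12]]), (11,[[S 0 1,S 1 1,B 1
    4,S 2 3,A 2 4,S 3 4,B 3 7,B 5 6,B 5 10,B 7 9,B 7 13,B 9 12,S 9 14,B 10 14,A 10 16,B 11 16,S
    11 17,B 12 17,B 12 21,B 14 20,B 14 24,B 16 23,B 16 27,B 18 26,S 18 28,B 19 28,S 19 29,B 20
    29,S 20 31,S 21 31], [S 0 1,S 1 4,S 1 1,S 3 4,B 2 7,B 5 6,B 5 12,B 8 11,B 8 17,B 11 16,B 11
    22,B 14 21,S 13 23,S 15 26,S 15 23,S 16 25], [S 0 2,S 1 4,S 1 2,B 2 7,B 3 4,B 4 10,S 4 6,B
    6 9,S 7 16,S 6 14,B 7 13,B 9 16,S 9 19,S 10 18,S 10 20,S 11 20], [S 1 4,S 0 2,S 1 2,B 3 4,B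
    2 9,B 4 8,B 4 12,B 6 11,S 6 16,S 7 15,S 7 17,S 8 17], [S 0 2,B 1 2,S 1 4,S 2 9,B 2 3,S 3 7,
    A 4 14,B 3 14,S 4 12,S 5 14], [S 0 2,B 1 2,B 1 8,B 2 7,B 2 13,S 3 12], [S 0 4,S 1 4,S 1 9,S
    2 9]]), (12,[[S 0 1,S 1 1,B 1 4,S 2 2,A 2 4,S 3 4,B 3 7,B 5 6,B 5 10,B 7 9,B 7 13,B 9 12,B
    9 16,B 11 15,S 11 17,B 12 17,B 12 21,B 14 20,B 14 24,B 16 23,B 16 27,B 18 26,B 18 30,B 20
    29,S 20 31,B 21 31,S 22 34,S 21 32,B 22 32,S 23 34], [S 0 2,S 1 1,B 2 7,B 1 4,S 2 3,B 5 6,B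
    5 12,B 8 11,B 8 17,A 12 16,B 11 22,B 13 19,S 13 23,S 15 23,S 15 26,S 17 26,S 17 29,S 18 28],
     [S 0 1,S 1 4,S 1 1,B 3 4,S 3 7,B 4 5,B 4 10,S 6 9,B 6 16,B 7 10,S 7 16,B 9 16,B 9 21,B 11
    19,B 10 22,S 12 23,S 12 21,S 13 23], [S 0 2,S 1 2,B 2 9,B 1 4,B 2 3,B 4 8,B 4 12,B 5 14,B 5
    10,B 7 13,B 7 19,S 8 17,S 8 19,S 9 19], [S 0 3,S 2 3,S 2 9,B 3 12,B 3 6,S 5 10,S 5 16,S 7
    16], [S 0 3,S 2 3,S 2 10,B 4 10,S 4 15,S 5 14]]), (13,[[S 0 1,S 1 1,B 1 4,S 2 2,A 2 4,S 3 4,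
    B 3 7,B 5 6,B 5 10,B 7 9,B 7 13,B 9 12,B 9 16,B 11 15,B 11 19,B 13 18,A 13 21,B 14 20,B 14
    24,B 16 23,B 16 27,B 18 26,B 18 30,B 20 29,B 20 33,B 22 32,S 22 34,S 23 36,B 23 34,B 24 35,
    S 24 37,S 25 37], [S 0 2,S 1 1,B 2 7,B 1 4,S 2 3,B 5 6,B 5 12,B 8 11,B 8 17,B 11 16,B 11 22,
    S 14 21,B 13 25,B 16 24,A 16 28,B 18 27,S 18 30,S 19 29,S 19 31,S 20 31], [S 0 1,S 1 4,S 1
    1,S 3 4,S 4 8,B 2 7,B 4 5,B 6 8,B 6 16,B 10 15,B 9 21,B 11 24,B 11 19,B 13 22,S 14 27,S 13
    25,S 14 24,S 15 26], [S 0 1,S 1 1,S 2 5,S 1 4,S 2 3,S 3 9,S 3 5,S 5 8,B 5 14,B 7 13,S 8 19,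
    S 6 16,S 8 15,B 9 18,S 10 22,S 9 21,S 10 20,S 11 22], [S 0 3,S 1 2,S 1 8,B 2 5,B 2 13,S 3 9,
    S 3 15,S 4 14]]), (14,[
    [S 0 1,S 1 1,B 1 4,S 2 3,A 2 4,S 3 4,B 3 7,B 5 6,S 5 8,B 6 8,A 6 10,B 7 10,S 7 11,B 8 11,A 8 13,B 9
    13,S 9 14,B 10 14,A 10 16,B 11 16,S 11 17,B 12 17,B 12 21,B 14 20,A 14 22,B 15 22,A 15 24,B 16 24,S
    16 25,B 17 25,A 17 27,B 18 27,S 18 28,B 19 28,A 19 30,B 20 30,S 20 31,B 21 31,B 21 35,B 23 34,S 23
    36,B 24 36,S 24 37,B 25 37,S 25 39,S 26 39], [S 0 1,S 1 4,S 1 1,B 3 4,S 3 7,B 4 5,B 4 10,B 6 8,S 6 12,B 8 11,B 8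
    17,B 11 16,B 11 22,A 15 21,B 15 28,A 14 25,S 15 23,B 17 26,B 17 31,B 19 29,S 19 32,S 20 33,
    S 20 31,S 21 33], [S 0 1,S 1 4,S 1 1,S 3 4,S 3 7,S 5 7,B 5 14,B 9 13,B 9 21,B 12 18,S 12 24,
    S 14 24,S 14 27,S 16 27,S 16 29,S 17 29], [S 0 1,S 1 1,S 1 4,S 3 4,S 3 9,B 6 9,S 6 16,B 9
    16,B 9 23,B 11 19,S 11 24,S 12 25,S 12 23,S 13 25], [B 1 4,S 0 2,S 1 2,S 2 7,B 2 3,S 3 7,S
    3 9,B 4 8,B 4 12,B 5 10,S 6 16,B 5 16,S 6 14,S 7 16,B 7 21,S 8 21,S 8 19,S 9 21], [S 0 2,S
    1 2,S 2 9,S 1 5,S 2 3,B 4 8,S 5 16,B 3 14,S 5 12,S 6 16,S 6 19,S 7 19]]), (15,[[S 0 1,S 1 1,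
    S 1 4,B 3 4,S 3 7,B 4 5,B 4 10,S 6 9,B 6 16,B 9 13,B 9 21,B 12 18,S 12 24,B 14 24,S 14 27,B
    16 27,S 17 32,B 15 30,S 17 29,S 18 32], [S 0 2,S 1 4,S 1 2,S 2 5,S 2 3,S 3 5,S 3 9,S 5 8,B
    5 14,S 7 13,S 7 16,B 9 16,B 9 21,S 11 20,S 11 24,B 12 23,S 12 26,S 13 25,S 13 27,S 14 27]]),
     (16,[[S 0 1,S 1 4,S 1 1,S 2 3,B 2 7,S 4 6,B 4 12,B 7 10,S 7 16,S 9 16,S 9 21,B 12 21,S 12
    26,B 14 26,S 14 29,S 15 28,S 15 30,S 16 30]]), (17,[[S 0 2,S 1 2,S 1 4,S 3 4,S 3 9,S 6 9,S
    6 14,B 9 13,B 9 23,B 13 22,S 13 27,S 15 26,S 15 31,S 17 31,S 17 33,S 18 33], [S 0 2,S 1 4,S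
    1 2,B 3 4,S 3 9,S 5 8,B 5 14,B 7 13,B 7 19,B 9 18,S 9 23,S 11 22,B 11 28,S 13 27,S 13 29,S
    14 29], [S 0 2,S 1 5,S 1 2,S 2 5,B 3 12,S 2 7,S 3 7,B 4 10,S 4 12,S 5 16,S 6 12,S 7 16,B 7
    19,B 8 17,S 8 19,S 9 19,S 9 23,S 10 23,S 10 26,S 11 26]])]"

definition inc_cert_DD :: "(int \<times> opt list list) list" where
  "inc_cert_DD = [(1,[[S 0 0,D 0 0,S 1 1,A 2 3,B 1 3,S 2 2,S 3 3]]), (2,[[S 0 0,D 0 0,S 1 1,A 2 3,B 1 3,S 2 2,S 3
    3,B 3 6,S 4 5,A 4 6,S 5 6], [S 0 0,S 0 1,S 1 1]]), (3,[[S 0 0,D 0 0,S 1 1,A 2 3,B 1 3,S 2 2,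
    S 3 3,B 3 6,S 4 5,B 5 9,A 4 6,S 5 6,B 6 7,A 6 9,S 7 9], [S 0 0,S 0 1,S 1 2,S 1 1,B 2 6,S 2
    2,S 3 4], [S 0 0,S 0 2,S 1 1]]), (4,[[S 0 0,D 0 0,S 1 1,A 2 3,B 1 3,S 2 2,S 3 3,B 3 6,S 4 5,
    B 5 9,A 4 6,S 5 6,B 6 7,S 7 10,A 6 9,S 7 9,B 8 10,A 8 12,S 9 12], [S 0 0,S 0 1,S 1 2,S 1 1,
    S 2 2,B 2 6,S 3 3,B 4 9,B 3 7,B 4 6,S 5 7], [S 0 0,S 1 4,S 0 2,S 1 2,S 2 4]]), (5,[[S 0 0,D
    0 0,S 1 1,A 2 3,B 1 3,S 2 2,S 3 3,B 3 6,S 4 5,B 5 9,A 4 6,S 5 6,B 6 7,S 7 10,A 6 9,S 7 9,B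
    8 10,S 9 13,A 8 12,S 9 12,B 10 13,A 10 15,S 11 15], [S 0 0,S 0 1,S 1 1,B 1 3,S 2 2,B 2 6,S
    4 5,B 5 11,S 4 7,S 5 7,S 6 10], [S 0 0,S 0 1,S 1 1,S 1 4,B 2 4,S 2 6,S 3 6]]), (6,[[S 0 0,D
    0 0,B 1 3,S 1 1,S 2 2,A 2 3,S 3 3,B 3 6,S 4 5,B 5 9,A 4 6,S 5 6,B 7 8,S 7 10,B 8 10,B 9 15,
    A 8 12,S 9 12,B 10 13,S 11 16,A 10 15,S 11 15,B 12 16,B 12 19,S 13 18], [S 0 0,S 0 1,B 1 3,
    S 1 1,B 2 6,S 2 2,S 4 5,B 4 9,S 6 8,S 6 11,B 7 11,B 7 14,S 8 13], [S 0 0,S 0 1,S 1 2,S 1 1,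
    B 2 6,S 2 2,S 3 8,B 3 5,B 4 7,S 4 9,S 5 9], [S 0 0,S 0 2,S 1 2,S 1 4,S 2 4,S 2 6,S 3 6], [S
    0 0,S 0 3,S 1 3]]), (7,[[S 0 0,D 0 0,B 1 3,S 1 1,S 2 2,A 2 3,S 3 3,B 3 6,S 4 4,A 4 6,S 5 6,
    B 5 9,B 7 8,B 7 12,B 9 11,S 9 13,B 10 13,A 10 15,S 11 15,B 12 20,B 11 18,B 12 16,B 14 19,A
    14 21,S 15 21], [S 0 0,B 1 3,S 0 1,S 1 1,S 2 2,B 2 4,S 3 3,B 4 9,B 3 7,B 4 6,B 5 8,B 5 11,S
    7 10,S 7 12,S 8 11,B 8 15,B 9 14,A 9 16,S 10 16], [S 0 0,S 0 1,B 1 3,S 1 1,B 2 6,S 2 2,B 3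
    5,S 3 8,B 4 7,S 4 9,B 5 9,S 5 11,S 6 11], [S 0 0,S 0 2,S 2 2,S 3 9,S 2 6,S 3 6,S 4 9], [S 0
    0,S 0 3,S 1 1,S 1 7,S 2 6]]), (8,[[S 0 0,D 0 0,S 1 1,A 2 3,D 1 1,S 2 2,S 3 3,A 4 6,B 3 6,S
    4 4,B 5 9,S 5 6,B 7 8,B 7 12,B 9 11,B 9 15,B 11 14,S 11 16,B 12 20,B 12 16,B 14 19,B 14 23,
    B 16 22,A 16 24,S 17 24], [S 0 0,B 1 3,S 0 1,S 1 1,B 2 6,S 2 2,S 4 5,B 4 9,B 5 8,S 6 11,B 5
    11,B 6 10,B 8 11,B 8 15,S 9 13,B 10 19,A 9 16,B 10 16,S 11 18], [S 0 0,S 0 1,S 1 2,S 1 1,B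
    2 6,S 2 2,B 3 5,S 3 8,B 5 8,B 5 11,S 6 13,B 6 10,B 7 13,S 7 14,S 8 14], [S 0 0,S 0 1,S 1 1,
    S 2 6,S 1 4,S 2 4,B 3 5,S 3 9,S 4 9,S 4 11,S 5 11], [S 0 0,S 0 2,S 1 2,S 1 4,S 2 9,B 2 4,S
    3 8], [S 0 0,S 0 5,S 1 3]]), (9,[[S 0 0,D 0 0,B 1 3,S 1 1,S 2 2,A 2 3,S 3 3,B 3 6,S 4 5,B 5
    9,A 4 6,S 5 6,B 7 8,B 7 12,B 8 10,S 9 13,A 8 12,B 9 12,B 10 13,A 10 15,B 11 15,S 11 16,B 12
    16,B 12 20,B 13 18,B 14 23,A 13 20,S 14 20,B 15 21,A 16 24,A 15 23,S 16 23,B 17 24,A 17 26,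
    S 18 26], [S 0 0,B 1 3,S 0 1,S 1 1,S 2 2,B 2 6,S 4 5,B 4 9,B 6 7,S 6 11,B 8 11,B 8 15,B 10
    14,B 10 19,B 11 18,B 11 20,B 12 19,B 12 22,S 13 21], [S 0 0,S 0 1,S 1 1,S 1 3,S 2 2,B 2 6,S
    3 8,S 3 4,S 5 7,S 5 11,B 6 10,S 7 14,S 6 13,S 7 12,B 8 18,S 8 14,S 9 17], [S 0 0,S 0 1,S 1
    1,S 2 6,S 1 3,S 2 2,S 3 6,S 3 8,B 4 7,S 4 11,S 5 11,S 5 13,S 6 13], [S 0 0,S 0 1,S 1 1,S 2
    6,S 1 4,S 2 4,B 3 6,S 3 11,S 4 11]]), (10,[[S 0 0,D 0 0,B 1 3,S 1 1,S 2 2,A 2 3,S 3 3,B 3 6,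
    S 4 4,A 4 6,S 5 6,B 5 9,B 7 8,B 7 12,B 9 11,S 9 13,B 10 13,A 10 15,B 11 15,B 12 20,B 11 18,
    B 12 16,B 14 19,A 14 21,B 15 21,A 15 23,S 16 23,B 16 26,B 17 24,B 18 29,A 17 26,B 18 26,A
    19 29,B 19 27,S 20 29], [S 0 0,S 0 1,B 1 3,S 1 1,B 2 6,S 2 2,S 4 5,B 4 9,B 6 7,S 6 11,B 8
    10,B 8 15,B 10 14,B 10 19,B 11 18,B 11 20,B 12 19,B 12 22,B 13 21,B 14 25,B 13 24,B 14 22,S
    15 24], [S 0 0,S 0 1,S 1 1,S 1 3,S 3 3,B 4 11,S 3 8,S 5 7,S 7 10,B 7 16,S 9 15,B 8 18,S 10
    17,S 10 19,S 11 19], [S 0 0,S 0 2,S 2 2,S 2 6,S 4 5,S 4 11,B 6 10,S 6 14,S 7 14,S 7 16,S 8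
    16], [S 0 0,S 0 1,S 1 1,S 1 4,B 2 4,S 3 11,S 2 6,S 3 6,S 4 11,S 4 13,S 5 13]]), (11,[[S 0 0,
    D 0 0,S 1 1,A 2 3,D 1 1,S 2 2,S 3 3,A 4 6,B 3 6,S 4 4,B 5 9,S 5 6,B 7 8,B 7 12,B 9 11,B 9
    15,B 11 14,S 11 16,B 12 20,B 12 16,B 14 19,B 14 23,B 16 22,A 16 24,B 17 24,B 18 29,A 17 26,
    B 18 26,B 19 27,A 19 29,S 20 30,S 20 29,B 21 30,A 21 32,S 22 32], [S 0 0,S 0 1,S 1 1,S 1 3,
    S 3 3,S 3 6,S 5 6,B 5 11,B 8 10,S 8 14,B 10 13,S 10 17,B 12 17,S 12 20,B 14 20,B 14 25,S 15
    24,S 15 25,B 16 25,B 16 28,S 17 27], [S 0 0,S 0 1,S 1 3,S 1 1,B 2 6,S 2 2,S 4 5,B 4 9,S 5 7,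
    B 5 11,B 6 10,S 6 13,B 7 12,B 7 16,B 9 15,B 8 18,S 10 17,S 10 19,S 11 19,B 11 23,S 12 22],
    [S 0 0,S 0 1,S 1 4,S 1 1,S 2 4,S 2 6,S 3 8,S 3 6,S 5 7,S 5 11,S 6 11,S 6 13,B 7 12,S 7 16,S
    8 16,B 8 20,S 9 18], [S 0 0,S 0 2,S 1 4,S 1 2,S 2 4,S 3 9,S 2 6,S 3 5,S 5 9,S 5 13,S 6 13,B
    6 18,S 7 16]]), (12,[[S 0 0,D 0 0,S 1 1,A 2 3,B 1 3,S 2 2,S 3 3,B 3 6,S 4 5,B 5 9,A 4 6,S 5
    6,B 6 7,S 7 10,A 6 9,S 7 9,B 8 10,A 8 12,B 9 12,S 9 13,B 10 13,S 11 16,A 10 15,B 11 15,B 12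
    16,A 13 20,B 12 20,B 13 18,B 14 23,B 14 20,B 15 21,A 15 23,B 16 23,A 16 24,B 17 24,B 18 29,
    A 17 26,B 18 26,S 19 28,B 20 32,A 19 29,B 20 29,S 21 31,B 22 35,A 21 32,B 22 32,S 23 34],
    [S 0 0,S 0 1,S 1 2,S 1 1,B 2 6,S 2 2,B 3 7,B 3 5,B 4 6,B 4 9,B 7 8,B 7 14,B 10 13,B 10 19,B
    11 17,B 11 20,B 12 19,B 12 21,B 13 20,B 13 24,B 14 22,B 14 25,B 15 26,B 15 24,B 16 25,B 16
    28,B 17 27,S 17 28,B 18 28,A 18 30,S 19 30], [S 0 0,S 0 1,S 1 1,S 1 3,S 2 2,S 3 8,S 2 4,S 3
    4,S 6 8,S 6 11,B 8 11,S 9 18,B 8 18,S 10 17,B 11 18,B 11 23,S 13 22,B 13 26,S 14 25], [S 0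
    0,S 0 1,S 1 1,S 1 3,S 3 3,S 3 8,S 5 7,S 5 11,S 7 10,B 7 18,B 9 15,S 10 21,B 8 20,S 10 19,S
    11 21], [S 0 0,S 0 2,S 2 2,S 2 6,B 3 5,B 3 11,S 4 13,B 5 9,S 6 11,B 6 18,S 7 16,S 7 18,S 8
    18]]), (13,[[S 0 0,D 0 0,S 1 1,A 2 3,B 1 3,S 2 2,S 3 3,B 3 6,S 4 5,B 5 9,A 4 6,S 5 6,B 6 7,
    S 7 10,A 6 9,S 7 9,B 8 10,A 8 12,S 9 12,S 9 13,B 10 13,S 11 16,A 10 15,B 11 15,B 12 16,B 12
    20,B 14 19,A 14 21,B 15 21,A 15 23,B 16 23,A 16 24,B 17 24,A 17 26,B 18 26,B 18 29,A 19 29,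
    B 19 27,B 20 29,B 20 32,A 21 32,S 21 31,B 22 32,S 23 35,B 22 35,S 23 34,B 24 35,B 24 38,S
    25 37], [S 0 0,S 0 1,S 1 1,S 1 3,S 3 3,S 3 6,S 5 6,B 5 11,B 8 10,S 8 14,S 10 14,S 10 17,S
    12 17,B 12 22,B 14 20,B 15 27,B 14 25,B 15 24,S 16 26,B 16 28,S 18 27,A 18 30,B 19 30,A 19
    32,S 20 32], [S 0 0,S 0 1,S 1 3,S 1 1,S 3 3,S 3 8,B 6 7,S 6 13,S 9 13,S 9 18,B 11 18,B 11
    23,B 13 21,S 14 26,S 13 24,S 14 23,S 15 25,A 15 28,S 16 28], [S 0 0,S 0 1,S 1 1,S 2 6,S 1 3,
    S 2 2,S 4 5,B 4 11,B 6 10,S 6 15,S 8 14,B 8 20,S 10 19,S 10 21,S 11 21,B 11 25,S 12 23], [S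
    0 0,S 0 1,S 1 4,S 1 1,S 3 4,B 3 11,S 5 9,S 5 13,S 6 13,S 6 15,B 7 14,S 7 18,S 8 18,S 8 20,S
    9 20]]), (14,[[S 0 0,S 0 1,S 1 1,B 1 3,S 2 2,B 2 6,S 4 5,B 4 9,S 5 7,B 5 11,S 7 10,S 6 13,S
    9 13,S 9 18,B 11 18,B 11 23,S 13 22,B 13 26,S 15 25,A 15 28,B 16 28,B 16 31,S 17 30], [S 0
    0,S 0 1,S 1 1,S 2 6,S 1 3,S 2 2,B 4 6,B 4 11,S 7 10,S 6 15,B 9 15,S 9 20,S 11 19,B 11 25,S
    13 24,S 13 26,S 14 26]])]"

text \<open>Diagonals without an entry carry an empty list, because \<open>inc_checkedI\<close>
  expects the indices to run through an interval.\<close>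

definition inc_cert_DB :: "(int \<times> opt list list) list" where
  "inc_cert_DB = [((-13),[[S 0 0,D 0 0,S 1 1,S 2 2,A 3 1,A 6 2,S 5 4,A 9 4,S 8 6,A 11 5,S 10 7,A 14 7,S 13 9,S 18
    9,A 17 12,S 23 12,A 23 14,S 26 14,S 25 15,B 28 15,S 28 17,S 31 17,S 31 18,S 32 18], [S 0 0,
    S 1 0,S 1 1,S 3 1,S 2 2,A 6 2,A 5 3,S 8 3,S 7 5,A 11 5,A 10 6,S 13 6,A 13 8,A 20 8,S 19 11,
    A 25 11,S 24 13,S 26 13,S 26 14,S 28 14]]), ((-12),[[S 1 1,S 0 0,S 1 0,S 3 1,S 3 3,S 6 3,S
    6 5,A 11 5,S 10 7,A 16 7,S 14 10,S 19 10,A 19 12,S 23 12,S 23 14,S 25 14,A 24 15,S 26 16,A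
    27 15,S 28 16,S 28 17,S 30 17]]), ((-11),[[S 0 0,S 1 1,D 0 0,S 3 1,S 3 3,S 6 3,S 6 5,A 11 5,
    A 10 8,A 14 7,A 13 10,A 19 10,A 18 13,S 21 13,A 21 15,A 27 15,A 26 18,S 29 18,S 30 20,S 28
    19,S 30 19,S 32 20]]), ((-10),[[S 0 0,S 1 1,D 0 0,S 3 1,S 3 3,S 6 3,S 6 5,A 11 5,A 10 8,A
    14 7,A 13 10,A 19 10,A 18 13,A 24 13,A 23 16,S 26 16,S 25 17,S 28 17,S 27 18,S 29 18]]),
    ((-9),[[S 0 0,S 1 1,D 0 0,S 3 1,S 3 3,S 6 3,S 6 5,A 11 5,A 10 8,S 14 8,A 13 10,S 17 10,A 17
    12,A 22 12,A 20 14,S 22 15,S 23 14,S 25 15,S 25 16,S 26 16]]), ((-8),[[S 0 0,D 0 0,S 1 1,S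
    2 2,A 3 1,A 6 2,S 5 4,A 9 4,A 7 6,A 11 5,A 10 8,S 14 8,A 14 10,A 19 10,S 19 13,A 17 12,S 20
    12,S 22 13,S 22 14,S 23 14]]), ((-7),[[S 0 0,D 0 0,S 1 1,S 2 2,A 3 1,A 6 2,S 5 4,A 9 4,A 7
    6,S 11 6,A 11 8,S 14 8,A 14 10,S 17 10,S 16 11,S 19 11,S 19 12,S 20 12], [S 0 0,S 1 0,S 2 2,
    S 1 1,A 3 1,A 6 2,A 5 3,S 8 3,S 7 5,A 11 5,A 10 6,S 13 6,A 13 7,S 14 8,S 14 7,S 16 8]]),
    ((-6),[]), ((-5),[[S 0 0,S 1 1,D 0 0,S 3 1,S 3 3,S 6 3,S 5 4,S 7 5,S 7 4,A 11 5,S 10 7,S 11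
    8,S 11 6,S 13 8,S 13 9,S 15 9]]), ((-4),[[S 0 0,S 1 1,D 0 0,S 3 1,S 4 3,S 2 2,S 4 2,S 5 4,S
    6 3,A 9 4,S 8 6,S 10 6,S 10 7,S 12 7]]), ((-3),[[S 0 0,S 1 0,S 2 2,S 1 1,S 3 1,A 6 2,S 5 4,
    S 7 4,S 7 5,S 9 5]]), ((-2),[[S 0 0,S 1 0,S 2 2,S 1 1,S 3 1,S 4 3,S 4 2,S 6 3]]), ((-1),[[S
    0 0,S 1 0,S 1 1,S 3 1]]), (0,[]), (1,[[S 0 0,D 0 0,S 1 1,D 1 1,S 2 2,D 2 2,S 3 3,S 4 5,S 3
    4,S 4 4,S 5 5,S 5 6,S 6 6]]), (2,[[S 0 0,D 0 0,S 1 1,D 1 1,A 2 3,S 2 2,S 3 3,S 4 5,S 3 4,S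
    4 4,S 5 5,S 5 7,S 6 7,S 6 8,S 7 8,S 7 9,S 8 9], [S 0 0,S 0 1,S 1 1]]), (3,[[S 0 0,D 0 0,B 1
    3,S 1 1,S 2 2,B 3 6,B 2 4,S 3 3,S 4 5,S 5 7,A 4 6,S 5 6,B 6 7,S 7 10,S 6 8,B 7 8,S 8 10],
    [S 0 0,S 0 1,S 1 1,S 2 4,B 1 3,S 2 2,S 3 4]]), (4,[[S 0 0,D 0 0,S 1 1,A 2 3,B 1 3,S 2 2,S 3
    3,B 3 6,S 4 5,B 4 7,S 5 6,B 5 9,B 7 8,S 7 10,B 8 10,S 9 13,S 8 11,B 9 11,S 10 13], [S 0 0,S
    0 1,S 1 1,B 1 3,S 2 2,B 2 6,S 4 5,S 4 7,S 5 7], [S 0 0,S 0 1,S 1 1,S 1 4,S 2 4]]), (5,[[S 0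
    0,D 0 0,S 1 1,A 2 3,B 1 3,S 2 2,S 3 3,B 3 6,S 4 5,B 5 9,A 4 6,S 5 6,B 7 8,B 7 12,B 9 11,S
    10 14,S 9 13,B 10 13,S 11 16,B 11 14,S 12 16], [S 0 0,S 0 1,S 1 1,S 2 4,S 1 3,S 2 2,S 3 4,S
    3 6,S 4 5,B 4 9,S 6 8,S 6 11,S 7 10], [S 0 0,S 0 1,S 1 1,S 1 4,S 3 4,S 3 8,S 4 7]]), (6,[[S
    0 0,D 0 0,S 1 1,A 2 3,B 1 3,S 2 2,S 3 3,B 3 6,S 4 5,B 5 9,A 4 6,S 5 6,B 7 8,B 7 12,B 9 11,B
    9 15,B 11 14,S 12 17,S 11 16,B 12 16,S 13 19,B 13 17,S 14 19], [S 0 0,S 0 1,S 1 1,S 1 3,S 3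
    3,S 3 6,S 4 7,S 4 5,S 5 7,B 5 11,S 7 10,S 8 13,S 7 12,S 8 11,S 9 13], [S 0 0,S 0 1,S 1 1,S
    1 3,S 2 2,S 2 4,S 3 4,S 4 9,S 3 8,S 4 7,S 5 9]]), (7,[[S 0 0,D 0 0,S 1 1,A 2 3,B 1 3,S 2 2,
    S 3 3,B 3 6,S 4 5,B 5 9,A 4 6,S 5 6,B 7 8,B 7 12,B 9 11,B 9 15,B 11 14,B 11 18,B 13 17,S 13
    19,B 14 19,S 14 20,S 15 22,B 15 20,S 16 22], [S 0 0,S 0 1,S 1 1,S 1 3,S 3 3,S 3 6,S 5 6,S 5
    9,B 6 7,S 6 11,S 8 11,S 8 14,S 10 14,S 10 17,S 11 16], [S 0 0,S 0 1,S 1 1,S 1 2,B 2 6,S 2 2,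
    S 4 5,B 4 11,S 6 10,S 6 12,S 7 12], [S 0 0,S 0 1,S 1 1,S 1 4,S 2 2,S 3 9,S 2 6,S 3 6,S 4
    9]]), (8,[[S 0 0,D 0 0,S 1 1,A 2 3,D 1 1,S 2 2,S 3 3,A 4 6,B 3 6,S 4 5,S 5 6,B 5 9,B 7 8,B
    7 12,B 9 11,B 9 15,B 11 14,B 11 18,B 13 17,A 13 20,B 15 20,S 16 23,S 15 22,B 16 22,S 17 25,
    B 17 23,S 18 25], [S 0 0,D 0 0,S 1 1,B 1 3,B 2 6,S 2 2,S 4 5,B 4 9,S 6 8,S 6 11,B 8 11,S 8
    14,B 10 14,S 10 17,S 11 16,S 11 19,S 12 19], [S 0 0,S 0 2,S 1 4,S 1 1,S 2 9,B 2 4,S 3 8]]),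
    (9,[[S 0 0,D 0 0,S 1 1,A 2 3,D 1 1,S 2 2,S 3 3,A 4 6,B 3 6,S 4 4,B 5 9,S 5 6,B 7 8,B 7 12,B
    9 11,B 9 15,B 11 14,B 11 18,B 13 17,B 13 21,B 15 20,A 15 23,B 17 23,A 17 25,A 18 26,B 18 25,
    S 19 28,B 19 26,S 20 28], [S 0 0,D 0 0,S 1 3,S 1 1,S 3 3,B 4 9,S 3 6,S 4 5,B 6 7,S 6 11,S 8
    11,S 8 14,B 10 14,S 10 17,B 12 17,S 13 22,S 12 20,S 13 19,S 14 22], [S 0 0,S 0 1,S 1 3,S 1
    1,S 3 3,S 3 8,B 4 11,S 5 7,S 7 10,B 7 16,S 9 15,S 9 17,S 10 17], [S 0 0,S 0 1,S 1 1,S 1 4,S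
    3 4,S 3 8,S 5 7,S 4 11,S 6 11,S 6 15,S 7 14]]), (10,[[S 0 0,D 0 0,S 1 1,A 2 3,B 1 3,S 2 2,S
    3 3,B 3 6,S 4 5,B 5 9,A 4 6,S 5 6,B 7 8,B 7 12,B 9 11,S 9 13,A 10 15,B 10 13,B 11 15,B 12
    20,B 11 18,B 12 16,B 14 19,B 14 23,B 16 22,B 16 26,B 18 25,S 18 27,B 19 27,S 19 28,B 20 28,
    S 20 30,S 21 30], [S 0 0,S 0 1,S 1 1,S 1 3,S 3 3,S 3 6,S 5 6,B 5 11,B 8 10,S 8 14,S 10 14,S
    10 17,B 12 17,S 13 22,B 12 22,B 14 20,S 15 25,S 15 22,S 16 25], [S 0 0,S 0 1,S 1 1,S 1 3,S
    3 3,S 3 8,S 6 8,S 6 13,S 9 13,S 9 17,B 10 16,B 10 19,S 11 18,S 11 21,S 12 20], [S 0 0,S 0 1,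
    S 1 2,S 1 1,S 2 2,S 3 8,S 2 6,S 3 4,B 4 7,S 5 13,B 4 11,S 5 9,S 6 15,S 6 11,S 7 14,S 7 16,S
    8 16]]), (11,[[S 0 0,D 0 0,B 1 3,S 1 1,S 2 2,A 2 3,S 3 3,B 3 6,S 4 5,B 5 9,A 4 6,S 5 6,B 7
    8,B 7 12,B 9 11,B 9 15,B 11 14,S 11 16,B 12 16,B 12 20,B 14 19,B 14 23,B 16 22,B 16 26,B 18
    25,B 18 29,B 20 28,S 20 30,B 21 30,S 22 33,S 21 31,B 22 31,S 23 33], [S 0 0,S 0 1,S 1 1,S 1
    3,S 3 3,S 3 6,S 5 6,B 5 11,B 8 10,S 8 14,B 10 13,B 10 19,B 13 18,B 13 24,B 16 23,S 17 27,S
    16 26,B 17 26,S 18 27], [S 0 0,S 0 1,S 1 1,B 1 3,B 2 6,S 2 2,S 4 5,B 4 9,S 6 8,S 6 11,B 8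
    11,S 9 18,B 7 16,B 9 15,B 11 18,S 11 21,S 12 22,S 12 20,S 13 22], [S 0 0,S 0 2,S 2 2,S 2 6,
    S 3 6,B 3 11,S 4 13,B 4 7,S 6 13,S 6 16,S 7 16], [S 0 0,S 0 2,S 1 1,S 1 7,S 2 6,B 2 13,S 3
    11], [S 0 0,S 0 4,S 1 4,S 1 9,S 2 9]]), (12,[[S 0 0,S 0 1,S 1 1,S 1 3,S 3 3,S 3 6,S 5 6,B 5
    11,B 8 10,S 8 14,B 10 13,S 10 17,B 12 16,B 12 22,B 15 21,B 15 27,B 18 26,S 17 28,S 19 30,S
    19 28,S 20 30], [S 0 0,B 1 3,S 0 1,S 1 1,S 2 2,B 3 7,B 2 4,S 3 3,B 4 6,B 4 9,S 6 8,S 6 11,S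
    8 11,B 8 15,B 10 14,B 10 19,B 11 18,S 11 21,B 13 21,B 13 24,B 14 23,S 14 25,S 15 25], [S 0
    0,S 0 1,S 1 3,S 1 1,S 2 2,S 3 8,B 2 6,B 3 5,B 5 8,S 5 11,B 6 10,B 7 16,S 6 13,B 7 12,S 8 14,
    B 8 20,S 10 19,S 10 21,S 11 21], [S 0 0,S 0 1,S 1 4,S 1 1,S 3 4,B 3 11,B 5 9,S 5 13,S 6 11,
    B 6 18,S 7 16,S 7 18,S 8 18], [S 0 0,S 0 1,S 1 4,S 1 1,S 3 4,B 3 11,S 4 9,B 4 16,S 6 15],
    [S 0 0,S 0 1,S 1 4,S 1 1,B 2 4,S 2 9,S 3 8,B 3 14,S 4 13]]), (13,[[S 0 0,S 0 1,S 1 1,S 1 3,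
    S 3 3,S 3 6,S 5 6,B 5 11,B 8 10,S 8 14,B 11 14,S 11 19,B 14 19,B 14 25,B 17 24,S 17 28,S 19
    28,S 19 31,S 21 31,S 21 34,S 22 33], [S 0 0,S 0 1,S 1 1,S 1 3,S 3 3,S 3 8,S 5 7,S 6 15,B 4
    11,S 7 10,B 9 15,S 9 20,S 11 19,S 12 25,B 11 23,S 12 22,S 13 24]]), (14,[[S 0 0,S 0 1,S 1 1,
    S 1 3,S 3 3,S 3 6,S 4 5,B 5 11,B 4 9,S 5 7,B 8 10,A 9 16,S 8 14,B 10 13,B 12 16,B 12 22,B
    15 21,B 15 27,B 18 26,B 18 32,B 21 31,S 21 34,S 22 35,S 22 33,S 23 35], [S 0 0,D 0 0,S 1 1,
    B 1 3,B 2 6,S 2 2,S 4 5,B 4 9,S 6 8,S 6 11,B 8 11,B 8 18,B 12 17,S 12 23,B 14 23,S 14 26,B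
    16 26,S 16 29,S 17 31,S 17 28,S 18 31], [S 0 0,S 0 1,S 1 3,S 1 1,S 2 4,S 2 2,S 3 4,S 4 9,S
    3 8,B 4 7,S 5 9,S 5 13,S 6 11,S 6 15,B 7 14,B 7 18,S 8 16,B 8 20,S 9 18,S 9 22,S 10 21,S 10
    23,S 11 23]]), (15,[[S 0 0,S 0 1,S 1 1,B 2 6,S 1 3,S 2 2,S 4 5,B 4 11,S 7 10,B 7 16,S 9 15,
    S 9 20,B 12 20,S 12 25,B 14 25,S 14 28,S 15 27,S 15 29,S 16 29]])]"

definition inc_cert_BD :: "(int \<times> opt list list) list" where
  "inc_cert_BD = [((-12),[[S 0 1,A 3 1,S 2 2,B 3 2,S 3 3,A 6 3,S 5 4,B 6 4,S 6 5,A 7 6,S 7 5,B 9 6,A 9 7,S 10 7,A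
    10 8,A 13 8,A 12 9,A 15 9,A 13 10,B 15 10,A 15 11,A 18 11,A 18 13,A 17 12,A 20 12,A 20 14,B
    20 13,A 23 14,A 23 16,A 21 15,B 23 15,A 26 16,A 25 17,B 26 17,A 26 18,A 29 18,S 28 19,A 29
    20,A 30 19,A 32 20,S 31 21]]), ((-11),[]), ((-10),[]), ((-9),[[S 0 1,A 3 1,S 2 2,B 3 2,S 3
    3,A 6 3,A 5 5,A 9 5,A 7 6,B 9 6,A 9 7,A 10 8,S 10 7,B 12 8,A 13 10,A 12 9,A 15 9,A 15 11,B
    15 10,A 18 11,S 17 12,A 20 12,S 20 14,A 18 13,B 20 13,A 21 15,A 23 14,S 23 16,B 23 15]]),
    ((-8),[]), ((-7),[]), ((-6),[]), ((-5),[]), ((-4),[]), ((-3),[]), ((-2),[]), ((-1),[]), (0,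
    []), (1,[]), (2,[]), (3,[]), (4,[]), (5,[]), (6,[]), (7,[]), (8,[[S 0 1,S 1 1,B 1 4,A 2 4,S
    2 3,S 3 4,S 3 5,A 4 7,B 4 5,B 5 6,A 6 10,B 5 10,S 6 9,B 7 10,B 7 13,B 8 11,S 9 14,A 8 13,B
    9 13,B 10 14,B 11 19,B 10 17,B 11 16,S 12 18,B 12 20,B 13 19,A 13 21,S 14 21,A 14 22,A 15
    24,B 15 22,S 16 24]])]"

definition inc_cert_BS :: "(int \<times> opt list list) list" where
  "inc_cert_BS = [((-14),[[S 0 0,S 1 0,S 1 1,A 3 1,S 2 2,A 6 2,S 5 4,A 9 4,S 8 6,B 9 6,A 9 7,A 12 7,S 11 8,B 12 8,
    A 12 9,A 15 9,S 14 10,A 19 10,A 18 13,A 24 13,A 23 16,A 26 16,A 25 17,S 28 17,S 27 18,B 30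
    18,S 30 20,S 32 20,S 32 21]]), ((-13),[]), ((-12),[]), ((-11),[]), ((-10),[[S 0 1,A 3 1,S 2
    2,B 3 2,S 3 3,A 6 3,A 5 5,A 9 5,A 8 7,A 12 7,A 10 8,B 12 8,A 13 10,A 12 9,A 15 9,B 15 10,A
    15 11,A 18 11,A 18 13,A 16 12,A 19 12,A 20 13,A 19 14,A 23 14,A 22 16,B 24 16,A 24 17,B 25
    17,A 25 18,S 27 18,S 27 19]]), ((-9),[[S 0 1,A 3 1,S 2 2,B 3 2,A 3 3,A 6 3,A 5 5,S 7 5,A 7
    6,B 9 6,A 9 7,A 10 8,S 10 7,B 12 8,A 13 10,A 12 9,A 15 9,A 15 11,B 15 10,A 16 12,S 16 11,A
    20 12,A 19 14,B 21 14,A 21 15,B 22 15,A 22 16,S 24 16,S 24 17]]), ((-8),[]), ((-7),[]),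
    ((-6),[]), ((-5),[]), ((-4),[]), ((-3),[[S 0 1,A 3 1,S 2 2,S 3 3,B 3 2,S 4 3,A 5 5,A 4 4,S
    5 4,S 7 5,S 7 6]]), ((-2),[]), ((-1),[[S 0 1]]), (0,[]), (1,[[S 0 0,S 0 2,S 1 2,S 1 4]]),
    (2,[[S 0 0,S 0 2,S 1 2,B 1 4,S 2 3,S 2 5,S 3 5,S 3 7]]), (3,[[S 0 0,S 0 2,S 1 4,S 1 2,B 3 4,
    S 3 7,S 4 6,S 4 8,S 5 8,S 5 10]]), (4,[[S 0 2,S 1 4,S 1 1,B 3 4,S 3 7,S 4 6,B 4 10,S 6 9,S
    6 11,S 7 11,S 7 13]]), (5,[]), (6,[]), (7,[[S 0 1,S 1 1,S 1 4,B 3 4,B 4 10,S 3 5,B 4 5,S 6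
    9,S 6 12,B 8 12,S 8 15,B 10 15,S 10 18,S 11 17,S 11 20,S 12 20,S 12 21]]), (8,[[S 0 1,S 1 1,
    S 1 4,S 3 4,S 3 7,B 4 10,B 4 5,S 6 9,S 6 12,B 8 11,S 8 15,B 10 15,S 10 18,B 12 18,S 11 20,S
    13 20,S 14 24,S 13 23,S 14 23]]), (9,[[S 0 2,S 1 4,S 1 1,S 3 4,S 3 7,B 5 6,S 5 10,B 7 10,S
    7 13,B 9 13,S 9 16,B 11 16,S 11 20,S 13 20,S 13 23,S 15 23,S 15 26,S 16 27,S 16 26]]), (10,
    [[S 0 2,S 1 4,S 1 1,S 3 4,S 3 7,B 5 6,S 5 10,S 7 10,S 7 13,B 9 13,S 9 16,B 11 16,S 11 19,B
    13 19,S 13 23,S 15 23,S 15 26,B 16 24,S 17 28,S 16 27,B 17 27,S 18 28,S 18 30]]), (11,[]),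
    (12,[[S 0 1,S 0 2,S 1 2,S 1 4,A 4 4,S 3 7,S 4 6,B 4 10,S 6 9,S 6 12,B 8 11,S 8 15,B 10 14,S
    10 18,B 12 18,S 12 21,B 14 21,S 14 24,B 16 24,S 16 27,S 17 29,B 17 26,B 19 29,S 19 32,S 20
    31,S 20 34,S 21 34,S 21 35]])]"

definition inc_cert_BB :: "(int \<times> opt list list) list" where
  "inc_cert_BB = [(1,[[S 0 1,S 1 1,S 1 2,D 1 2,A 2 3,S 3 3,S 3 5,S 4 5,S 4 6,S 5 6,S 5 7,S 6 7]]), (2,[[S 0 1,S 1
    1,B 1 4,S 2 3,A 2 4,S 3 5,S 3 4,S 4 6,B 4 5,B 5 6,S 5 8,S 6 8], [S 0 0,S 0 2,S 1 2]]), (3,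
    [[S 0 1,S 1 1,B 2 5,B 1 4,S 2 3,S 3 5,S 3 4,B 4 5,A 4 7,B 5 6,S 6 9,S 5 8,B 6 8,S 7 11,B 7
    9,S 8 11]]), (4,[[S 0 1,S 1 1,B 1 4,A 2 4,S 2 3,S 3 4,S 3 5,S 4 6,B 4 5,B 5 6,B 5 10,S 6 9,
    A 6 10,S 7 10,S 7 11,B 8 11,S 8 12,B 9 12,S 9 14,S 10 14], [S 0 0,S 0 2,S 1 4,S 1 2,B 3 4,S
    3 7,S 4 6,S 4 8,S 5 8]]), (5,[[S 0 1,S 1 1,B 1 4,A 2 4,S 2 3,S 3 4,S 3 5,S 4 6,B 4 5,B 5 6,
    B 5 10,S 6 9,B 6 11,S 7 10,B 7 13,B 9 12,S 10 15,S 9 14,B 10 14,B 11 15,S 11 17,S 12 17],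
    [S 0 2,S 1 4,S 1 1,B 3 4,S 3 7,S 4 6,B 4 10,S 6 9,S 6 12,S 7 11], [S 0 2,S 1 1,S 1 5,S 3 5,
    S 3 9,S 4 8]]), (6,[[S 0 1,S 1 1,B 1 4,A 2 4,S 2 3,S 3 4,S 3 5,A 4 7,B 4 5,B 5 6,A 6 10,B 5
    10,S 6 9,S 7 11,S 7 10,B 8 11,S 8 12,B 9 12,B 9 16,B 11 15,S 11 17,B 12 17,S 12 18,B 13 18,
    S 13 20,S 14 20], [S 0 2,S 1 4,S 1 1,S 3 4,S 3 7,B 4 5,S 4 8,S 5 8,S 5 10,B 7 10,S 7 13,S 8
    12,S 8 15,S 9 14]]), (7,[[S 0 1,S 1 1,B 1 4,A 2 4,S 2 3,S 3 4,S 3 5,A 4 7,B 4 5,B 5 6,A 6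
    10,B 5 10,S 6 9,B 7 13,S 7 10,B 9 12,S 9 14,B 10 14,B 11 19,S 10 15,B 11 15,B 13 18,S 13 20,
    S 14 21,B 14 20,B 15 21,S 15 23,S 16 23], [S 0 2,S 1 4,S 1 1,S 3 4,S 3 7,S 5 7,S 5 10,B 7
    10,S 7 13,B 9 13,S 9 16,S 10 15,S 10 18,S 11 17]]), (8,[[S 0 1,S 1 1,B 1 4,A 2 4,S 2 3,B 3
    4,S 3 5,B 4 5,B 5 10,A 4 7,B 5 6,A 6 10,S 6 9,S 7 11,B 7 10,A 8 13,B 8 11,B 9 13,S 9 14,B
    10 14,B 10 17,B 11 16,B 12 21,S 11 17,B 12 17,B 14 20,A 14 22,B 15 22,S 15 23,B 16 23,S 16
    25,S 17 25], [S 0 1,S 1 1,S 1 4,B 3 4,B 4 10,S 3 5,B 4 5,S 6 9,S 6 12,B 8 12,S 8 15,B 10 15,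
    S 10 18,S 11 17,S 11 20,S 12 20]]), (9,[[S 0 1,S 1 1,B 1 4,A 2 4,S 2 3,S 3 4,S 3 5,B 4 5,B
    5 10,A 4 7,B 5 6,S 6 9,B 7 13,A 6 10,B 7 10,B 8 11,B 9 16,A 8 13,B 9 13,B 10 17,B 10 14,B
    11 16,S 11 17,B 12 17,B 12 20,B 13 19,S 13 20,B 14 20,B 14 24,B 16 23,A 16 25,B 17 25,A 17
    26,B 18 26,S 18 28,S 19 28], [S 0 1,S 1 1,S 1 4,S 3 4,B 4 10,S 3 5,B 4 5,S 6 9,S 6 12,S 8
    12,S 8 15,B 10 15,S 11 20,S 10 18,S 11 17,S 13 20,S 13 23,S 14 23]]), (10,[[S 0 1,S 1 1,B 1
    4,A 2 4,S 2 3,S 3 4,S 3 5,A 4 7,B 4 5,B 5 6,A 6 10,B 5 10,S 6 9,B 7 13,B 7 10,B 9 12,B 9 16,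
    B 10 14,B 10 17,B 11 16,S 11 17,B 12 17,B 12 21,B 14 20,A 14 22,B 15 22,S 15 23,B 16 23,B
    16 27,B 18 26,S 18 28,S 19 29,B 19 28,B 20 29,S 20 31,S 21 31], [S 0 2,S 1 4,S 1 1,S 3 4,S
    3 7,B 5 6,S 5 10,B 7 10,S 7 13,S 8 15,B 8 11,S 10 15,S 10 18,B 12 18,S 12 21,S 13 23,B 14
    21,S 15 23,S 15 26,S 16 25]]), (11,[[S 0 1,S 1 2,D 0 1,S 2 2,S 3 5,A 2 4,S 3 4,B 4 5,A 4 7,
    B 5 6,A 6 10,B 5 10,S 6 9,B 7 13,S 7 10,B 9 12,B 9 16,B 11 15,S 11 17,B 12 17,B 12 21,B 14
    20,B 14 24,B 16 23,A 16 25,B 17 25,A 17 26,B 18 30,B 18 26,B 20 29,S 20 31,B 21 31,S 21 32,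
    S 22 34,B 22 32,S 23 34], [S 0 2,S 1 4,S 1 1,S 3 4,S 3 7,B 5 6,S 5 10,S 7 10,S 7 13,S 8 15,
    B 9 13,B 10 14,S 10 18,S 12 18,S 12 21,B 14 21,S 15 26,S 14 24,B 16 24,S 17 28,B 17 26,S 18
    28]]), (12,[]), (13,[[S 0 2,S 1 4,S 1 1,A 4 4,S 3 7,B 4 10,S 4 6,S 6 9,S 6 12,B 8 11,S 8 15,
    B 10 14,S 10 18,B 12 18,B 12 20,B 13 19,S 13 23,S 15 23,S 15 26,B 17 26,S 17 29,B 19 29,S
    20 34,S 19 32,S 20 31,S 21 34]])]"

definition top_cert_DD :: "opt list" where
  "top_cert_DD = [S 0 0,D 0 0,S 1 1,B 1 3,S 2 2,A 2 3,S 3 3,B 3 6,S 4 5,B 5 9,A 4 6,S 5 6,B 6 7,S 7 10,A 6 9,S 7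
    9,B 8 10,A 8 12,S 9 12,A 10 15,S 9 13,B 10 13,B 11 15,S 11 16,B 12 16,B 12 20,B 14 19,A 14
    21,B 15 21,A 15 23,B 16 26,B 16 23,B 17 24,S 18 27,A 17 26,B 18 26,B 19 27,A 19 29,B 20 29,
    B 20 32,S 21 31,B 22 35,A 21 32,B 22 32,S 23 34,B 24 38,S 23 35,B 24 35,S 25 37]"

text \<open>Columns run up to 39 here, column 1 being the old \<open>b n\<close>. The six cells
  marked \<open>X\<close> are claimed without an answer and are dealt with by
  \<open>two_sided\<close>.\<close>

definition top_cert_BB :: "opt list" where
  "top_cert_BB = [S 0 1,B 0 2,X 0 1,S 1 2,B 1 4,S 2 3,S 3 5,A 2 4,B 3 4,B 4 5,A 4 7,X 4 7,S 5 8,A 6 10,B 5 10,B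
    6 9,B 7 10,B 7 13,B 8 12,A 8 13,B 9 13,B 9 16,B 10 15,X 10 15,B 11 19,B 11 16,B 12 18,A 13
    21,B 12 21,B 13 19,B 14 24,B 14 21,X 14 23,A 15 24,B 16 24,B 16 27,B 17 26,A 17 27,B 18 27,
    B 18 30,B 19 29,S 20 31,A 19 30,B 20 30,X 20 31,B 21 35,B 21 32,S 22 34,S 23 36,A 22 35,B
    23 35,S 24 37,B 24 36,X 24 37,S 25 38]"

text \<open>The shift (38, 25) needs a certificate of its own: exchanging the lists would turn the
  right constraint \<open>Backslash\<close> into \<open>Slash\<close>.\<close>

definition top_cert_BB' :: "opt list" where
  "top_cert_BB' = [B 0 1,X 0 0,B 1 2,A 3 1,B 2 3,A 4 2,B 3 4,A 6 3,S 5 4,A 7 4,S 7 5,X 6 4,A 9 5,A 8 6,A 10 6,A 9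
    7,A 12 7,A 12 9,A 11 8,B 12 8,A 15 9,A 14 10,X 14 10,A 15 11,A 18 11,A 17 12,A 20 12,A 18
    13,A 21 13,A 20 14,A 23 14,X 22 14,A 23 16,B 23 15,A 26 16,A 25 17,A 27 17,A 26 18,A 29 18,
    A 29 20,A 28 19,B 29 19,S 30 20,X 30 20,A 31 21,A 34 21,S 33 22,A 35 22,A 34 23,A 36 23,A
    35 24,A 37 24,S 37 25,X 36 24,S 38 25]"

lemma lb_checked_DD: "lb_checked Dot Dot"
proof (rule lb_checkedI[where cs = lb_cert_DD and lo = "0" and hi = 15])
  show "list_all (\<lambda>(d, oss). list_all2 (lb_check Dot Dot d) (lb_tab Dot Dot d) oss) lb_cert_DD"
    unfolding lb_cert_DD_def by (simp add: check_simps)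
  show "map fst lb_cert_DD = [0..15]" unfolding lb_cert_DD_def by (simp add: upto.simps)
qed (auto simp: lb_tab_def lb_tab_DD_def)

lemma lb_checked_DB: "lb_checked Dot Backslash"
proof (rule lb_checkedI[where cs = lb_cert_DB and lo = "-14" and hi = 16])
  show "list_all (\<lambda>(d, oss). list_all2 (lb_check Dot Backslash d) (lb_tab Dot Backslash d) oss) lb_cert_DB"
    unfolding lb_cert_DB_def by (simp add: check_simps)
  show "map fst lb_cert_DB = [-14..16]" unfolding lb_cert_DB_def by (simp add: upto.simps)
qed (auto simp: lb_tab_def lb_tab_DB_def)

lemma lb_checked_BB: "lb_checked Backslash Backslash"
proof (rule lb_checkedI[where cs = lb_cert_BB and lo = "0" and hi = 15])
  show "list_all (\<lambda>(d, oss). list_all2 (lb_check Backslash Backslash d) (lb_tab Backslash Backslash d) oss) lb_cert_BB"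
    unfolding lb_cert_BB_def by (simp add: check_simps)
  show "map fst lb_cert_BB = [0..15]" unfolding lb_cert_BB_def by (simp add: upto.simps)
qed (auto simp: lb_tab_def lb_tab_BB_def)

lemma lb_checked_SB: "lb_checked Slash Backslash"
proof (rule lb_checkedI[where cs = lb_cert_SB and lo = "-13" and hi = 17])
  show "list_all (\<lambda>(d, oss). list_all2 (lb_check Slash Backslash d) (lb_tab Slash Backslash d) oss) lb_cert_SB"
    unfolding lb_cert_SB_def by (simp add: check_simps)
  show "map fst lb_cert_SB = [-13..17]" unfolding lb_cert_SB_def by (simp add: upto.simps)
qed (auto simp: lb_tab_def lb_tab_SB_def)

lemma inc_checked_DD: "inc_checked Dot Dot"
proof (rule inc_checkedI[where cs = inc_cert_DD and lo = "1" and hi = 14])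
  show "list_all (\<lambda>(d, oss). list_all2 (inc_check Dot Dot d) (inc_tab Dot Dot d) oss) inc_cert_DD"
    unfolding inc_cert_DD_def by (simp add: check_simps)
  show "map fst inc_cert_DD = [1..14]" unfolding inc_cert_DD_def by (simp add: upto.simps)
qed (auto simp: inc_tab_def inc_tab_DD_def)

lemma inc_checked_DB: "inc_checked Dot Backslash"
proof (rule inc_checkedI[where cs = inc_cert_DB and lo = "-13" and hi = 15])
  show "list_all (\<lambda>(d, oss). list_all2 (inc_check Dot Backslash d) (inc_tab Dot Backslash d) oss) inc_cert_DB"
    unfolding inc_cert_DB_def by (simp add: check_simps)
  show "map fst inc_cert_DB = [-13..15]" unfolding inc_cert_DB_def by (simp add: upto.simps)
qed (auto simp: inc_tab_def inc_tab_DB_def)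

lemma inc_checked_BD: "inc_checked Backslash Dot"
proof (rule inc_checkedI[where cs = inc_cert_BD and lo = "-12" and hi = 8])
  show "list_all (\<lambda>(d, oss). list_all2 (inc_check Backslash Dot d) (inc_tab Backslash Dot d) oss) inc_cert_BD"
    unfolding inc_cert_BD_def by (simp add: check_simps)
  show "map fst inc_cert_BD = [-12..8]" unfolding inc_cert_BD_def by (simp add: upto.simps)
qed (auto simp: inc_tab_def inc_tab_BD_def)

lemma inc_checked_BS: "inc_checked Backslash Slash"
proof (rule inc_checkedI[where cs = inc_cert_BS and lo = "-14" and hi = 12])
  show "list_all (\<lambda>(d, oss). list_all2 (inc_check Backslash Slash d) (inc_tab Backslash Slash d) oss) inc_cert_BS"
    unfolding inc_cert_BS_def by (simp add: check_simps)
  show "map fst inc_cert_BS = [-14..12]" unfolding inc_cert_BS_def by (simp add: upto.simps)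
qed (auto simp: inc_tab_def inc_tab_BS_def)

lemma inc_checked_BB: "inc_checked Backslash Backslash"
proof (rule inc_checkedI[where cs = inc_cert_BB and lo = "1" and hi = 13])
  show "list_all (\<lambda>(d, oss). list_all2 (inc_check Backslash Backslash d) (inc_tab Backslash Backslash d) oss) inc_cert_BB"
    unfolding inc_cert_BB_def by (simp add: check_simps)
  show "map fst inc_cert_BB = [1..13]" unfolding inc_cert_BB_def by (simp add: upto.simps)
qed (auto simp: inc_tab_def inc_tab_BB_def)

lemma top_cells_DD: "inc_cells Dot Dot 25 38 63 top_cert_DD"
  unfolding top_cert_DD_def by (simp add: check_simps)

lemma top_cells_BB: "inc_cells Backslash Backslash 25 39 63 top_cert_BB"
  unfolding top_cert_BB_def by (simp add: check_simps)

lemma top_cells_BB': "inc_cells Backslash Backslash 38 26 63 top_cert_BB'"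
  unfolding top_cert_BB'_def by (simp add: check_simps)

lemma lb_ok: "lb_ok N"
  using lb_checked_DD lb_checked_DB lb_checked_BB lb_checked_SB by (intro lb_okI) auto

lemma inc_ok_Dot: "inc_ok Dot N"
  using lb_ok inc_checked_DD inc_checked_DB by (rule inc_ok_DotI)

lemma inc_checked_Backslash: "inc_checked Backslash t"
  by (cases t) (simp_all only: inc_checked_BD inc_checked_BS inc_checked_BB)

lemma inc_ok_Backslash: "inc_ok Backslash N"
  using lb_ok inc_ok_Dot inc_checked_Backslash by (rule inc_ok_BackslashI)

section \<open>Upper bounds\<close>

text \<open>
  An entry \<open>(n, d)\<close> at \<open>m\<close> says that \<open>M\<close> falls short of the trivial bound \<open>m + n - 1\<close> by at least \<open>d\<close>.
  The certificates list an optimal first comparison for each entry.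
\<close>

definition ub_tab_DD :: "int \<Rightarrow> (int \<times> int) list" where
  "ub_tab_DD m = (if m < 6 then (if m < 3 then (if m < 2 then (if m = 1 then [(3,1), (4,1), (5,2), (6,3), (7,4), (8,4), (9,5),
    (10,6), (11,7), (12,8), (13,9), (14,10), (15,11), (16,11), (17,12), (18,13), (19,14), (20,15)] else []) else
    (if m = 2 then [(5,1), (6,1), (7,2), (8,3), (9,3), (10,4), (11,5), (12,6), (13,6), (14,7), (15,8), (16,9),
    (17,10), (18,11), (19,11), (20,12)] else [])) else (if m < 4 then (if m = 3 then [(6,1), (7,1), (8,2), (9,2),
    (10,3), (11,4), (12,4), (13,5), (14,5), (15,6), (16,7), (17,8), (18,8), (19,9), (20,10)] else []) else (if m <
    5 then (if m = 4 then [(8,1), (9,1), (10,2), (11,2), (12,3), (13,3), (14,4), (15,5), (16,5), (17,6), (18,7),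
    (19,7), (20,8)] else []) else (if m = 5 then [(9,1), (10,1), (11,2), (12,2), (13,3), (14,3), (15,4), (16,4),
    (17,5), (20,7)] else [])))) else (if m < 9 then (if m < 7 then (if m = 6 then [(11,1), (12,1), (16,3), (17,4),
    (18,4), (20,5)] else []) else (if m < 8 then (if m = 7 then [(16,2), (17,3), (18,3), (19,4), (20,5)] else [])
    else (if m = 8 then [(15,1), (16,1), (17,2), (18,2), (19,3)] else []))) else (if m < 10 then (if m = 9 then
    [(15,1), (16,1), (17,1), (18,2), (19,2), (20,3)] else []) else (if m < 14 then (if m = 10 then [(17,1)] else
    []) else (if m = 14 then [(23,1)] else [])))))"

definition ub_tab_DB :: "int \<Rightarrow> (int \<times> int) list" where
  "ub_tab_DB m = (if m < 9 then (if m < 6 then (if m < 4 then (if m = 2 then [(4,1), (6,2)] else []) else (if m = 4 then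
    [(3,1), (7,1), (9,2), (11,3), (13,4)] else [])) else (if m < 7 then (if m = 6 then [(3,2)] else []) else (if m
    < 8 then (if m = 7 then [(5,1)] else []) else (if m = 8 then [(18,3)] else [])))) else (if m < 17 then (if m <
    16 then (if m = 9 then [(5,2), (17,2)] else []) else (if m = 16 then [(9,2)] else [])) else (if m < 18 then
    (if m = 17 then [(3,10)] else []) else (if m < 20 then (if m = 18 then [(2,13), (5,7)] else []) else (if m =
    20 then [(8,5)] else [])))))"

definition ub_tab_BB :: "int \<Rightarrow> (int \<times> int) list" where
  "ub_tab_BB m = (if m < 5 then (if m = 4 then [(9,3)] else []) else (if m = 5 then [(6,1), (7,1)] else []))"

definition ub_tab_SB :: "int \<Rightarrow> (int \<times> int) list" where
  "ub_tab_SB m = (if m < 4 then (if m < 3 then (if m = 1 then [(3,1), (5,2)] else []) else (if m = 3 then [(9,3)] else []))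
    else (if m < 7 then (if m = 4 then [(6,1), (7,1)] else []) else (if m = 7 then [(6,1)] else [])))"

text \<open>This is linear merging from the right: every comparison of the two last elements removes
  one element. Constraints are dropped by \<open>M_le_Dot\<close>, the left one after a
  reversal.\<close>

lemma M_tape: "dfd l r m n \<Longrightarrow> 1 \<le> m \<Longrightarrow> 1 \<le> n \<Longrightarrow> M l r m n \<le> m + n - 1"
proof -
  have tape: "M Dot Dot m n \<le> m + n - 1" for m n
  proof (induction "m + n" arbitrary: m n rule: less_induct)
    case less
    show ?case
    proof (cases "1 \<le> m \<and> 1 \<le> n")
      case True
      have "M Dot Dot m (n - 1) \<le> m + (n - 1) - 1" "M Dot Dot (m - 1) n \<le> m - 1 + n - 1"
        using True by (intro less.hyps; simp)+
      then show ?thesis using M_Dot_le[of m n Dot] True by linarith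
    qed (auto simp: not_le)
  qed
  assume "dfd l r m n"
  then have "M l r m n \<le> M l Dot m n" by (rule M_le_Dot)
  also have "M l Dot m n = M Dot (flip l) m n" using M_rev[of l Dot m n] by simp
  also have "\<dots> \<le> M Dot Dot m n" by (intro M_le_Dot) simp
  finally show ?thesis using tape[of m n] by linarith
qed

fun pick :: "int \<Rightarrow> (int \<times> int) list \<Rightarrow> int" where
  "pick n [] = 0"
| "pick n ((a, d) # es) = (if a = n then d else pick n es)"

lemma pick_cases: "pick n es = 0 \<or> (n, pick n es) \<in> set es"
  by (induction es) (auto split: if_splits)

text \<open>The first two cases make \<open>m + n - 1 - dfc_DD m n\<close> vanish when one list is
  empty, in agreement with \<open>M\<close>; \<open>dfc_DB\<close> relies on this when it steps down
  to \<open>n - 1 = 0\<close>.\<close>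

definition dfc_DD :: "int \<Rightarrow> int \<Rightarrow> int" where
  "dfc_DD m n = (if m < 1 then n - 1 else if n < 1 then m - 1 else
     if n < m then pick m (ub_tab_DD n) else pick n (ub_tab_DD m))"

text \<open>Dropping the constraint keeps a shortfall. So does spending one comparison on
  \<open>b n\<close>, since the trivial bound then decreases by 1 as well. The table has to
  contribute only what exceeds both.\<close>

definition dfc_DB :: "int \<Rightarrow> int \<Rightarrow> int" where
  "dfc_DB m n = mx (pick n (ub_tab_DB m)) (mx (dfc_DD m n) (dfc_DD m (n - 1)))"

definition dfc_BB :: "int \<Rightarrow> int \<Rightarrow> int" where
  "dfc_BB m n = mx (pick n (ub_tab_BB m)) (mx (dfc_DB n m) (dfc_DB (n - 1) m))"

definition dfc_SB :: "int \<Rightarrow> int \<Rightarrow> int" where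
  "dfc_SB m n = mx (pick n (ub_tab_SB m)) (mx (dfc_DB m n) (dfc_DB m (n - 1)))"

fun dfc :: "constr \<Rightarrow> constr \<Rightarrow> int \<Rightarrow> int \<Rightarrow> int" where
  "dfc Dot Dot m n = dfc_DD m n"
| "dfc Dot Backslash m n = dfc_DB m n"
| "dfc Slash Dot m n = dfc_DB m n"
| "dfc Dot Slash m n = dfc_DB n m"
| "dfc Backslash Dot m n = dfc_DB n m"
| "dfc Backslash Backslash m n = (if n < m then dfc_BB n m else dfc_BB m n)"
| "dfc Slash Slash m n = (if n < m then dfc_BB n m else dfc_BB m n)"
| "dfc Slash Backslash m n = dfc_SB m n"
| "dfc Backslash Slash m n = dfc_SB n m"

definition ubv :: "constr \<Rightarrow> constr \<Rightarrow> int \<Rightarrow> int \<Rightarrow> int" where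
  "ubv l r m n = (if m < 1 then 0 else if n < 1 then 0 else m + n - 1 - dfc l r m n)"

definition ub_tab :: "constr \<Rightarrow> constr \<Rightarrow> int \<Rightarrow> (int \<times> int) list" where
  "ub_tab l r m = (if r = Dot then if l = Dot then ub_tab_DD m else []
     else if r = Backslash then if l = Dot then ub_tab_DB m else if l = Backslash then ub_tab_BB m else ub_tab_SB m
     else [])"

definition ub_ok :: "int \<Rightarrow> bool" where
  "ub_ok N \<longleftrightarrow> (\<forall>l r m n d. (n, d) \<in> set (ub_tab l r m) \<longrightarrow> m + n \<le> N \<longrightarrow>
     1 \<le> m \<and> 1 \<le> n \<and> int (M l r (nat m) (nat n)) + d \<le> m + n - 1)"

lemma ub_pick:
  assumes "ub_ok (int m + int n)" "dfd l r m n" "1 \<le> m" "1 \<le> n"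
  shows "int (M l r m n) + pick (int n) (ub_tab l r (int m)) \<le> int m + int n - 1"
  using pick_cases[of "int n" "ub_tab l r (int m)"]
proof
  assume "pick (int n) (ub_tab l r (int m)) = 0"
  then show ?thesis using M_tape[OF assms(2-4)] assms(3,4) by linarith
next
  assume "(int n, pick (int n) (ub_tab l r (int m))) \<in> set (ub_tab l r (int m))"
  then have "int (M l r (nat (int m)) (nat (int n))) + pick (int n) (ub_tab l r (int m)) \<le> int m + int n - 1"
    using assms(1) unfolding ub_ok_def by blast
  then show ?thesis by simp
qed

lemma ub_ok_mono: "ub_ok N \<Longrightarrow> N' \<le> N \<Longrightarrow> ub_ok N'"
  unfolding ub_ok_def by (meson order_trans)

lemma mx_le: "a + x \<le> c \<Longrightarrow> a + y \<le> c \<Longrightarrow> a + mx x y \<le> (c :: int)"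
  by (simp add: mx_def)

lemma dfc_DD_le:
  assumes "ub_ok (int m + int n)" "1 \<le> m \<or> 1 \<le> n"
  shows "int (M Dot Dot m n) + dfc_DD (int m) (int n) \<le> int m + int n - 1"
proof (cases "1 \<le> m \<and> 1 \<le> n")
  case True
  have o': "ub_ok (int n + int m)" using assms(1) by (simp add: add.commute)
  show ?thesis
    using True ub_pick[OF assms(1), of Dot Dot] ub_pick[OF o', of Dot Dot] M_swap[of Dot Dot m n]
    by (auto simp: dfc_DD_def ub_tab_def)
qed (use assms(2) in \<open>auto simp: dfc_DD_def not_le\<close>)

lemma dfc_DB_le:
  assumes "ub_ok (int m + int n)" "1 \<le> m" "1 \<le> n"
  shows "int (M Dot Backslash m n) + dfc_DB (int m) (int n) \<le> int m + int n - 1"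
proof -
  have "ub_ok (int m + int (n - 1))" using assms(1) by (rule ub_ok_mono) simp
  from dfc_DD_le[OF this] have "int (M Dot Dot m (n - 1)) + dfc_DD (int m) (int n - 1) \<le> int m + int n - 2"
    using assms(2,3) by (simp add: of_nat_diff)
  moreover have "M Dot Backslash m n \<le> 1 + M Dot Dot m (n - 1)" "M Dot Backslash m n \<le> M Dot Dot m n"
    using assms M_Backslash_le[of Dot m n] M_le_Dot[of Dot Backslash m n] by auto
  ultimately show ?thesis unfolding dfc_DB_def
    using ub_pick[OF assms(1), of Dot Backslash] dfc_DD_le[OF assms(1)] assms(2,3)
    by (intro mx_le) (auto simp: ub_tab_def)
qed

lemma M_Backslash_Dot: "M Backslash Dot m n = M Dot Backslash n m"
  using M_swap[of Dot Slash m n] M_rev[of Backslash Dot m n] by simp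

lemma M_Slash_Dot: "M Slash Dot m n = M Dot Backslash m n"
  using M_rev[of Slash Dot m n] by simp

lemma M_Dot_Slash: "M Dot Slash m n = M Dot Backslash n m"
  using M_swap[of Dot Slash m n] by simp

lemma M_Backslash_Backslash_commute: "M Backslash Backslash m n = M Backslash Backslash n m"
  using M_swap[of Backslash Backslash m n] M_rev[of Backslash Backslash n m] by (simp add: dfd_def)

lemma M_Slash_Slash: "M Slash Slash m n = M Backslash Backslash m n"
  using M_rev[of Backslash Backslash m n] by (simp add: dfd_def)

lemma dfc_BB_le:
  assumes "ub_ok (int m + int n)" "1 \<le> m" "1 \<le> n"
  shows "int (M Backslash Backslash m n) + dfc_BB (int m) (int n) \<le> int m + int n - 1"
proof -
  have d: "dfd Backslash Backslash m n" by (simp add: dfd_def)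
  have o1: "ub_ok (int n + int m)" using assms(1) by (simp add: add.commute)
  have o2: "ub_ok (int (n - 1) + int m)" using o1 by (rule ub_ok_mono) simp
  have "int (M Backslash Backslash m n) + dfc_DB (int n - 1) (int m) \<le> int m + int n - 1"
  proof (cases "n = 1")
    \<comment> \<open>\<open>dfc_DB 0 (int m)\<close> equals \<open>m - 1\<close>, so the claim
      amounts to \<open>M Backslash Backslash m 1 \<le> 1\<close>.\<close>
    case True
    have "M Backslash Backslash m n \<le> 1" using M_Backslash_1[of Backslash m] True assms(2) d by simp
    moreover have "ub_tab_DB 0 = []" by (simp add: ub_tab_DB_def)
    ultimately show ?thesis using True assms(2) by (auto simp: dfc_DB_def dfc_DD_def mx_def)
  next
    case False
    then have "int (M Dot Backslash (n - 1) m) + dfc_DB (int n - 1) (int m) \<le> int m + int n - 2"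
      using dfc_DB_le[OF o2] assms by (simp add: of_nat_diff add.commute)
    then show ?thesis using M_Backslash_le[OF d] assms M_Backslash_Dot[of m "n - 1"] by linarith
  qed
  then show ?thesis unfolding dfc_BB_def
    using ub_pick[OF assms(1) d] dfc_DB_le[OF o1] M_le_Dot[OF d] M_Backslash_Dot[of m n] assms(2,3)
    by (intro mx_le) (auto simp: ub_tab_def)
qed

lemma dfc_SB_le:
  assumes "ub_ok (int m + int n)" "1 \<le> m" "2 \<le> n"
  shows "int (M Slash Backslash m n) + dfc_SB (int m) (int n) \<le> int m + int n - 1"
proof -
  have d: "dfd Slash Backslash m n" using assms by (simp add: dfd_def)
  have "ub_ok (int m + int (n - 1))" using assms(1) by (rule ub_ok_mono) simp
  from dfc_DB_le[OF this] have "int (M Dot Backslash m (n - 1)) + dfc_DB (int m) (int n - 1) \<le> int m + int n - 2"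
    using assms(2,3) by (simp add: of_nat_diff)
  moreover have "M Slash Backslash m n \<le> 1 + M Dot Backslash m (n - 1)" "M Slash Backslash m n \<le> M Dot Backslash m n"
    using assms M_Backslash_le[OF d] M_le_Dot[OF d] by (auto simp: M_Slash_Dot)
  ultimately show ?thesis unfolding dfc_SB_def
    using ub_pick[OF assms(1) d] dfc_DB_le[OF assms(1)] assms(2,3)
    by (intro mx_le) (auto simp: ub_tab_def)
qed

lemma ubv_le:
  assumes "ub_ok (int m + int n)" "dfd l r m n"
  shows "int (M l r m n) \<le> ubv l r (int m) (int n)"
proof (cases "1 \<le> m \<and> 1 \<le> n")
  case True
  have o': "ub_ok (int n + int m)" using assms(1) by (simp add: add.commute)
  have BS: "M Backslash Slash m n = M Slash Backslash n m" if "2 \<le> m"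
    using M_swap[of Slash Backslash n m] that by (simp add: dfd_def)
  note L = dfc_DD_le[OF assms(1)] dfc_DB_le[OF assms(1)] dfc_DB_le[OF o'] dfc_BB_le[OF assms(1)] dfc_BB_le[OF o']
    dfc_SB_le[OF assms(1)] dfc_SB_le[OF o']
  have "int (M l r m n) + dfc l r (int m) (int n) \<le> int m + int n - 1"
    using True assms(2) L BS M_Backslash_Backslash_commute[of m n]
    by (cases l; cases r) (auto simp: dfd_def M_Backslash_Dot M_Slash_Dot M_Dot_Slash M_Slash_Slash)
  then show ?thesis using True by (simp add: ubv_def)
qed (auto simp: ubv_def not_le)

fun ub_split :: "constr \<Rightarrow> constr \<Rightarrow> int \<Rightarrow> int \<Rightarrow> int \<Rightarrow> opt \<Rightarrow> bool" where
  "ub_split l r m n v (S p q) \<longleftrightarrow> (if p = 0 \<and> l = Backslash then True else if q = 0 \<and> l = Slash then True else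
     if p = m \<and> r = Slash then True else if q = n \<and> r = Backslash then True else
     ubv l Dot p q + ubv Dot r (m - p) (n - q) < v)"
| "ub_split l r m n v (A p q) \<longleftrightarrow> (if p = 1 \<and> l = Backslash then True else if p = m \<and> r = Slash then True else
     ubv l Slash p q + ubv Backslash r (m - p + 1) (n - q) < v)"
| "ub_split l r m n v (B p q) \<longleftrightarrow> (if q = 1 \<and> l = Slash then True else if q = n \<and> r = Backslash then True else
     ubv l Backslash p q + ubv Slash r (m - p) (n - q + 1) < v)"
| "ub_split l r m n v (D p q) \<longleftrightarrow> True"
| "ub_split l r m n v (X p q) \<longleftrightarrow> True"

fun ub_row :: "(int \<Rightarrow> int \<Rightarrow> opt) \<Rightarrow> constr \<Rightarrow> constr \<Rightarrow> int \<Rightarrow> int \<Rightarrow> int \<Rightarrow> int \<Rightarrow> int list \<Rightarrow> bool" where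
  "ub_row C l r m n v p [] = True"
| "ub_row C l r m n v p (q # qs) = (if ub_split l r m n v (C p q) then ub_row C l r m n v p qs else False)"

fun ub_rect :: "(int \<Rightarrow> int \<Rightarrow> opt) \<Rightarrow> constr \<Rightarrow> constr \<Rightarrow> int \<Rightarrow> int \<Rightarrow> int \<Rightarrow> int list \<Rightarrow> int list \<Rightarrow> bool" where
  "ub_rect C l r m n v [] qs = True"
| "ub_rect C l r m n v (p # ps) qs = (if ub_row C l r m n v p qs then ub_rect C l r m n v ps qs else False)"

lemma ub_rectD:
  assumes "ub_rect C l r m n v [a..b] [c..d]" "a \<le> p" "p \<le> b" "c \<le> q" "q \<le> d"
  shows "ub_split l r m n v (C p q)"
proof -
  have row: "ub_split l r m n v (C p q)" if "ub_row C l r m n v p qs" "q \<in> set qs" for qs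
    using that by (induction qs) (auto split: if_splits)
  have "ub_split l r m n v (C p q)" if "ub_rect C l r m n v ps qs" "p \<in> set ps" "q \<in> set qs" for ps qs
    using that by (induction ps) (auto split: if_splits intro: row)
  then show ?thesis using assms by auto
qed

text \<open>The pair \<open>(i, j)\<close> is the first comparison of the algorithm. The six
  rectangles list, for each kind of splitting, the two ways in which it can separate
  \<open>a i\<close> from \<open>b j\<close>.\<close>

definition ub_check :: "constr \<Rightarrow> constr \<Rightarrow> int \<Rightarrow> (int \<times> int) \<Rightarrow> (int \<times> int) \<Rightarrow> bool" where
  "ub_check l r m e x = (case e of (n, d) \<Rightarrow> case x of (i, j) \<Rightarrow> 1 \<le> i \<and> i \<le> m \<and> 1 \<le> j \<and> j \<le> n \<and>
     (if l = Slash then 2 \<le> n else True) \<and>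
     ub_rect S l r m n (m + n - 1 - d) [i..m] [0..(j - 1)] \<and>
     ub_rect S l r m n (m + n - 1 - d) [0..(i - 1)] [j..n] \<and>
     ub_rect A l r m n (m + n - 1 - d) [(i + 1)..m] [1..(j - 1)] \<and>
     ub_rect A l r m n (m + n - 1 - d) [1..(i - 1)] [j..(n - 1)] \<and>
     ub_rect B l r m n (m + n - 1 - d) [i..(m - 1)] [1..(j - 1)] \<and>
     ub_rect B l r m n (m + n - 1 - d) [1..(i - 1)] [(j + 1)..n])"

lemma ub_check_le:
  assumes ok: "ub_ok (int m + int n - 1)" and c: "ub_check l r (int m) (int n, d) (int i, int j)" and r: "r \<noteq> Slash"
  shows "int (M l r m n) + d \<le> int m + int n - 1"
proof -
  have ij: "1 \<le> i" "i \<le> m" "1 \<le> j" "j \<le> n" using c by (auto simp: ub_check_def)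
  have d: "dfd l r m n" using c r by (auto simp: ub_check_def dfd_def)
  obtain s where s: "ok l r m n i j s" "M l r m n \<le> 1 + val l r m n s" using M_le_split[OF d ij] by blast
  have U: "int (M l' r' m' n') \<le> ubv l' r' (int m') (int n')" if "dfd l' r' m' n'" "m' + n' < m + n" for l' r' m' n'
    using that by (intro ubv_le ub_ok_mono[OF ok]) auto
  have "int (val l r m n s) < int m + int n - 1 - d"
  proof (cases s)
    case (Simple p q)
    note b = ok_SimpleD[OF s(1)[unfolded Simple] ij]
    have "i \<le> p \<and> q < j \<or> p < i \<and> j \<le> q" using s(1) Simple by (simp add: ok_def)
    then have "ub_split l r (int m) (int n) (int m + int n - 1 - d) (S (int p) (int q))"
    proof
      assume "i \<le> p \<and> q < j"
      then show ?thesis using c b unfolding ub_check_def prod.case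
        by (elim conjE) (erule ub_rectD; simp)
    next
      assume "p < i \<and> j \<le> q"
      then show ?thesis using c b unfolding ub_check_def prod.case
        by (elim conjE) (erule ub_rectD; simp)
    qed
    moreover have "\<not> (p = 0 \<and> l = Backslash)" "\<not> (q = 0 \<and> l = Slash)" "\<not> (p = m \<and> r = Slash)" "\<not> (q = n \<and> r = Backslash)"
      using s(1) Simple by (auto simp: ok_def)
    ultimately have "ubv l Dot (int p) (int q) + ubv Dot r (int (m - p)) (int (n - q)) < int m + int n - 1 - d"
      using b by (auto simp: of_nat_diff split: if_splits)
    moreover have "int (M l Dot p q) \<le> ubv l Dot (int p) (int q)" using b by (intro U) auto
    moreover have "int (M Dot r (m - p) (n - q)) \<le> ubv Dot r (int (m - p)) (int (n - q))" using b by (intro U) auto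
    ultimately show ?thesis unfolding Simple val.simps by linarith
  next
    case (Share_a p q)
    have b: "1 \<le> p" "p \<le> m" "1 \<le> q" "q < n" using s(1) Share_a by (auto simp: ok_def)
    have "i < p \<and> q < j \<or> p < i \<and> j \<le> q" using s(1) Share_a by (simp add: ok_def)
    then have "ub_split l r (int m) (int n) (int m + int n - 1 - d) (A (int p) (int q))"
    proof
      assume "i < p \<and> q < j"
      then show ?thesis using c b unfolding ub_check_def prod.case
        by (elim conjE) (erule ub_rectD; simp)
    next
      assume "p < i \<and> j \<le> q"
      then show ?thesis using c b unfolding ub_check_def prod.case
        by (elim conjE) (erule ub_rectD; simp)
    qed
    moreover have "\<not> (p = 1 \<and> l = Backslash)" "\<not> (p = m \<and> r = Slash)"
      using s(1) Share_a by (auto simp: ok_def)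
    moreover have e: "int (m - p + 1) = int m - int p + 1" "int (n - q) = int n - int q" using b by auto
    ultimately have "ubv l Slash (int p) (int q) + ubv Backslash r (int (m - p + 1)) (int (n - q)) < int m + int n - 1 - d"
      unfolding e by (simp split: if_splits)
    moreover note ok_dfd(1)[OF s(1) Share_a]
    moreover from this have "int (M l Slash p q) \<le> ubv l Slash (int p) (int q)" using b by (intro U) auto
    moreover from calculation(2) have "int (M Backslash r (m - p + 1) (n - q)) \<le> ubv Backslash r (int (m - p + 1)) (int (n - q))"
      using b by (intro U) auto
    ultimately show ?thesis unfolding Share_a val.simps by linarith
  next
    case (Share_b p q)
    have b: "1 \<le> p" "p < m" "1 \<le> q" "q \<le> n" using s(1) Share_b by (auto simp: ok_def)
    have "i \<le> p \<and> q < j \<or> p < i \<and> j < q" using s(1) Share_b by (simp add: ok_def)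
    then have "ub_split l r (int m) (int n) (int m + int n - 1 - d) (B (int p) (int q))"
    proof
      assume "i \<le> p \<and> q < j"
      then show ?thesis using c b unfolding ub_check_def prod.case
        by (elim conjE) (erule ub_rectD; simp)
    next
      assume "p < i \<and> j < q"
      then show ?thesis using c b unfolding ub_check_def prod.case
        by (elim conjE) (erule ub_rectD; simp)
    qed
    moreover have "\<not> (q = 1 \<and> l = Slash)" "\<not> (q = n \<and> r = Backslash)"
      using s(1) Share_b by (auto simp: ok_def)
    moreover have e: "int (m - p) = int m - int p" "int (n - q + 1) = int n - int q + 1" using b by auto
    ultimately have "ubv l Backslash (int p) (int q) + ubv Slash r (int (m - p)) (int (n - q + 1)) < int m + int n - 1 - d"
      unfolding e by (simp split: if_splits)
    moreover note ok_dfd(2)[OF s(1) Share_b]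
    moreover from this have "int (M l Backslash p q) \<le> ubv l Backslash (int p) (int q)" using b by (intro U) auto
    moreover from calculation(2) have "int (M Slash r (m - p) (n - q + 1)) \<le> ubv Slash r (int (m - p)) (int (n - q + 1))"
      using b by (intro U) auto
    ultimately show ?thesis unfolding Share_b val.simps by linarith
  qed
  then show ?thesis using s(2) by linarith
qed

definition ub_checked :: "constr \<Rightarrow> constr \<Rightarrow> bool" where
  "ub_checked l r \<longleftrightarrow> (\<forall>m. \<exists>xs. list_all2 (ub_check l r m) (ub_tab l r m) xs)"

lemma ub_okI:
  assumes "\<And>l r. (l, r) \<in> {(Dot, Dot), (Dot, Backslash), (Backslash, Backslash), (Slash, Backslash)} \<Longrightarrow> ub_checked l r"
  shows "ub_ok N"
proof -
  have chk: "\<exists>x. ub_check l r m (n, d) x \<and> r \<noteq> Slash" if "(n, d) \<in> set (ub_tab l r m)" for l r m n d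
  proof -
    have "(l, r) \<in> {(Dot, Dot), (Dot, Backslash), (Backslash, Backslash), (Slash, Backslash)}"
      using that by (cases l; cases r) (auto simp: ub_tab_def)
    then obtain xs where "list_all2 (ub_check l r m) (ub_tab l r m) xs" "r \<noteq> Slash"
      using assms unfolding ub_checked_def by blast
    then show ?thesis using that by (metis in_set_conv_nth list_all2_conv_all_nth)
  qed
  have ge: "1 \<le> m \<and> 1 \<le> n" if "(n, d) \<in> set (ub_tab l r m)" for l r m n d
    using chk[OF that] by (auto simp: ub_check_def)
  have "ub_ok (int k)" for k
  proof (induction k rule: less_induct)
    case (less k)
    show ?case unfolding ub_ok_def
    proof (intro allI impI)
      fix l r m n d assume e: "(n, d) \<in> set (ub_tab l r m)" "m + n \<le> int k"
      obtain i j where x: "ub_check l r m (n, d) (i, j)" "r \<noteq> Slash" using chk[OF e(1)] by auto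
      have g: "1 \<le> m" "1 \<le> n" "1 \<le> i" "1 \<le> j" using ge[OF e(1)] x by (auto simp: ub_check_def)
      have ok: "ub_ok (int (nat m) + int (nat n) - 1)"
      proof (rule ub_ok_mono)
        show "ub_ok (int (k - 1))" using e(2) g by (intro less.IH) linarith
      qed (use e(2) g in linarith)
      show "1 \<le> m \<and> 1 \<le> n \<and> int (M l r (nat m) (nat n)) + d \<le> m + n - 1"
        using ub_check_le[OF ok, of l r d "nat i" "nat j"] x g by simp
    qed
  qed
  from this[of "nat N"] show ?thesis by (rule ub_ok_mono) auto
qed

lemma ub_checkedI:
  assumes "\<And>m. m < lo \<or> hi < m \<Longrightarrow> ub_tab l r m = []" and "map fst cs = [lo..hi]"
    and "list_all (\<lambda>(m, xs). list_all2 (ub_check l r m) (ub_tab l r m) xs) cs"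
  shows "ub_checked l r"
  unfolding ub_checked_def
proof
  fix m
  show "\<exists>xs. list_all2 (ub_check l r m) (ub_tab l r m) xs"
  proof (cases "m < lo \<or> hi < m")
    case False
    then have "m \<in> set (map fst cs)" unfolding assms(2) by auto
    then obtain xs where "(m, xs) \<in> set cs" by auto
    then show ?thesis using assms(3) by (auto simp: list_all_iff)
  qed (use assms(1) in auto)
qed

lemmas ub_simps = ub_tab_def ub_tab_DD_def ub_tab_DB_def ub_tab_BB_def ub_tab_SB_def mx_def
  dfc_DD_def dfc_DB_def dfc_BB_def dfc_SB_def ubv_def ub_check_def  upto.simps

definition ub_cert_DD :: "(int \<times> (int \<times> int) list) list" where
  "ub_cert_DD = [(1, [(1,2), (1,4), (1,4), (1,4), (1,4), (1,8), (1,8), (1,8), (1,8), (1,8), (1,8), (1,8), (1,8), (1,16),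
    (1,16), (1,16), (1,16), (1,16)]), (2, [(2,4), (2,6), (2,6), (2,6), (2,9), (2,9), (2,9), (2,9), (2,13), (2,13),
    (2,13), (2,13), (2,13), (2,13), (2,19), (2,19)]), (3, [(3,5), (3,7), (3,7), (3,9), (3,9), (2,6), (3,12),
    (3,12), (3,14), (3,14), (3,14), (3,14), (3,18), (3,18), (3,18)]), (4, [(4,7), (4,9), (4,9), (4,11), (4,11),
    (4,13), (4,13), (3,12), (4,16), (3,14), (4,16), (4,19), (4,19)]), (5, [(5,8), (5,10), (5,10), (5,12), (5,12),
    (5,14), (5,14), (5,14), (3,9), (4,16)]), (6, [(6,10), (6,12), (5,13), (4,11), (4,14), (5,15)]), (7, [(5,13),
    (5,13), (4,13), (4,13), (4,11)]), (8, [(6,12), (8,16), (8,16), (8,18), (5,13)]), (9, [(5,8), (9,16), (9,17),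
    (9,17), (9,19), (5,12)]), (10, [(10,16)]), (11, []), (12, []), (13, []), (14, [(10,16)])]"

definition ub_cert_DB :: "(int \<times> (int \<times> int) list) list" where
  "ub_cert_DB = [(2, [(2,3), (1,2)]), (3, []), (4, [(3,2), (4,6), (1,2), (1,2), (1,2)]), (5, []), (6, [(2,1)]), (7, [(6,4)]),
    (8, [(5,10)]), (9, [(2,1), (6,10)]), (10, []), (11, []), (12, []), (13, []), (14, []), (15, []), (16,
    [(10,5)]), (17, [(13,2)]), (18, [(18,2), (14,3)]), (19, []), (20, [(20,8)])]"

definition ub_cert_BB :: "(int \<times> (int \<times> int) list) list" where
  "ub_cert_BB = [(4, [(3,5)]), (5, [(4,4), (5,6)])]"

definition ub_cert_SB :: "(int \<times> (int \<times> int) list) list" where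
  "ub_cert_SB = [(1, [(1,2), (1,3)]), (2, []), (3, [(2,5)]), (4, [(3,4), (4,6)]), (5, []), (6, []), (7, [(6,5)])]"

lemma ub_checked_DD: "ub_checked Dot Dot"
proof (rule ub_checkedI[where cs = ub_cert_DD and lo = 1 and hi = 14])
  show "list_all (\<lambda>(m, xs). list_all2 (ub_check Dot Dot m) (ub_tab Dot Dot m) xs) ub_cert_DD"
    unfolding ub_cert_DD_def by (simp add: ub_simps)
  show "map fst ub_cert_DD = [1..14]" unfolding ub_cert_DD_def by (simp add: upto.simps)
qed (auto simp: ub_tab_def ub_tab_DD_def)

lemma ub_checked_DB: "ub_checked Dot Backslash"
proof (rule ub_checkedI[where cs = ub_cert_DB and lo = 2 and hi = 20])
  show "list_all (\<lambda>(m, xs). list_all2 (ub_check Dot Backslash m) (ub_tab Dot Backslash m) xs) ub_cert_DB"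
    unfolding ub_cert_DB_def by (simp add: ub_simps)
  show "map fst ub_cert_DB = [2..20]" unfolding ub_cert_DB_def by (simp add: upto.simps)
qed (auto simp: ub_tab_def ub_tab_DB_def)

lemma ub_checked_SB: "ub_checked Slash Backslash"
proof (rule ub_checkedI[where cs = ub_cert_SB and lo = 1 and hi = 7])
  show "list_all (\<lambda>(m, xs). list_all2 (ub_check Slash Backslash m) (ub_tab Slash Backslash m) xs) ub_cert_SB"
    unfolding ub_cert_SB_def by (simp add: ub_simps)
  show "map fst ub_cert_SB = [1..7]" unfolding ub_cert_SB_def by (simp add: upto.simps)
qed (auto simp: ub_tab_def ub_tab_SB_def)

lemma ub_checked_BB: "ub_checked Backslash Backslash"
proof (rule ub_checkedI[where cs = ub_cert_BB and lo = 4 and hi = 5])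
  show "list_all (\<lambda>(m, xs). list_all2 (ub_check Backslash Backslash m) (ub_tab Backslash Backslash m) xs) ub_cert_BB"
    unfolding ub_cert_BB_def by (simp add: ub_simps)
  show "map fst ub_cert_BB = [4..5]" unfolding ub_cert_BB_def by (simp add: upto.simps)
qed (auto simp: ub_tab_def ub_tab_BB_def)

lemma ub_ok: "ub_ok N"
  using ub_checked_DD ub_checked_DB ub_checked_BB ub_checked_SB by (intro ub_okI) auto

section \<open>The theorem\<close>

lemmas lbv_M = lbv_nat_le[OF lb_ok]
lemmas ubv_M = ubv_le[OF ub_ok]

lemma nat_int_add_63: "nat (int a + 63) = a + 63"
  by linarith

lemma inc_Dot_25_38: "inc Dot Dot 25 38 63"
proof (rule inc_DotI)
  show "63 \<le> M Dot Dot 25 (38 + 1)" using lbv_M[of Dot Dot 25 39 63] by (simp add: table_simps)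
  show "63 \<le> M Dot Dot (25 + 1) 38" using lbv_M[of Dot Dot 26 38 63] by (simp add: table_simps)
  show "63 + 1 \<le> M Backslash Dot (25 + 1) (38 + 1)" using lbv_M[of Backslash Dot 26 39 64] by (simp add: table_simps)
  show "63 + 1 \<le> M Slash Dot (25 + 1) (38 + 1)" using lbv_M[of Slash Dot 26 39 64] by (simp add: table_simps)
next
  fix l m n i j assume h: "reg l m n" "1 \<le> i" "i \<le> m + 25" "1 \<le> j" "j \<le> n + 38" "m < i \<or> n < j"
  have nX: "\<And>p q. X p q \<notin> set top_cert_DD" by (simp add: top_cert_DD_def)
  have "reaches l Dot (m + 25) (n + 38) i j (nat (int (M l Dot m (n + sh Dot)) + 63))"
    by (rule inc_cells_reaches[OF lb_ok inc_ok_Dot _ _ _ h(1-5)]) (use h(6) nX top_cells_DD in \<open>auto simp: sh_def\<close>)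
  then show "reaches l Dot (m + 25) (n + 38) i j (M l Dot m n + 63)"
    by (simp add: sh_def nat_int_add_63)
qed simp_all

text \<open>Only \<open>n = 1\<close> escapes the regular case. There the small value is at most 1,
  and 64 at (26, 39) suffices by monotonicity.\<close>

lemma M_Slash_Dot_25_38:
  assumes "1 \<le> m" "1 \<le> n"
  shows "M Slash Dot m n + 63 \<le> M Slash Dot (m + 25) (n + 38)"
proof (cases "n = 1")
  case True
  have "64 \<le> M Slash Dot 26 39" using lbv_M[of Slash Dot 26 39 64] by (simp add: table_simps)
  also have "\<dots> \<le> M Slash Dot (m + 25) (n + 38)" by (rule M_mono) (use assms in auto)
  finally show ?thesis using M_Slash_Dot_1[of m] True by simp
qed (use assms in \<open>intro incD[OF inc_Dot_25_38]; auto simp: reg_def\<close>)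

lemma M_Backslash_Dot_25_38:
  assumes "1 \<le> m" "1 \<le> n"
  shows "M Backslash Dot m n + 63 \<le> M Backslash Dot (m + 25) (n + 38)"
proof (cases "m = 1")
  case True
  have "64 \<le> M Backslash Dot 26 39" using lbv_M[of Backslash Dot 26 39 64] by (simp add: table_simps)
  also have "\<dots> \<le> M Backslash Dot (m + 25) (n + 38)" by (rule M_mono) (use assms in auto)
  finally show ?thesis using M_Backslash_Dot_1[of n] True by simp
qed (use assms in \<open>intro incD[OF inc_Dot_25_38]; auto simp: reg_def\<close>)

lemma M_Dot_Dot_25_38:
  assumes "1 \<le> m + n"
  shows "M Dot Dot m n + 63 \<le> M Dot Dot (m + 25) (n + 38)"
proof (cases "1 \<le> m \<and> 1 \<le> n")
  case True
  then show ?thesis by (intro incD[OF inc_Dot_25_38]) (simp add: reg_def)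
next
  case False
  have l: "63 \<le> M Dot Dot 25 39" "63 \<le> M Dot Dot 26 38"
    using lbv_M[of Dot Dot 25 39 63] lbv_M[of Dot Dot 26 38 63] by (simp_all add: table_simps)
  have "M Dot Dot 25 39 \<le> M Dot Dot (m + 25) (n + 38) \<or> M Dot Dot 26 38 \<le> M Dot Dot (m + 25) (n + 38)"
    using False assms M_mono[of Dot Dot 25 39 "m + 25" "n + 38"] M_mono[of Dot Dot 26 38 "m + 25" "n + 38"] by auto
  then show ?thesis using l False by (auto simp: not_le)
qed

section \<open>Right constraint \<open>Backslash\<close>: answers obtained from the right
  end\<close>

definition jumps :: "constr \<Rightarrow> nat \<Rightarrow> nat \<Rightarrow> nat \<Rightarrow> nat \<Rightarrow> bool" where
  "jumps l x y m n \<longleftrightarrow> M l Backslash m n + 63 \<le> M l Backslash (m + x) (n + y)"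

text \<open>Reversal turns the type into \<open>Slash\<close>, \<open>Dot\<close>, and exchanging
  the lists as well turns it into \<open>Backslash\<close>, \<open>Dot\<close>; the increment for
  \<open>Dot\<close> settles both.\<close>

lemma jumps_Dot:
  assumes "1 \<le> m" "1 \<le> n"
  shows "jumps Dot 25 38 m n" "jumps Dot 38 25 m n"
  using M_Slash_Dot_25_38[OF assms] M_Backslash_Dot_25_38[OF assms(2,1)]
  by (simp_all add: jumps_def M_Slash_Dot M_Backslash_Dot)

text \<open>
  The cells left open by a certificate, shifted back from the base point \<open>(m, n - 1)\<close> to \<open>(m, n)\<close>.
\<close>

definition exempt :: "opt list \<Rightarrow> (int \<times> int) list" where
  "exempt os = [(p + 1, q). X p q \<leftarrow> os]"

lemma exempt_BB: "exempt top_cert_BB = [(1, 1), (5, 7), (11, 15), (15, 23), (21, 31), (25, 37)]"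
  by (simp add: exempt_def top_cert_BB_def)

lemma exempt_BB': "exempt top_cert_BB' = [(1, 0), (7, 4), (15, 10), (23, 14), (31, 20), (37, 24)]"
  by (simp add: exempt_def top_cert_BB'_def)

lemma cells_reaches_exempt:
  assumes c: "inc_cells Backslash Backslash (int x) (int (y + 1)) 63 os" and rg: "reg l m (n - 1)"
    and ij: "1 \<le> i" "i \<le> m + x" "1 \<le> j" "j \<le> n + y" "m < i \<or> n < j"
    and ex: "(int i - int m, int j - int n) \<notin> set (exempt os)"
  shows "reaches l Backslash (m + x) (n + y) i j (M l Backslash m n + 63)"
proof -
  have n: "n - 1 + (y + 1) = n + y" "n - 1 + 1 = n" "j \<le> n - 1 + (y + 1)" "int (n - 1) = int n - 1"
    using rg ij by (auto simp: reg_def)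
  have X: "(p + 1, q) \<in> set (exempt os)" if "X p q \<in> set os" for p q
    using that by (force simp: exempt_def)
  have "reaches l Backslash (m + x) (n - 1 + (y + 1)) i j (nat (int (M l Backslash m (n - 1 + sh Backslash)) + 63))"
  proof (rule inc_cells_reaches[OF lb_ok inc_ok_Dot inc_ok_Backslash _ c rg ij(1-3) n(3)])
    show "m < i \<or> n - 1 + sh Backslash < j" using ij(5) n(2) by (simp add: sh_def)
    fix p q assume a: "X p q \<in> set os" "int i = int m + p + 1" "int j = int (n - 1) + q + 1"
    then have "int i - int m = p + 1" "int j - int n = q" using n(4) by auto
    then show False using X[OF a(1)] ex by simp
  qed simp
  then show ?thesis unfolding n(1) using n(2) by (simp add: sh_def nat_int_add_63)
qed

text \<open>The hypothesis \<open>IH\<close> can be asked for all regular problems: the exceptional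
  pair (1, 1) of type \<open>Backslash\<close>, \<open>Backslash\<close> is not regular.\<close>

lemma reaches_25_38:
  assumes IH: "\<And>l' m' n'. m' + n' < m + n \<Longrightarrow> reg l' m' n' \<Longrightarrow> jumps l' 25 38 m' n'"
    and rg: "reg l m (n - 1)" and ij: "1 \<le> i" "i \<le> m + 25" "1 \<le> j" "j \<le> n + 38"
    and ex: "(int i - int m, int j - int n) \<notin> set (exempt top_cert_BB)"
  shows "reaches l Backslash (m + 25) (n + 38) i j (M l Backslash m n + 63)"
proof (cases "m < i \<or> n < j")
  case True
  then show ?thesis using cells_reaches_exempt[OF _ rg ij _ ex] top_cells_BB by simp
next
  case False
  have caps: "63 \<le> M Dot Backslash 25 (38 + 1)" "63 + 1 \<le> M Backslash Backslash (25 + 1) (38 + 2)"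
    using lbv_M[of Dot Backslash 25 39 63] lbv_M[of Backslash Backslash 26 40 64]
    by (simp_all add: table_simps dfd_def)
  have d: "dfd l Backslash m n" using rg by (auto simp: reg_def dfd_def)
  show ?thesis
    by (rule transplant_Backslash[where E = "\<lambda>_ _ _. False", OF _ _ caps _ _ ij(1) _ ij(3) _ d])
      (use IH False in \<open>auto simp: jumps_def\<close>)
qed

section \<open>Corner estimates for the shift (38, 25)\<close>

text \<open>Compare \<open>a 1\<close> with \<open>b a\<close> first. If it is smaller, linear
  merging needs at most \<open>a - 1\<close> further comparisons; otherwise a problem no larger than
  \<open>(1, k)\<close> remains.\<close>

lemma M_Dot_Backslash_1_add:
  assumes "1 \<le> a" "1 \<le> k"
  shows "M Dot Backslash 1 (k + a) \<le> 1 + max (a - 1) (M Dot Backslash 1 k)"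
proof (rule M_leI)
  fix s assume s: "ok Dot Backslash 1 (k + a) 1 a s"
  show "1 + val Dot Backslash 1 (k + a) s \<le> 1 + max (a - 1) (M Dot Backslash 1 k)"
  proof (cases s)
    case (Simple p q)
    then consider "p = 1" "q < a" | "p = 0" "a \<le> q" using s by (auto simp: ok_def)
    then show ?thesis
    proof cases
      case 1
      have "M Dot Dot 1 q \<le> q" using M_tape[of Dot Dot 1 q] by (cases "q = 0") auto
      then have "M Dot Dot 1 q \<le> a - 1" using 1 by linarith
      then show ?thesis using 1 Simple by simp
    next
      case 2
      have "M Dot Backslash 1 (k + a - q) \<le> M Dot Backslash 1 k" by (rule M_mono) (use 2 in auto)
      then show ?thesis using 2 Simple by simp
    qed
  qed (use s in \<open>auto simp: ok_def\<close>)
qed (use assms in auto)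

lemma M_Dot_Backslash_1_shift:
  assumes "14 \<le> k"
  shows "M Dot Backslash 1 k + 64 \<le> M Dot Backslash 38 (k + 25)"
proof -
  \<comment> \<open>The 12 is 37 - 25. Passing from \<open>k\<close> to \<open>k'\<close> loses at
    most 10, because \<open>1 + 11 = 10 + 2\<close> and \<open>M Dot Backslash 1 k'\<close> is at
    least 2. Then 37 diagonal steps gain 74, which leaves 64.\<close>
  define k' where "k' = k - 12"
  have k: "k = k' + 12" "2 \<le> k'" using assms by (auto simp: k'_def)
  have "2 \<le> M Dot Backslash 1 2" using M_Slash_Dot_1_2 by (simp add: M_Slash_Dot)
  also have "\<dots> \<le> M Dot Backslash 1 k'" by (rule M_mono) (use k in auto)
  finally have "M Dot Backslash 1 k \<le> 10 + M Dot Backslash 1 k'"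
    using M_Dot_Backslash_1_add[of 12 k'] k by simp
  moreover have "M Dot Backslash 1 k' + 2 * 37 \<le> M Dot Backslash (1 + 37) (k' + 37)"
    using k by (intro incD[OF inc_diag]) (auto simp: reg_def)
  ultimately show ?thesis unfolding k(1) by (simp add: add.commute)
qed

lemma M_Slash_Backslash_1_le: "1 \<le> k \<Longrightarrow> M Slash Backslash 1 (k + 1) \<le> 1 + M Dot Backslash 1 k"
  using M_Backslash_le[of Slash 1 "k + 1"] by (simp add: M_Slash_Dot dfd_def)

text \<open>Needed when a cut moves from before \<open>a m\<close> to after it: the second part then
  has only the 38 new elements of \<open>a\<close>, so 37 additional ones must bring the full 63.
  Short \<open>b\<close> lists are decided by the tables of upper and lower bounds.\<close>

lemma corner_A:
  assumes "3 \<le> k"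
  shows "M Dot Backslash 1 k + 63 \<le> M Dot Backslash 38 (k + 25)"
proof (cases "14 \<le> k")
  case False
  with assms have "k = 3 \<or> k = 4 \<or> k = 5 \<or> k = 6 \<or> k = 7 \<or> k = 8 \<or> k = 9 \<or> k = 10 \<or> k = 11 \<or> k = 12 \<or> k = 13"
    by presburger
  then have "63 + ubv Dot Backslash 1 (int k) \<le> lbv Dot Backslash 38 (int k + 25)"
    by (elim disjE) (simp_all add: table_simps ub_simps)
  then show ?thesis using ubv_M[of Dot Backslash 1 k] lbv_M[of Dot Backslash 38 "k + 25"]
    by fastforce
qed (use M_Dot_Backslash_1_shift[of k] in simp)

text \<open>For small \<open>k\<close> the shared \<open>b\<close> is kept and the type stays
  \<open>Slash\<close>, \<open>Backslash\<close>. For large \<open>k\<close> a plain cut suffices: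
  \<open>M_Slash_Backslash_1_le\<close> loses 1, which is why \<open>M_Dot_Backslash_1_shift\<close>
  provides 64 instead of 63.\<close>

lemma corner_B:
  assumes "3 \<le> k"
  shows "M Slash Backslash 1 (k + 1) + 63 \<le> M Dot Backslash 38 (k + 25) \<or>
    M Slash Backslash 1 (k + 1) + 63 \<le> M Slash Backslash 38 (k + 26)"
proof (cases "14 \<le> k")
  case False
  with assms have "k = 3 \<or> k = 4 \<or> k = 5 \<or> k = 6 \<or> k = 7 \<or> k = 8 \<or> k = 9 \<or> k = 10 \<or> k = 11 \<or> k = 12 \<or> k = 13"
    by presburger
  then have "63 + ubv Slash Backslash 1 (int k + 1) \<le> lbv Slash Backslash 38 (int k + 26)"
    by (elim disjE) (simp_all add: table_simps ub_simps)
  then have "int (M Slash Backslash 1 (k + 1)) + 63 \<le> int (M Slash Backslash 38 (k + 26))"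
    using ubv_M[of Slash Backslash 1 "k + 1"] lbv_M[OF _ order.refl, of Slash Backslash 38 "k + 26"] assms
    by (simp add: dfd_def add.commute)
  then show ?thesis by linarith
qed (use M_Dot_Backslash_1_shift[of k] M_Slash_Backslash_1_le[of k] in simp)

text \<open>Here the shared \<open>b\<close> is given up to the first part, so the \<open>b\<close>
  list grows by 24 only, from \<open>k + 1\<close> to \<open>k + 25\<close>.\<close>

lemma corner_C:
  assumes "2 \<le> k"
  shows "M Slash Backslash 1 (k + 1) + 63 \<le> M Dot Backslash 39 (k + 25)"
proof (cases "14 \<le> k")
  case False
  with assms have "k = 2 \<or> k = 3 \<or> k = 4 \<or> k = 5 \<or> k = 6 \<or> k = 7 \<or> k = 8 \<or> k = 9 \<or> k = 10 \<or> k = 11 \<or> k = 12 \<or> k = 13"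
    by presburger
  then have "63 + ubv Slash Backslash 1 (int k + 1) \<le> lbv Dot Backslash 39 (int k + 25)"
    by (elim disjE) (simp_all add: table_simps ub_simps)
  then have "int (M Slash Backslash 1 (k + 1)) + 63 \<le> int (M Dot Backslash 39 (k + 25))"
    using ubv_M[of Slash Backslash 1 "k + 1"] lbv_M[OF _ order.refl, of Dot Backslash 39 "k + 25"] assms
    by (simp add: dfd_def add.commute)
  then show ?thesis by linarith
next
  case True
  have "M Dot Backslash 38 (k + 25) \<le> M Dot Backslash 39 (k + 25)" by (rule M_mono) auto
  then show ?thesis using M_Dot_Backslash_1_shift[OF True] M_Slash_Backslash_1_le[of k] True by simp
qed

lemma corner_D: "64 \<le> M Dot Backslash 38 28" "65 \<le> M Dot Backslash 39 27"
  using lbv_M[of Dot Backslash 38 28 64] lbv_M[of Dot Backslash 39 27 65] by (simp_all add: table_simps)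

text \<open>
  For the shift (38, 25) the problem of type \<open>Slash\<close>, \<open>Backslash\<close> and size (1, 2) gains only 62. It arises as
  the second part of \<open>Share_b (m - 1) (n - 1)\<close>, which cannot be bypassed for the comparison of \<open>a m\<close> with \<open>b j\<close>,
  \<open>j \<le> n - 2\<close>; there one follows the small problem on the comparison of \<open>a (m - 1)\<close> with \<open>b (j + 1)\<close> instead.
\<close>

definition pinned :: "constr \<Rightarrow> nat \<Rightarrow> nat \<Rightarrow> bool" where
  "pinned l m n \<longleftrightarrow> l = Slash \<and> m = 1 \<and> n = 2"

lemma reaches_corner:
  assumes IH: "\<And>l' m' n'. m' + n' < m + n \<Longrightarrow> reg l' m' n' \<Longrightarrow> \<not> pinned l' m' n' \<Longrightarrow> jumps l' 38 25 m' n'"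
    and d: "dfd l Backslash m n" and j: "1 \<le> j" "j + 2 \<le> n" and m: "1 \<le> m"
  shows "reaches l Backslash (m + 38) (n + 25) m j (M l Backslash m n + 63)"
proof -
  have caps: "63 \<le> M Dot Backslash 38 (25 + 1)" "63 + 1 \<le> M Backslash Backslash (38 + 1) (25 + 2)"
    using lbv_M[of Dot Backslash 38 26 63] lbv_M[of Backslash Backslash 39 27 64]
    by (simp_all add: table_simps dfd_def)
  \<comment> \<open>An answer to some cell of the small problem may be kept if it also separates
    \<open>a m\<close> from \<open>b j\<close> and its second part is not the pinned one, which the
    condition on \<open>Share_b\<close> ensures.\<close>
  have same: ?thesis
    if s: "ok l Backslash m n i' j' s" "1 \<le> i'" "i' \<le> m" "1 \<le> j'" "j' \<le> n"
      "ok l Backslash m n m j s" "M l Backslash m n \<le> 1 + val l Backslash m n s"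
      "\<And>p h. s \<noteq> Share_b p h \<or> p + 1 < m" for i' j' s
  proof -
    have "val l Backslash m n s + 63 \<le> val l Backslash (m + 38) (n + 25) s"
    proof (rule transplant_Backslash_val[where E = pinned, OF _ _ caps])
      show "s \<noteq> Share_a m (n - 1)" using s(6) j by (auto simp: ok_def)
      show "\<not> pinned Slash (m - p) (n - h + 1)" if "s = Share_b p h" for p h
        using s(8)[of p h] that by (auto simp: pinned_def)
      show "ok l Backslash m n m j s" "1 \<le> m" "m \<le> m" "1 \<le> j" "j \<le> n" using s(6) m j by auto
      show "M l' Backslash m' n' + 63 \<le> M l' Backslash (m' + 38) (n' + 25)"
        if "m' + n' < m + n" "reg l' m' n'" "\<not> pinned l' m' n'" for l' m' n'
        using IH[OF that] by (simp add: jumps_def)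
    qed (auto simp: pinned_def)
    moreover have "ok l Backslash (m + 38) (n + 25) m j s" using s(6) j by (intro ok_extend) auto
    ultimately show ?thesis using s(7) by (intro reachesI[of _ _ _ _ _ _ s]) auto
  qed
  show ?thesis
  proof (cases "m = 1")
    case True
    obtain s where s: "ok l Backslash m n m j s" "M l Backslash m n \<le> 1 + val l Backslash m n s"
      using M_le_split[OF d, of m j] m j by auto
    show ?thesis by (rule same[OF s(1) _ _ _ _ s]) (use s(1) True m j in \<open>auto simp: ok_def\<close>)
  next
    case False
    then have m2: "2 \<le> m" using m by simp
    have "1 \<le> m - 1" "m - 1 \<le> m" "1 \<le> j + 1" "j + 1 \<le> n" using m2 j by linarith+
    then obtain s where s: "ok l Backslash m n (m - 1) (j + 1) s" "M l Backslash m n \<le> 1 + val l Backslash m n s"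
      using M_le_split[OF d] by blast
    note same = same[OF s(1) _ _ _ _ _ s(2)]
    have okm: "ok l Backslash (m + 38) (n + 25) m j (Simple m q)" if "q < j" "q = 0 \<longrightarrow> l \<noteq> Slash" for q
      using that m2 j by (auto simp: ok_def)
    have okj: "ok l Backslash (m + 38) (n + 25) m j (Simple (m - 1) j)"
      using m2 j by (auto simp: ok_def)
    \<comment> \<open>All other answers are replaced by a plain cut: \<open>low\<close> puts
      \<open>a m\<close> below \<open>b j\<close> by cutting after \<open>a m\<close> and
      \<open>b q\<close> with \<open>q < j\<close>; \<open>high\<close> puts it above by cutting
      right after \<open>a (m - 1)\<close> and \<open>b j\<close>. The 62 is 63 minus the comparison
      made.\<close>
    have low: ?thesis if "q < j" "q = 0 \<longrightarrow> l \<noteq> Slash" "M l Backslash m n + 62 \<le> M l Dot m q + M Dot Backslash 38 (n - q + 25)" for q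
    proof -
      have e: "n + 25 - q = n - q + 25" "m + 38 - m = 38" using that(1) j by linarith+
      show ?thesis
        by (rule reachesI[OF okm[OF that(1,2)]]; unfold val.simps e) (use that(3) in linarith)
    qed
    have high: ?thesis if "M l Backslash m n + 62 \<le> M l Dot (m - 1) j + M Dot Backslash 39 (n - j + 25)"
    proof -
      have e: "n + 25 - j = n - j + 25" "m + 38 - (m - 1) = 39" using m2 j by linarith+
      show ?thesis
        by (rule reachesI[OF okj]; unfold val.simps e) (use that in linarith)
    qed
    have D38: "64 \<le> M Dot Backslash 38 (n - q + 25)" if "q < j" for q
      using order.trans[OF corner_D(1) M_mono[of Dot Backslash 38 28 38 "n - q + 25"]] that j by simp
    have D39: "65 \<le> M Dot Backslash 39 (n - j + 25)"
      using order.trans[OF corner_D(2) M_mono[of Dot Backslash 39 27 39 "n - j + 25"]] j by simp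
    have mono: "M l Dot (m - 1) q \<le> M l Dot m q" for q by (rule M_mono) auto
    show ?thesis
    proof (cases s)
      case (Simple p q)
      have pq: "p \<le> m" "q \<le> n" "p = 0 \<longrightarrow> l \<noteq> Backslash" "q = 0 \<longrightarrow> l \<noteq> Slash" "q < n"
        "m - 1 \<le> p \<and> q \<le> j \<or> p + 1 < m \<and> j < q"
        using s(1) Simple by (auto simp: ok_def)
      from pq(1,6) m2 consider "p + 1 < m" "j < q" | "p + 1 = m" "q = j" | "p + 1 = m" "q < j" | "p = m" "q < j" | "p = m" "q = j"
        by linarith
      then show ?thesis
      proof cases
        case 1
        then show ?thesis using pq m2 j by (intro same) (auto simp: ok_def Simple)
      next
        case 2
        then show ?thesis using pq m2 j by (intro same) (auto simp: ok_def Simple)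
      next
        \<comment> \<open>This cut puts both \<open>a m\<close> and \<open>b j\<close> into its
          second part. Moving \<open>a m\<close> to the first part separates them, and by
          \<open>corner_A\<close> the second part still gains 63.\<close>
        case 3
        then have p: "p = m - 1" "m - p = 1" by linarith+
        have "M Dot Backslash 1 (n - q) + 63 \<le> M Dot Backslash 38 (n - q + 25)" using 3 j by (intro corner_A) linarith
        then show ?thesis using s(2) pq(4) 3(2) mono[of q] unfolding Simple val.simps p(2) unfolding p(1)
          by (intro low[of q]) simp_all
      next
        case 4
        then show ?thesis using s(2) pq(4) D38[of q] unfolding Simple 4(1) by (intro low[of q]) auto
      next
        \<comment> \<open>The cut \<open>Simple m j\<close> has \<open>a m\<close> and
          \<open>b j\<close> in the same part. \<open>M_Dot_le\<close> retreats to
          \<open>(m - 1, j)\<close> or \<open>(m, j - 1)\<close> at a loss of 1, which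
          \<open>corner_D\<close> makes up for. With \<open>l = Slash\<close> and
          \<open>j = 1\<close> the second retreat would be inconsistent, but then the value is at
          most 1.\<close>
        case 5
        have le: "M l Dot m j \<le> 1 + M l Dot (m - 1) j \<or> (j - 1 = 0 \<longrightarrow> l \<noteq> Slash) \<and> M l Dot m j \<le> 1 + M l Dot m (j - 1)"
        proof (cases "l = Slash \<and> j = 1")
          case True
          then show ?thesis using M_Slash_Dot_1[of m] by simp
        next
          case False
          then show ?thesis using M_Dot_le[of m j l] m j by (auto simp: max_def split: if_splits)
        qed
        have "M l Backslash m n \<le> 1 + M l Dot m j" using s(2) 5 unfolding Simple by simp
        with le consider "M l Backslash m n \<le> 2 + M l Dot (m - 1) j"
          | "j - 1 = 0 \<longrightarrow> l \<noteq> Slash" "M l Backslash m n \<le> 2 + M l Dot m (j - 1)" by linarith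
        then show ?thesis
        proof cases
          case 1
          then show ?thesis using D39 by (intro high) linarith
        next
          case 2
          have "j - 1 < j" using j by linarith
          then show ?thesis using 2 D38[of "j - 1"] by (intro low[of "j - 1"]) linarith+
        qed
      qed
    next
      case (Share_a k q)
      have kq: "1 \<le> k" "k \<le> m" "1 \<le> q" "q + 1 \<le> n" "l = Backslash \<longrightarrow> 2 \<le> k" "m - 1 < k \<and> q \<le> j \<or> k + 1 < m \<and> j < q"
        using s(1) Share_a by (auto simp: ok_def)
      show ?thesis
      proof (cases "k + 1 < m")
        case True
        then show ?thesis using kq m2 j by (intro same) (auto simp: ok_def Share_a)
      next
        case False
        then have k: "k = m" "m - k + 1 = 1" and q: "q \<le> j" using kq by linarith+
        have "M Backslash Backslash 1 (n - q) \<le> 1"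
          using M_le_Dot[of Backslash Backslash 1 "n - q"] M_Backslash_Dot_1[of "n - q"] by (simp add: dfd_def)
        then have b: "M l Backslash m n \<le> 2 + M l Slash m q" using s(2) unfolding Share_a val.simps k(2) unfolding k(1) by linarith
        have dq: "dfd l Slash m q" using m2 by (auto simp: dfd_def)
        show ?thesis
        proof (cases "q = j")
          case True
          \<comment> \<open>Here the 65 of \<open>corner_D\<close> is used up exactly: 62, and 1
            each for the comparison in the small problem, its second part and this step.\<close>
          have "M l Slash m q \<le> 1 + M l Dot (m - 1) q" using M_Slash_le[OF dq] m kq by simp
          then show ?thesis using b D39 unfolding True by (intro high) linarith
        next
          case False
          then have "q < j" using q by simp
          then show ?thesis using b M_le_Dot[OF dq] D38[of q] kq by (intro low[of q]) linarith+
        qed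
      qed
    next
      case (Share_b p h)
      have ph: "1 \<le> p" "p + 1 \<le> m" "1 \<le> h" "h < n" "l = Slash \<longrightarrow> 2 \<le> h" "m - 1 \<le> p \<and> h \<le> j \<or> p + 1 < m \<and> j + 1 < h"
        using s(1) Share_b by (auto simp: ok_def)
      show ?thesis
      proof (cases "p + 1 < m")
        case True
        then show ?thesis using ph m2 j by (intro same) (auto simp: ok_def Share_b)
      next
        case False
        then have p: "p = m - 1" "m - p = 1" and h: "h \<le> j" using ph by linarith+
        have b: "M l Backslash m n \<le> 1 + (M l Backslash (m - 1) h + M Slash Backslash 1 (n - h + 1))"
          using s(2) unfolding Share_b val.simps p(2) unfolding p(1) .
        have dh: "dfd l Backslash (m - 1) h" using ph by (auto simp: dfd_def)
        show ?thesis
        proof (cases "h = j")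
          case True
          have "M Slash Backslash 1 (n - h + 1) + 63 \<le> M Dot Backslash 39 (n - h + 25)" using True j by (intro corner_C) linarith
          then show ?thesis using b M_le_Dot[OF dh] unfolding True by (intro high) linarith
        next
          case False
          then have h: "h < j" using h by simp
          then have "3 \<le> n - h" using j by linarith
          from corner_B[OF this] show ?thesis
          proof
            assume "M Slash Backslash 1 (n - h + 1) + 63 \<le> M Dot Backslash 38 (n - h + 25)"
            then show ?thesis using b M_le_Dot[OF dh] mono[of h] h ph by (intro low[of h]) linarith+
          next
            assume B: "M Slash Backslash 1 (n - h + 1) + 63 \<le> M Slash Backslash 38 (n - h + 26)"
            have o: "ok l Backslash (m + 38) (n + 25) m j (Share_b m h)" using ph h j m2 by (auto simp: ok_def)
            have "M l Backslash (m - 1) h \<le> M l Backslash m h" using dh by (rule M_mono) auto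
            moreover have "m + 38 - m = 38" "n + 25 - h + 1 = n - h + 26" using h j by linarith+
            ultimately show ?thesis using b B by (intro reachesI[OF o]) (simp only: val.simps)
          qed
        qed
      qed
    qed
  qed
qed

lemma reaches_38_25:
  assumes IH: "\<And>l' m' n'. m' + n' < m + n \<Longrightarrow> reg l' m' n' \<Longrightarrow> \<not> pinned l' m' n' \<Longrightarrow> jumps l' 38 25 m' n'"
    and rg: "reg l m (n - 1)" and ij: "1 \<le> i" "i \<le> m + 38" "1 \<le> j" "j \<le> n + 25"
    and ex: "(int i - int m, int j - int n) \<notin> set (exempt top_cert_BB')"
  shows "reaches l Backslash (m + 38) (n + 25) i j (M l Backslash m n + 63)"
proof -
  have d: "dfd l Backslash m n" using rg by (auto simp: reg_def dfd_def)
  have m: "1 \<le> m" using rg by (simp add: reg_def)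
  consider "m < i \<or> n < j" | "i = m" "j + 2 \<le> n" | "i \<le> m" "j \<le> n" "\<not> (i = m \<and> j < n - 1)" by linarith
  then show ?thesis
  proof cases
    case 1
    then show ?thesis using cells_reaches_exempt[OF _ rg ij _ ex] top_cells_BB' by simp
  next
    case 2
    show ?thesis unfolding 2(1) by (rule reaches_corner[OF IH d ij(3) 2(2) m])
  next
    case 3
    have caps: "63 \<le> M Dot Backslash 38 (25 + 1)" "63 + 1 \<le> M Backslash Backslash (38 + 1) (25 + 2)"
      using lbv_M[of Dot Backslash 38 26 63] lbv_M[of Backslash Backslash 39 27 64]
      by (simp_all add: table_simps dfd_def)
    show ?thesis
      by (rule transplant_Backslash[where E = pinned, OF _ _ caps _ _ ij(1) 3(1) ij(3) 3(2) d])
        (use IH 3 in \<open>auto simp: jumps_def pinned_def\<close>)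
  qed
qed

section \<open>Combining the extensions at both ends\<close>

lemma val_rvs:
  assumes s: "ok l r m n i j s" and ij: "1 \<le> i" "i \<le> m" "1 \<le> j" "j \<le> n"
  shows "val (flip r) (flip l) m n (rvs m n s) = val l r m n s"
proof (cases s)
  case (Simple p q)
  then have "p \<le> m" "q \<le> n" using s by (auto simp: ok_def)
  then show ?thesis using Simple M_rev[of l Dot p q] M_rev[of Dot r "m - p" "n - q"] by simp
next
  case (Share_a k q)
  then have "k \<le> m" "1 \<le> k" "1 \<le> q" "q < n" using s by (auto simp: ok_def)
  then show ?thesis using Share_a M_rev[of l Slash k q] M_rev[of Backslash r "m - k + 1" "n - q"] ok_dfd(1)[OF s Share_a]
    by simp
next
  case (Share_b p h)
  then have "p < m" "1 \<le> p" "1 \<le> h" "h \<le> n" using s by (auto simp: ok_def)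
  then show ?thesis using Share_b M_rev[of l Backslash p h] M_rev[of Slash r "m - p" "n - h + 1"] ok_dfd(2)[OF s Share_b]
    by simp
qed

lemma reaches_rev:
  assumes "reaches l r m n (m + 1 - i) (n + 1 - j) c" and ij: "1 \<le> i" "i \<le> m" "1 \<le> j" "j \<le> n"
  shows "reaches (flip r) (flip l) m n i j c"
proof -
  obtain s where s: "ok l r m n (m + 1 - i) (n + 1 - j) s" "c \<le> 1 + val l r m n s"
    using assms(1) by (auto simp: reaches_def)
  then show ?thesis using ok_rvs[OF s(1) ij] val_rvs[OF s(1)] ij by (intro reachesI) auto
qed

lemma val_sws:
  assumes s: "ok l r m n i j s"
  shows "val (flip l) (flip r) n m (sws s) = val l r m n s"
proof (cases s)
  case (Simple p q)
  then show ?thesis using M_swap[of l Dot p q] M_swap[of Dot r "m - p" "n - q"] by simp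
next
  case (Share_a k q)
  then show ?thesis using M_swap[of l Slash k q] M_swap[of Backslash r "m - k + 1" "n - q"] ok_dfd(1)[OF s Share_a]
    by simp
next
  case (Share_b p h)
  then show ?thesis using M_swap[of l Backslash p h] M_swap[of Slash r "m - p" "n - h + 1"] ok_dfd(2)[OF s Share_b]
    by simp
qed

lemma reaches_swap: "reaches l r m n j i c \<Longrightarrow> reaches (flip l) (flip r) n m i j c"
  using ok_sws val_sws by (fastforce simp: reaches_def)

text \<open>Reversing and exchanging each lead to type \<open>Slash\<close>, \<open>Slash\<close>,
  but together they preserve \<open>Backslash\<close>, \<open>Backslash\<close>. Thus a left
  extension by (25, 38) is a right extension by (38, 25) in transposed form.\<close>

lemma reaches_BB_transpose:
  assumes "reaches Backslash Backslash n m (n + 1 - j) (m + 1 - i) c" "1 \<le> i" "i \<le> m" "1 \<le> j" "j \<le> n"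
  shows "reaches Backslash Backslash m n i j c"
  using reaches_rev[OF reaches_swap[OF assms(1)]] assms by simp

text \<open>
  The problems \<open>(m, n)\<close> and cells \<open>(u, v)\<close> for which both the right and the left extension fail, with a
  splitting that suffices in view of the upper bounds. The primed table belongs to the shift (38, 25).
\<close>

definition resid_SB :: "(int \<times> int \<times> int \<times> int \<times> opt) list" where
  "resid_SB = [(24, 37, 1, 1, A 26 37), (20, 31, 1, 1, B 20 33), (14, 23, 1, 1, S 16 23), (10, 15, 1, 1, B 10 17), (4,
    7, 1, 1, S 6 7), (20, 31, 5, 7, B 25 37), (16, 25, 5, 7, B 21 31), (10, 17, 5, 7, S 16 23), (6, 9, 5, 7,
    B 11 15), (14, 23, 11, 15, S 25 37), (10, 17, 11, 15, S 21 31), (4, 9, 11, 15, S 15 23), (10, 15, 15,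
    23, B 25 37), (6, 9, 15, 23, B 21 31), (4, 7, 21, 31, S 25 37)]"

definition resid_BB :: "(int \<times> int \<times> int \<times> int \<times> opt) list" where
  "resid_BB = [(25, 37, 1, 1, B 25 39), (21, 31, 1, 1, B 21 33), (15, 23, 1, 1, S 17 23), (11, 15, 1, 1, B 11 17), (5,
    7, 1, 1, S 7 7), (21, 31, 5, 7, B 26 37), (17, 25, 5, 7, B 22 31), (11, 17, 5, 7, S 17 23), (7, 9, 5, 7,
    B 12 15), (15, 23, 11, 15, S 26 37), (11, 17, 11, 15, S 22 31), (5, 9, 11, 15, S 16 23), (11, 15, 15,
    23, B 26 37), (7, 9, 15, 23, B 22 31), (5, 7, 21, 31, S 26 37)]"

definition resid_SB' :: "(int \<times> int \<times> int \<times> int \<times> opt) list" where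
  "resid_SB' = [(37, 26, 1, 0, A 39 25), (31, 22, 1, 0, A 33 21), (23, 16, 1, 0, S 24 15), (15, 12, 1, 0, A 17 11), (7,
    6, 1, 0, S 8 5), (31, 22, 7, 4, A 39 25), (25, 18, 7, 4, A 33 21), (17, 12, 7, 4, S 24 15), (9, 8, 7, 4,
    A 17 11), (23, 16, 15, 10, S 38 25), (17, 12, 15, 10, S 34 21), (9, 6, 15, 10, S 24 15), (15, 12, 23,
    14, A 39 25), (9, 8, 23, 14, A 33 21), (7, 6, 31, 20, S 38 25)]"

fun resid_ok :: "constr \<Rightarrow> int \<Rightarrow> int \<Rightarrow> (int \<times> int \<times> int \<times> int \<times> opt) list \<Rightarrow> bool" where
  "resid_ok l x y [] = True"
| "resid_ok l x y ((m, n, u, v, a) # rs) = (if lb_good l Backslash (m + x) (n + y) (63 + ubv l Backslash m n) a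
     then if cov a (m + u) (n + v) then resid_ok l x y rs else False else False)"

lemma resid_okD:
  "resid_ok l x y rs \<Longrightarrow> (m, n, u, v, a) \<in> set rs \<Longrightarrow>
    lb_good l Backslash (m + x) (n + y) (63 + ubv l Backslash m n) a \<and> cov a (m + u) (n + v)"
  by (induction rs) (auto split: if_splits)

text \<open>\<open>m0\<close> and \<open>n0\<close> discard the problems that
  \<open>jumps_small\<close> treats separately.\<close>

definition resid_covers ::
    "(int \<times> int) list \<Rightarrow> (int \<times> int) list \<Rightarrow> int \<Rightarrow> int \<Rightarrow> int \<Rightarrow> int \<Rightarrow> (int \<times> int \<times> int \<times> int \<times> opt) list \<Rightarrow> bool" where
  "resid_covers R R' x y m0 n0 rs \<longleftrightarrow> (\<forall>(u, v)\<in>set R. \<forall>(u', v')\<in>set R'.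
     x + 1 - u - u' < m0 \<or> y + 1 - v - v' < n0 \<or> (\<exists>a. (x + 1 - u - u', y + 1 - v - v', u, v, a) \<in> set rs))"

text \<open>A cell open from both sides has offsets \<open>(u, v)\<close> from the right and
  \<open>(u', v')\<close> from the left, so \<open>m = x + 1 - u - u'\<close> and
  \<open>n = y + 1 - v - v'\<close>. Hence only the finitely many problems in \<open>rs\<close>
  remain, where one splitting reaches 63 more than the upper bound for the small problem.\<close>

lemma two_sided:
  assumes d: "dfd l Backslash m n" and mn: "1 \<le> m" "1 \<le> n" "m0 \<le> int m" "n0 \<le> int n"
    and right: "\<And>i j. 1 \<le> i \<Longrightarrow> i \<le> m + x \<Longrightarrow> 1 \<le> j \<Longrightarrow> j \<le> n + y \<Longrightarrow>
      (int i - int m, int j - int n) \<notin> set R \<Longrightarrow> reaches l Backslash (m + x) (n + y) i j (M l Backslash m n + 63)"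
    and left: "\<And>i j. 1 \<le> i \<Longrightarrow> i \<le> m + x \<Longrightarrow> 1 \<le> j \<Longrightarrow> j \<le> n + y \<Longrightarrow>
      (int x + 1 - int i, int y + 1 - int j) \<notin> set R' \<Longrightarrow> reaches l Backslash (m + x) (n + y) i j (M l Backslash m n + 63)"
    and rs: "resid_covers R R' (int x) (int y) m0 n0 rs" "resid_ok l (int x) (int y) rs"
  shows "jumps l x y m n"
  unfolding jumps_def
proof (rule M_ge_reaches)
  fix i j assume ij: "1 \<le> i" "i \<le> m + x" "1 \<le> j" "j \<le> n + y"
  show "reaches l Backslash (m + x) (n + y) i j (M l Backslash m n + 63)"
  proof (cases "(int i - int m, int j - int n) \<in> set R \<and> (int x + 1 - int i, int y + 1 - int j) \<in> set R'")
    case True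
    have e: "int x + 1 - (int i - int m) - (int x + 1 - int i) = int m"
      "int y + 1 - (int j - int n) - (int y + 1 - int j) = int n" by auto
    obtain a where "(int m, int n, int i - int m, int j - int n, a) \<in> set rs"
      using rs(1) True mn e unfolding resid_covers_def by fastforce
    from resid_okD[OF rs(2) this]
    have a: "lb_good l Backslash (int (m + x)) (int (n + y)) (63 + ubv l Backslash (int m) (int n)) a"
      "cov a (int i) (int j)" by auto
    have "reaches l Backslash (m + x) (n + y) i j (nat (63 + ubv l Backslash (int m) (int n)))"
      by (rule lb_good_reaches[OF lb_ok a ij])
    then show ?thesis using ubv_M[OF d] by (fastforce simp: reaches_def)
  qed (use right left ij in blast)
qed (use mn in auto)

text \<open>Type \<open>Slash\<close>, \<open>Backslash\<close> is its own reversal, so both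
  extensions leave the same cells open.\<close>

lemma covers_SB: "resid_covers (exempt top_cert_BB) (exempt top_cert_BB) 25 38 1 3 resid_SB"
  unfolding exempt_BB by (simp add: resid_covers_def resid_SB_def)

text \<open>By \<open>reaches_BB_transpose\<close> the left extension comes from the certificate for
  (38, 25), hence the exchanged coordinates.\<close>

lemma covers_BB: "resid_covers (exempt top_cert_BB) (map prod.swap (exempt top_cert_BB')) 25 38 2 2 resid_BB"
  unfolding exempt_BB exempt_BB' by (simp add: resid_covers_def resid_BB_def)

lemma covers_SB': "resid_covers (exempt top_cert_BB') (exempt top_cert_BB') 38 25 1 3 resid_SB'"
  unfolding exempt_BB' by (simp add: resid_covers_def resid_SB'_def)

lemma resid_ok_SB: "resid_ok Slash 25 38 resid_SB"
  unfolding resid_SB_def by (simp add: table_simps ub_simps)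

lemma resid_ok_BB: "resid_ok Backslash 25 38 resid_BB"
  unfolding resid_BB_def by (simp add: table_simps ub_simps)

lemma resid_ok_SB': "resid_ok Slash 38 25 resid_SB'"
  unfolding resid_SB'_def by (simp add: table_simps ub_simps)

lemma jumps_BB_transpose: "jumps Backslash x y m n \<longleftrightarrow> jumps Backslash y x n m"
  unfolding jumps_def by (simp add: M_Backslash_Backslash_commute[of m n] M_Backslash_Backslash_commute[of "m + x"])

text \<open>Collects problems without a regular base point, for the right extension or for the
  transposed one. Their values are at most 1 or 2, so bounds at a single large problem and
  monotonicity suffice.\<close>

lemma jumps_small:
  assumes "1 \<le> m"
  shows "jumps Slash 25 38 m 2" "2 \<le> m \<Longrightarrow> jumps Slash 38 25 m 2"
    "2 \<le> m \<Longrightarrow> jumps Backslash 25 38 m 1" "2 \<le> n \<Longrightarrow> jumps Backslash 25 38 1 n"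
proof -
  have l: "65 \<le> M Slash Backslash 26 40" "65 \<le> M Slash Backslash 40 27" "64 \<le> M Backslash Backslash 27 39" "64 \<le> M Backslash Backslash 26 40"
    using lbv_M[of Slash Backslash 26 40 65] lbv_M[of Slash Backslash 40 27 65]
      lbv_M[of Backslash Backslash 27 39 64] lbv_M[of Backslash Backslash 26 40 64]
    by (simp_all add: table_simps dfd_def)
  have S2: "M Slash Backslash m 2 \<le> 2" using assms by (rule M_Slash_Backslash_2)
  show "jumps Slash 25 38 m 2"
    using S2 l(1) M_mono[of Slash Backslash 26 40 "m + 25" 40] assms by (simp add: jumps_def dfd_def)
  show "2 \<le> m \<Longrightarrow> jumps Slash 38 25 m 2"
    using S2 l(2) M_mono[of Slash Backslash 40 27 "m + 38" 27] by (simp add: jumps_def dfd_def)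
  show "2 \<le> m \<Longrightarrow> jumps Backslash 25 38 m 1"
    using M_Backslash_1[of Backslash m] l(3) M_mono[of Backslash Backslash 27 39 "m + 25" 39] by (simp add: jumps_def dfd_def)
  have "M Backslash Backslash 1 n \<le> 1"
    using M_le_Dot[of Backslash Backslash 1 n] M_Backslash_Dot_1[of n] by (simp add: dfd_def)
  then show "2 \<le> n \<Longrightarrow> jumps Backslash 25 38 1 n"
    using l(4) M_mono[of Backslash Backslash 26 40 26 "n + 38"] by (simp add: jumps_def dfd_def)
qed

text \<open>The three claims need each other: second parts change the left constraint, and the left
  extension for type \<open>Backslash\<close>, \<open>Backslash\<close> exchanges the two shifts.
  The last claim is (f) with the lists exchanged, so its exception (1, 2) becomes (2, 1)
  there.\<close>

lemma jumps_all:
  assumes "m + n = k"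
  shows "(1 \<le> m \<and> 2 \<le> n \<longrightarrow> jumps Slash 25 38 m n) \<and>
    (1 \<le> m \<and> 1 \<le> n \<and> (m, n) \<noteq> (1, 1) \<longrightarrow> jumps Backslash 25 38 m n) \<and>
    (1 \<le> m \<and> 2 \<le> n \<and> (m, n) \<noteq> (1, 2) \<longrightarrow> jumps Slash 38 25 m n)"
  using assms
proof (induction k arbitrary: m n rule: less_induct)
  case (less k)
  have IH: "jumps l 25 38 m' n'" "\<not> pinned l m' n' \<Longrightarrow> jumps l 38 25 m' n'"
    if "m' + n' < k" "reg l m' n'" for l m' n'
    using that less.IH[OF that(1) refl] less.IH[of "n' + m'" n' m'] jumps_Dot[of m' n'] jumps_BB_transpose[of 38 25 m' n']
    by (cases l; force simp: reg_def pinned_def)+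
  have SB: "jumps Slash 25 38 m n" if mn: "1 \<le> m" "2 \<le> n"
  proof (cases "n = 2")
    case False
    then have rg: "reg Slash m (n - 1)" and n3: "3 \<le> int n" using mn by (auto simp: reg_def)
    have R: "reaches Slash Backslash (m + 25) (n + 38) i j (M Slash Backslash m n + 63)"
      if "1 \<le> i" "i \<le> m + 25" "1 \<le> j" "j \<le> n + 38" "(int i - int m, int j - int n) \<notin> set (exempt top_cert_BB)" for i j
      by (rule reaches_25_38[OF IH(1) rg that]) (use less.prems in auto)
    show ?thesis
    proof (rule two_sided[OF _ _ _ _ n3 R])
      fix i j assume ij: "1 \<le> i" "i \<le> m + 25" "1 \<le> j" "j \<le> n + 38"
        and ex: "(int 25 + 1 - int i, int 38 + 1 - int j) \<notin> set (exempt top_cert_BB)"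
      have "int (m + 25 + 1 - i) - int m = int 25 + 1 - int i" "int (n + 38 + 1 - j) - int n = int 38 + 1 - int j"
        using ij by auto
      then have "reaches Slash Backslash (m + 25) (n + 38) (m + 25 + 1 - i) (n + 38 + 1 - j) (M Slash Backslash m n + 63)"
        using ij ex by (intro R) auto
      from reaches_rev[OF this ij]
      show "reaches Slash Backslash (m + 25) (n + 38) i j (M Slash Backslash m n + 63)" by simp
    qed (use mn covers_SB resid_ok_SB in \<open>auto simp: dfd_def\<close>)
  qed (use mn jumps_small in simp)
  have SB': "jumps Slash 38 25 m n" if mn: "1 \<le> m" "2 \<le> n" "(m, n) \<noteq> (1, 2)"
  proof (cases "n = 2")
    case False
    then have rg: "reg Slash m (n - 1)" and n3: "3 \<le> int n" using mn by (auto simp: reg_def)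
    have R: "reaches Slash Backslash (m + 38) (n + 25) i j (M Slash Backslash m n + 63)"
      if "1 \<le> i" "i \<le> m + 38" "1 \<le> j" "j \<le> n + 25" "(int i - int m, int j - int n) \<notin> set (exempt top_cert_BB')" for i j
      by (rule reaches_38_25[OF IH(2) rg that]) (use less.prems in auto)
    show ?thesis
    proof (rule two_sided[OF _ _ _ _ n3 R])
      fix i j assume ij: "1 \<le> i" "i \<le> m + 38" "1 \<le> j" "j \<le> n + 25"
        and ex: "(int 38 + 1 - int i, int 25 + 1 - int j) \<notin> set (exempt top_cert_BB')"
      have "int (m + 38 + 1 - i) - int m = int 38 + 1 - int i" "int (n + 25 + 1 - j) - int n = int 25 + 1 - int j"
        using ij by auto
      then have "reaches Slash Backslash (m + 38) (n + 25) (m + 38 + 1 - i) (n + 25 + 1 - j) (M Slash Backslash m n + 63)"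
        using ij ex by (intro R) auto
      from reaches_rev[OF this ij]
      show "reaches Slash Backslash (m + 38) (n + 25) i j (M Slash Backslash m n + 63)" by simp
    qed (use mn covers_SB' resid_ok_SB' in \<open>auto simp: dfd_def\<close>)
  qed (use mn jumps_small in auto)
  have BB: "jumps Backslash 25 38 m n" if mn: "1 \<le> m" "1 \<le> n" "(m, n) \<noteq> (1, 1)"
  proof (cases "n = 1 \<or> m = 1")
    case False
    then have mn2: "2 \<le> int m" "2 \<le> int n" and rg: "reg Backslash m (n - 1)" "reg Backslash n (m - 1)"
      using mn by (auto simp: reg_def)
    show ?thesis
    proof (rule two_sided[OF _ _ _ mn2 reaches_25_38[OF IH(1) rg(1)]])
      fix i j assume ij: "1 \<le> i" "i \<le> m + 25" "1 \<le> j" "j \<le> n + 38"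
        and ex: "(int 25 + 1 - int i, int 38 + 1 - int j) \<notin> set (map prod.swap (exempt top_cert_BB'))"
      have e: "int (m + 25 + 1 - i) - int m = int 25 + 1 - int i" "int (n + 38 + 1 - j) - int n = int 38 + 1 - int j"
        using ij by auto
      have "(int (n + 38 + 1 - j) - int n, int (m + 25 + 1 - i) - int m) \<notin> set (exempt top_cert_BB')"
        using ex unfolding e by force
      then have "reaches Backslash Backslash (n + 38) (m + 25) (n + 38 + 1 - j) (m + 25 + 1 - i) (M Backslash Backslash n m + 63)"
        using ij less.prems by (intro reaches_38_25[OF IH(2) rg(2)]) auto
      from reaches_BB_transpose[OF this ij]
      show "reaches Backslash Backslash (m + 25) (n + 38) i j (M Backslash Backslash m n + 63)"
        by (simp add: M_Backslash_Backslash_commute[of n m])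
    qed (use mn less.prems covers_BB resid_ok_BB in \<open>auto simp: dfd_def\<close>)
  qed (use mn jumps_small(3)[of m] jumps_small(4)[of m n] in auto)
  show ?case using SB BB SB' by blast
qed

theorem theorem4:
  shows "(\<forall>m n. m + n \<ge> 1 \<longrightarrow> M Dot Dot (m + 25) (n + 38) \<ge> M Dot Dot m n + 63) \<and>
    (\<forall>m n. m \<ge> 1 \<and> n \<ge> 1 \<longrightarrow> M Slash Dot (m + 25) (n + 38) \<ge> M Slash Dot m n + 63) \<and>
    (\<forall>m n. m \<ge> 1 \<and> n \<ge> 1 \<longrightarrow> M Backslash Dot (m + 25) (n + 38) \<ge> M Backslash Dot m n + 63) \<and>
    (\<forall>m n. m \<ge> 1 \<and> n \<ge> 1 \<and>
       M_defined Slash Backslash m n \<and> M_defined Slash Backslash (m + 25) (n + 38) \<longrightarrow>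
       M Slash Backslash (m + 25) (n + 38) \<ge> M Slash Backslash m n + 63) \<and>
    (\<forall>m n. m \<ge> 1 \<and> n \<ge> 1 \<and> (m, n) \<noteq> (1, 1) \<longrightarrow>
       M Backslash Backslash (m + 25) (n + 38) \<ge> M Backslash Backslash m n + 63) \<and>
    (\<forall>m n. m \<ge> 1 \<and> n \<ge> 1 \<and> (m, n) \<noteq> (2, 1) \<and>
       M_defined Backslash Slash m n \<and> M_defined Backslash Slash (m + 25) (n + 38) \<longrightarrow>
       M Backslash Slash (m + 25) (n + 38) \<ge> M Backslash Slash m n + 63)"
proof (intro conjI allI impI; (elim conjE)?)
  fix m n :: nat assume mn: "m \<ge> 1" "n \<ge> 1"
  {
    assume "M_defined Slash Backslash m n"
    then have "2 \<le> n" using M_defined_imp_dfd[of Slash Backslash m n] mn by (simp add: dfd_def)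
    then show "M Slash Backslash (m + 25) (n + 38) \<ge> M Slash Backslash m n + 63"
      using jumps_all[OF refl, of m n] mn by (simp add: jumps_def)
  next
    assume "(m, n) \<noteq> (1, 1)"
    then show "M Backslash Backslash (m + 25) (n + 38) \<ge> M Backslash Backslash m n + 63"
      using jumps_all[OF refl, of m n] mn by (simp add: jumps_def)
  next
    assume "M_defined Backslash Slash m n" and ne: "(m, n) \<noteq> (2, 1)"
    then have m: "2 \<le> m" using M_defined_imp_dfd[of Backslash Slash m n] mn by (simp add: dfd_def)
    then have "M Slash Backslash n m + 63 \<le> M Slash Backslash (n + 38) (m + 25)"
      using jumps_all[OF refl, of n m] mn ne by (auto simp: jumps_def)
    then show "M Backslash Slash (m + 25) (n + 38) \<ge> M Backslash Slash m n + 63"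
      using M_swap[of Slash Backslash n m] M_swap[of Slash Backslash "n + 38" "m + 25"] m by (simp add: dfd_def)
  }
qed (simp_all add: M_Dot_Dot_25_38 M_Slash_Dot_25_38 M_Backslash_Dot_25_38)

end
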